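(* Let the magnetic permeability $\mu=\mu_0$ be constant and let the electric permittivity $\epsilon$ be translationally invariant in $z$ and periodic with respect to a two-dimensional lattice $\mathcal{K}'$, i.e. $\epsilon=\epsilon(\mathbf{x}')$ with $\mathbf{x}'=(x,y)$ and $\epsilon(\mathbf{x}'+\mathbf{k}')=\epsilon(\mathbf{x}')$ for all $\mathbf{x}'\in\mathbb{R}^2$, $\mathbf{k}'\in\mathcal{K}'$, and satisfy $\epsilon>0$, $\epsilon\in \mathrm{L}^\infty$, $\epsilon^{-1}\in \mathrm{L}^\infty$. Let $n>0$ be given by $\epsilon=\epsilon_0n^2$ ($\epsilon_0>0$ constant) and let $Q'=\mathbb{R}^2/\mathcal{K}'$. Then for any $\beta\in\mathbb{R}$ and any $\boldsymbol{\xi}'$ in the first Brillouin zone $\mathcal{B}'$ of $\mathcal{K}'$, the space $$\mathbf{V}'_{(\boldsymbol{\xi}',\beta)}:=\{\mathbf{v}\in \mathrm{L}^2(Q')^3:\ \nabla'_{(\boldsymbol{\xi}',\beta)}\times\mathbf{v}\in \mathrm{L}^2(Q')^3,\ \nabla'_{(\boldsymbol{\xi}',\beta)}\cdot\mathbf{v}=0\}$$ is contained in the Sobolev space $\mathrm{H}^1(Q')^3$. Moreover the sesquilinear form $$a'_{(\boldsymbol{\xi}',\beta)}(\mathbf{u},\mathbf{v}):=\int_{Q'}\tfrac{1}{n^2}\,\nabla'_{(\boldsymbol{\xi}',\beta)}\times\mathbf{u}\cdot\overline{\nabla'_{(\boldsymbol{\xi}',\beta)}\times\mathbf{v}}\;dx\,dy,\qquad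 \mathbf{u},\mathbf{v}\in\mathbf{V}'_{(\boldsymbol{\xi}',\beta)},$$ satisfies a Gårding inequality: for any $\mathbf{v}\in\mathbf{V}'_{(\boldsymbol{\xi}',\beta)}$, $\boldsymbol{\xi}'\in\mathcal{B}'$ and $\beta\in\mathbb{R}$, $$\|n\|^2_{\mathrm{L}^\infty(Q')}\,a'_{(\boldsymbol{\xi}',\beta)}(\mathbf{v},\mathbf{v})+(3|\boldsymbol{\xi}'|^2+1)\|\mathbf{v}\|^2_{\mathrm{L}^2(Q')^3}\ \ge\ \tfrac12\|\mathbf{v}\|^2_{\mathrm{H}^1(Q')^3}+\beta^2\|\mathbf{v}\|^2_{\mathrm{L}^2(Q')^3}.$$ The spectrum of $L'_{(\boldsymbol{\xi}',\beta)}$, the self-adjoint operator $\nabla'_{(\boldsymbol{\xi}',\beta)}\times(\tfrac{1}{n^2}\nabla'_{(\boldsymbol{\xi}',\beta)}\times\cdot)$ associated with $a'_{(\boldsymbol{\xi}',\beta)}$ on the form domain $\mathbf{V}'_{(\boldsymbol{\xi}',\beta)}$, is discrete and formed by a sequence of nonnegative eigenvalues.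
   Context: Lattice: $\mathcal{K}'=\{k_1\mathbf{a}_1+k_2\mathbf{a}_2: k_1,k_2\in\mathbb{Z}\}$ with $\mathbf{a}_1,\mathbf{a}_2\in\mathbb{R}^2$ linearly independent. The first Brillouin zone $\mathcal{B}'$ is the Wigner-Seitz cell (points at least as close to $0$ as to any other lattice point) of the reciprocal lattice $\{\mathbf{g}\in\mathbb{R}^2:\mathbf{g}\cdot\mathbf{k}\in2\pi\mathbb{Z}\ \forall\mathbf{k}\in\mathcal{K}'\}$. $\nabla'_{(\boldsymbol{\xi}',\beta)}:=(\partial_x,\partial_y,0)+i(\boldsymbol{\xi}',\beta)=(\partial_x+i\xi_1,\partial_y+i\xi_2,i\beta)$ for $\boldsymbol{\xi}'=(\xi_1,\xi_2)$, acting on $\mathbb{C}^3$-valued functions on the two-dimensional torus $Q'$ through formal cross and dot products, in the sense of distributions. Norms: $\|\mathbf{v}\|^2_{\mathrm{H}^1(Q')^3}=\|\mathbf{v}\|^2_{\mathrm{L}^2(Q')^3}+\|\partial_x\mathbf{v}\|^2_{\mathrm{L}^2(Q')^3}+\|\partial_y\mathbf{v}\|^2_{\mathrm{L}^2(Q')^3}$. The operator $L'_{(\boldsymbol{\xi}',\beta)}$ is considered on the Hilbert space $\{\mathbf{v}\in \mathrm{L}^2(Q')^3:\nabla'_{(\boldsymbol{\xi}',\beta)}\cdot\mathbf{v}=0\}$ with form domain $\mathbf{V}'_{(\boldsymbol{\xi}',\beta)}$. *)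

theory Defs
  imports "HOL-Probability.Essential_Supremum"
begin

section \<open>Lattices and the two-dimensional torus\<close>

definition period_lattice :: "real^2 \<Rightarrow> real^2 \<Rightarrow> (real^2) set" where
  "period_lattice a1 a2 = {of_int k1 *\<^sub>R a1 + of_int k2 *\<^sub>R a2 | k1 k2 :: int. True}"

definition reciprocal_lattice :: "(real^2) set \<Rightarrow> (real^2) set" where
  "reciprocal_lattice K = {g. \<forall>k\<in>K. \<exists>m::int. g \<bullet> k = 2 * pi * of_int m}"

definition wigner_seitz_cell :: "(real^2) set \<Rightarrow> (real^2) set" where
  "wigner_seitz_cell G = {x. \<forall>g\<in>G. dist x 0 \<le> dist x g}"

definition brillouin_zone :: "(real^2) set \<Rightarrow> (real^2) set" where
  "brillouin_zone K = wigner_seitz_cell (reciprocal_lattice K)"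

definition periodic :: "real^2 \<Rightarrow> real^2 \<Rightarrow> (real^2 \<Rightarrow> 'b) \<Rightarrow> bool" where
  "periodic a1 a2 f \<longleftrightarrow> (\<forall>x. \<forall>k\<in>period_lattice a1 a2. f (x + k) = f x)"

text \<open>Functions on the torus are represented by lattice-periodic functions on the plane, and they
  are integrated over the half-open fundamental parallelogram.\<close>

definition torus_measure :: "real^2 \<Rightarrow> real^2 \<Rightarrow> (real^2) measure" where
  "torus_measure a1 a2 =
     lebesgue_on {s *\<^sub>R a1 + t *\<^sub>R a2 | s t. 0 \<le> s \<and> s < 1 \<and> 0 \<le> t \<and> t < 1}"

definition Linf_norm :: "(real^2) measure \<Rightarrow> (real^2 \<Rightarrow> real) \<Rightarrow> ereal" where
  "Linf_norm M f = esssup M (\<lambda>x. ereal \<bar>f x\<bar>)"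

definition Linf :: "(real^2) measure \<Rightarrow> (real^2 \<Rightarrow> real) set" where
  "Linf M = {f \<in> borel_measurable M. Linf_norm M f < \<infinity>}"

text \<open>Elements of \<open>L2\<close> are functions, not classes of functions; two of them represent the same
  element of the Hilbert space iff they agree almost everywhere.\<close>

definition L2 :: "real^2 \<Rightarrow> real^2 \<Rightarrow> (real^2 \<Rightarrow> complex^3) set" where
  "L2 a1 a2 = {v \<in> borel_measurable lebesgue. periodic a1 a2 v \<and>
                  integrable (torus_measure a1 a2) (\<lambda>x. (norm (v x))\<^sup>2)}"

definition L2_inner ::
  "real^2 \<Rightarrow> real^2 \<Rightarrow> (real^2 \<Rightarrow> complex^3) \<Rightarrow> (real^2 \<Rightarrow> complex^3) \<Rightarrow> complex" where
  "L2_inner a1 a2 u v = (LINT x|torus_measure a1 a2. (\<Sum>i\<in>UNIV. u x $ i * cnj (v x $ i)))"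

definition L2_norm :: "real^2 \<Rightarrow> real^2 \<Rightarrow> (real^2 \<Rightarrow> complex^3) \<Rightarrow> real" where
  "L2_norm a1 a2 v = sqrt (LINT x|torus_measure a1 a2. (norm (v x))\<^sup>2)"


section \<open>Distributions on the torus\<close>

definition pdiff :: "2 \<Rightarrow> (real^2 \<Rightarrow> complex) \<Rightarrow> real^2 \<Rightarrow> complex" where
  "pdiff j f x = frechet_derivative f (at x) (axis j 1)"

text \<open>Smoothness: all iterated partial derivatives are totally differentiable everywhere.\<close>

definition test_fun :: "real^2 \<Rightarrow> real^2 \<Rightarrow> (real^2 \<Rightarrow> complex) set" where
  "test_fun a1 a2 = {\<phi>. periodic a1 a2 \<phi> \<and> (\<forall>js x. foldr pdiff js \<phi> differentiable (at x))}"

text \<open>A distribution with values in \<open>\<complex>\<^sup>3\<close> is a functional on (scalar) test functions. It is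
  represented by a total function, of which only the values on \<open>test_fun\<close> are meaningful.\<close>

type_synonym vdist = "(real^2 \<Rightarrow> complex) \<Rightarrow> complex^3"

definition regular :: "real^2 \<Rightarrow> real^2 \<Rightarrow> (real^2 \<Rightarrow> complex^3) \<Rightarrow> vdist" where
  "regular a1 a2 v \<phi> = (LINT x|torus_measure a1 a2. \<phi> x *s v x)"

definition dist_pdiff :: "2 \<Rightarrow> vdist \<Rightarrow> vdist" where
  "dist_pdiff j T \<phi> = - T (pdiff j \<phi>)"

text \<open>The \<open>k\<close>-th entry of \<open>(\<partial>\<^sub>x + i \<xi>\<^sub>1, \<partial>\<^sub>y + i \<xi>\<^sub>2, i \<beta>)\<close>, acting on every component of \<open>T\<close>.\<close>

definition nabla :: "real^2 \<Rightarrow> real \<Rightarrow> 3 \<Rightarrow> vdist \<Rightarrow> vdist" where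
  "nabla \<xi> \<beta> k T \<phi> =
     (if k = 1 then dist_pdiff 1 T \<phi> + (\<i> * of_real (\<xi> $ 1)) *s T \<phi>
      else if k = 2 then dist_pdiff 2 T \<phi> + (\<i> * of_real (\<xi> $ 2)) *s T \<phi>
      else (\<i> * of_real \<beta>) *s T \<phi>)"

definition dist_curl :: "real^2 \<Rightarrow> real \<Rightarrow> vdist \<Rightarrow> vdist" where
  "dist_curl \<xi> \<beta> T \<phi> = vector
     [nabla \<xi> \<beta> 2 T \<phi> $ 3 - nabla \<xi> \<beta> 3 T \<phi> $ 2,
      nabla \<xi> \<beta> 3 T \<phi> $ 1 - nabla \<xi> \<beta> 1 T \<phi> $ 3,
      nabla \<xi> \<beta> 1 T \<phi> $ 2 - nabla \<xi> \<beta> 2 T \<phi> $ 1]"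

definition dist_div :: "real^2 \<Rightarrow> real \<Rightarrow> vdist \<Rightarrow> (real^2 \<Rightarrow> complex) \<Rightarrow> complex" where
  "dist_div \<xi> \<beta> T \<phi> = (\<Sum>k\<in>UNIV. nabla \<xi> \<beta> k T \<phi> $ k)"

definition represents_L2 :: "real^2 \<Rightarrow> real^2 \<Rightarrow> vdist \<Rightarrow> (real^2 \<Rightarrow> complex^3) \<Rightarrow> bool" where
  "represents_L2 a1 a2 T w \<longleftrightarrow> w \<in> L2 a1 a2 \<and> (\<forall>\<phi>\<in>test_fun a1 a2. T \<phi> = regular a1 a2 w \<phi>)"

definition dist_in_L2 :: "real^2 \<Rightarrow> real^2 \<Rightarrow> vdist \<Rightarrow> bool" where
  "dist_in_L2 a1 a2 T \<longleftrightarrow> (\<exists>w. represents_L2 a1 a2 T w)"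

text \<open>The function representing \<open>T\<close>, which is unique up to null sets; used only for \<open>T\<close> in \<open>L2\<close>.\<close>

definition L2_fun :: "real^2 \<Rightarrow> real^2 \<Rightarrow> vdist \<Rightarrow> real^2 \<Rightarrow> complex^3" where
  "L2_fun a1 a2 T = (SOME w. represents_L2 a1 a2 T w)"


section \<open>Function spaces and the sesquilinear form\<close>

definition H1 :: "real^2 \<Rightarrow> real^2 \<Rightarrow> (real^2 \<Rightarrow> complex^3) set" where
  "H1 a1 a2 = {v \<in> L2 a1 a2. \<forall>j. dist_in_L2 a1 a2 (dist_pdiff j (regular a1 a2 v))}"

definition H1_norm :: "real^2 \<Rightarrow> real^2 \<Rightarrow> (real^2 \<Rightarrow> complex^3) \<Rightarrow> real" where
  "H1_norm a1 a2 v = sqrt ((L2_norm a1 a2 v)\<^sup>2 +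
     (\<Sum>j\<in>UNIV. (L2_norm a1 a2 (L2_fun a1 a2 (dist_pdiff j (regular a1 a2 v))))\<^sup>2))"

definition div_free :: "real^2 \<Rightarrow> real^2 \<Rightarrow> real^2 \<Rightarrow> real \<Rightarrow> (real^2 \<Rightarrow> complex^3) set" where
  "div_free a1 a2 \<xi> \<beta> =
     {v \<in> L2 a1 a2. \<forall>\<phi>\<in>test_fun a1 a2. dist_div \<xi> \<beta> (regular a1 a2 v) \<phi> = 0}"

definition form_domain :: "real^2 \<Rightarrow> real^2 \<Rightarrow> real^2 \<Rightarrow> real \<Rightarrow> (real^2 \<Rightarrow> complex^3) set" where
  "form_domain a1 a2 \<xi> \<beta> =
     {v \<in> L2 a1 a2. dist_in_L2 a1 a2 (dist_curl \<xi> \<beta> (regular a1 a2 v)) \<and>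
        (\<forall>\<phi>\<in>test_fun a1 a2. dist_div \<xi> \<beta> (regular a1 a2 v) \<phi> = 0)}"

definition curl ::
  "real^2 \<Rightarrow> real^2 \<Rightarrow> real^2 \<Rightarrow> real \<Rightarrow> (real^2 \<Rightarrow> complex^3) \<Rightarrow> real^2 \<Rightarrow> complex^3" where
  "curl a1 a2 \<xi> \<beta> v = L2_fun a1 a2 (dist_curl \<xi> \<beta> (regular a1 a2 v))"

definition curl_form ::
  "real^2 \<Rightarrow> real^2 \<Rightarrow> (real^2 \<Rightarrow> real) \<Rightarrow> real^2 \<Rightarrow> real \<Rightarrow>
   (real^2 \<Rightarrow> complex^3) \<Rightarrow> (real^2 \<Rightarrow> complex^3) \<Rightarrow> complex" where
  "curl_form a1 a2 n \<xi> \<beta> u v =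
     (LINT x|torus_measure a1 a2. of_real (1 / (n x)\<^sup>2) *
        (\<Sum>i\<in>UNIV. curl a1 a2 \<xi> \<beta> u x $ i * cnj (curl a1 a2 \<xi> \<beta> v x $ i)))"


section \<open>Unbounded operators\<close>

text \<open>An operator in a subspace \<open>H\<close> of \<open>L2\<close> is given by its graph, on the level of functions:
  the graph contains all representatives of its elements.\<close>

type_synonym operator_graph = "((real^2 \<Rightarrow> complex^3) \<times> (real^2 \<Rightarrow> complex^3)) set"

definition form_operator ::
  "real^2 \<Rightarrow> real^2 \<Rightarrow> (real^2 \<Rightarrow> real) \<Rightarrow> real^2 \<Rightarrow> real \<Rightarrow> operator_graph" where
  "form_operator a1 a2 n \<xi> \<beta> =
     {(u, f). u \<in> form_domain a1 a2 \<xi> \<beta> \<and> f \<in> div_free a1 a2 \<xi> \<beta> \<and>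
        (\<forall>v\<in>form_domain a1 a2 \<xi> \<beta>. curl_form a1 a2 n \<xi> \<beta> u v = L2_inner a1 a2 f v)}"

text \<open>The operator \<open>\<nabla> \<times> (1/n\<^sup>2 \<nabla> \<times> u)\<close> in the sense of distributions, on its maximal domain
  inside the form domain.\<close>

definition curl_curl_operator ::
  "real^2 \<Rightarrow> real^2 \<Rightarrow> (real^2 \<Rightarrow> real) \<Rightarrow> real^2 \<Rightarrow> real \<Rightarrow> operator_graph" where
  "curl_curl_operator a1 a2 n \<xi> \<beta> =
     {(u, f). u \<in> form_domain a1 a2 \<xi> \<beta> \<and>
        represents_L2 a1 a2
          (dist_curl \<xi> \<beta> (regular a1 a2 (\<lambda>x. (1 / (n x)\<^sup>2) *\<^sub>R curl a1 a2 \<xi> \<beta> u x))) f}"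

definition densely_defined ::
  "real^2 \<Rightarrow> real^2 \<Rightarrow> (real^2 \<Rightarrow> complex^3) set \<Rightarrow> operator_graph \<Rightarrow> bool" where
  "densely_defined a1 a2 H A \<longleftrightarrow>
     (\<forall>f\<in>H. \<forall>e>0. \<exists>u\<in>Domain A. L2_norm a1 a2 (\<lambda>x. f x - u x) < e)"

definition adjoint_operator ::
  "real^2 \<Rightarrow> real^2 \<Rightarrow> (real^2 \<Rightarrow> complex^3) set \<Rightarrow> operator_graph \<Rightarrow> operator_graph" where
  "adjoint_operator a1 a2 H A =
     {(v, g). v \<in> H \<and> g \<in> H \<and> (\<forall>(u, f)\<in>A. L2_inner a1 a2 f v = L2_inner a1 a2 u g)}"

definition self_adjoint ::
  "real^2 \<Rightarrow> real^2 \<Rightarrow> (real^2 \<Rightarrow> complex^3) set \<Rightarrow> operator_graph \<Rightarrow> bool" where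
  "self_adjoint a1 a2 H A \<longleftrightarrow> densely_defined a1 a2 H A \<and> adjoint_operator a1 a2 H A = A"

text \<open>\<open>A - z\<close> maps its domain bijectively onto \<open>H\<close> with a bounded inverse; injectivity up to null
  sets is part of the norm bound.\<close>

definition resolvent_set ::
  "real^2 \<Rightarrow> real^2 \<Rightarrow> (real^2 \<Rightarrow> complex^3) set \<Rightarrow> operator_graph \<Rightarrow> complex set" where
  "resolvent_set a1 a2 H A = {z.
     (\<forall>f\<in>H. \<exists>(u, g)\<in>A. AE x in torus_measure a1 a2. g x - z *s u x = f x) \<and>
     (\<exists>C. \<forall>(u, g)\<in>A. L2_norm a1 a2 u \<le> C * L2_norm a1 a2 (\<lambda>x. g x - z *s u x))}"

definition op_spectrum ::
  "real^2 \<Rightarrow> real^2 \<Rightarrow> (real^2 \<Rightarrow> complex^3) set \<Rightarrow> operator_graph \<Rightarrow> complex set" where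
  "op_spectrum a1 a2 H A = - resolvent_set a1 a2 H A"

definition op_eigenspace :: "operator_graph \<Rightarrow> complex \<Rightarrow> (real^2 \<Rightarrow> complex^3) set" where
  "op_eigenspace A z = {u. (u, \<lambda>x. z *s u x) \<in> A}"

definition op_eigenvalue :: "real^2 \<Rightarrow> real^2 \<Rightarrow> operator_graph \<Rightarrow> complex \<Rightarrow> bool" where
  "op_eigenvalue a1 a2 A z \<longleftrightarrow>
     (\<exists>u\<in>op_eigenspace A z. \<not> (AE x in torus_measure a1 a2. u x = 0))"

definition finite_multiplicity :: "real^2 \<Rightarrow> real^2 \<Rightarrow> operator_graph \<Rightarrow> complex \<Rightarrow> bool" where
  "finite_multiplicity a1 a2 A z \<longleftrightarrow>
     (\<exists>B. finite B \<and> (\<forall>u\<in>op_eigenspace A z. \<exists>c.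
        AE x in torus_measure a1 a2. u x = (\<Sum>b\<in>B. c b *s b x)))"

definition discrete_spectrum ::
  "real^2 \<Rightarrow> real^2 \<Rightarrow> (real^2 \<Rightarrow> complex^3) set \<Rightarrow> operator_graph \<Rightarrow> bool" where
  "discrete_spectrum a1 a2 H A \<longleftrightarrow>
     (\<forall>z\<in>op_spectrum a1 a2 H A. z isolated_in op_spectrum a1 a2 H A \<and>
        op_eigenvalue a1 a2 A z \<and> finite_multiplicity a1 a2 A z)"

end

theory Submission
  imports Defs "HOL-Library.Function_Algebras" "HOL-Complex_Analysis.Great_Picard"
begin

text \<open>On the Fourier side everything in the statement is explicit. A periodic field \<open>v\<close> has coefficients
\<open>v\<^sub>h \<in> \<complex>\<^sup>3\<close>, one for each reciprocal lattice point \<open>g\<^sub>h\<close>, and with \<open>\<zeta>\<^sub>h = (g\<^sub>h + \<xi>, \<beta>)\<close> the shifted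
divergence and curl multiply \<open>v\<^sub>h\<close> by \<open>\<i>\<zeta>\<^sub>h\<bullet>\<close> and \<open>\<i>\<zeta>\<^sub>h\<times>\<close>. Since \<open>\<zeta>\<^sub>h\<close> is real, Lagrange's identity gives
\<open>\<bar>\<zeta>\<^sub>h \<times> v\<^sub>h\<bar> = \<bar>\<zeta>\<^sub>h\<bar>\<bar>v\<^sub>h\<bar>\<close> whenever \<open>\<zeta>\<^sub>h \<bullet> v\<^sub>h = 0\<close>. So for divergence-free fields the curl controls all
derivatives: this yields the inclusion in \<open>H1\<close>, the Garding inequality (compare
\<open>(1 + \<bar>g\<^sub>h\<bar>\<^sup>2)/2 + \<beta>\<^sup>2\<close> with \<open>\<bar>\<zeta>\<^sub>h\<bar>\<^sup>2 + 3\<bar>\<xi>\<bar>\<^sup>2 + 1\<close> for each \<open>h\<close>), and, because only finitely many \<open>\<zeta>\<^sub>h\<close> lie in a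
given ball, the compactness of the embedding of the form domain into \<open>L2\<close>.

The same picture identifies the two descriptions of the operator. A divergence-free \<open>f\<close> satisfies the
variational equation iff it is the distributional curl of \<open>n\<^sup>-\<^sup>2 curl u\<close>: at each frequency the difference
of the two sides is orthogonal to \<open>\<zeta>\<^sub>h\<close>, hence is itself the amplitude of an admissible plane wave, and
testing with that wave shows that it vanishes (lemma \<open>curl_curl_eq\<close>).

The spectral part is abstract. A closed nonnegative form, densely defined in a Hilbert space \<open>H\<close> with
compact embedding and infinite dimension, has an orthonormal basis of eigenvectors \<open>e\<^sub>k\<close> that are found by
minimising the form successively on the orthogonal complements of the previous ones (\<open>eigenbasis\<close>).
In this basis the operator is multiplication by a sequence \<open>\<lambda>\<^sub>k \<rightarrow> \<infinity>\<close> on coefficients (\<open>form_graph_iff\<close>), and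
self-adjointness, the resolvent set and the multiplicities can be read off.

What makes this possible is the completeness of the plane waves in \<open>L2\<close> of the torus. Orthogonality and
the rule for coefficients of derivatives both follow from the vanishing of the integral of a derivative of
a periodic function, which in turn is the translation invariance of the integral over a period cell.
Completeness follows from the Weierstrass approximation theorem on a product of two circles. Since
elements of \<open>L2\<close> are functions and not classes of functions, the Hilbert space theory is developed for
semi-inner products, in which vectors of norm zero need not vanish.\<close>

section \<open>Semi-inner product spaces and orthonormal systems\<close>

text \<open>Functions that agree almost everywhere are different vectors, so the inner product is only
  semidefinite: two vectors represent the same element iff \<open>nrm (u - v) = 0\<close>. The space is a subset of an
  ambient vector space so that \<open>L2\<close>, its divergence-free part and the form domain share one addition.\<close>
locale semi_inner_space = vector_space scale
  for scale :: "complex \<Rightarrow> 'v::ab_group_add \<Rightarrow> 'v" (infixr "*\<^sub>C" 75) +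
  fixes H :: "'v set" and ip :: "'v \<Rightarrow> 'v \<Rightarrow> complex"
  assumes subspace_H: "subspace H"
    and ip_add_left: "u \<in> H \<Longrightarrow> v \<in> H \<Longrightarrow> w \<in> H \<Longrightarrow> ip (u + v) w = ip u w + ip v w"
    and ip_scale_left: "u \<in> H \<Longrightarrow> w \<in> H \<Longrightarrow> ip (c *\<^sub>C u) w = c * ip u w"
    and ip_commute: "u \<in> H \<Longrightarrow> v \<in> H \<Longrightarrow> ip v u = cnj (ip u v)"
    and ip_nonneg: "u \<in> H \<Longrightarrow> 0 \<le> Re (ip u u)"
begin

definition nrm :: "'v \<Rightarrow> real" where
  "nrm u = sqrt (Re (ip u u))"

lemma mem_zero [simp]: "0 \<in> H"
  and mem_add [simp]: "u \<in> H \<Longrightarrow> v \<in> H \<Longrightarrow> u + v \<in> H"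
  and mem_scale [simp]: "u \<in> H \<Longrightarrow> c *\<^sub>C u \<in> H"
  and mem_diff [simp]: "u \<in> H \<Longrightarrow> v \<in> H \<Longrightarrow> u - v \<in> H"
  by (fact subspace_0[OF subspace_H] subspace_add[OF subspace_H] subspace_scale[OF subspace_H]
      subspace_diff[OF subspace_H])+

lemma mem_sum [simp]: "(\<And>i. i \<in> I \<Longrightarrow> x i \<in> H) \<Longrightarrow> sum x I \<in> H"
  by (rule subspace_sum[OF subspace_H])

lemma ip_add_right: "u \<in> H \<Longrightarrow> v \<in> H \<Longrightarrow> w \<in> H \<Longrightarrow> ip u (v + w) = ip u v + ip u w"
  by (metis complex_cnj_add ip_add_left ip_commute mem_add)

lemma ip_scale_right: "u \<in> H \<Longrightarrow> v \<in> H \<Longrightarrow> ip u (c *\<^sub>C v) = cnj c * ip u v"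
  by (metis complex_cnj_mult ip_commute ip_scale_left mem_scale)

lemma ip_diff_left: "u \<in> H \<Longrightarrow> v \<in> H \<Longrightarrow> w \<in> H \<Longrightarrow> ip (u - v) w = ip u w - ip v w"
  using ip_add_left[of "u - v" v w] by (simp add: algebra_simps)

lemma ip_diff_right: "u \<in> H \<Longrightarrow> v \<in> H \<Longrightarrow> w \<in> H \<Longrightarrow> ip u (v - w) = ip u v - ip u w"
  using ip_add_right[of u "v - w" w] by (simp add: algebra_simps)

lemma ip_zero_left [simp]: "w \<in> H \<Longrightarrow> ip 0 w = 0"
  using ip_add_left[of 0 0 w] by simp

lemma ip_zero_right [simp]: "w \<in> H \<Longrightarrow> ip w 0 = 0"
  using ip_add_right[of w 0 0] by simp

lemma ip_sum_left:
  "w \<in> H \<Longrightarrow> (\<And>i. i \<in> I \<Longrightarrow> x i \<in> H) \<Longrightarrow> ip (\<Sum>i\<in>I. x i) w = (\<Sum>i\<in>I. ip (x i) w)"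
  by (induction I rule: infinite_finite_induct) (auto simp: ip_add_left)

lemma ip_sum_right:
  "w \<in> H \<Longrightarrow> (\<And>i. i \<in> I \<Longrightarrow> x i \<in> H) \<Longrightarrow> ip w (\<Sum>i\<in>I. x i) = (\<Sum>i\<in>I. ip w (x i))"
  by (induction I rule: infinite_finite_induct) (auto simp: ip_add_right)

lemma nrm_nonneg [simp]: "u \<in> H \<Longrightarrow> 0 \<le> nrm u"
  by (simp add: nrm_def ip_nonneg)

lemma nrm_sq: "u \<in> H \<Longrightarrow> (nrm u)\<^sup>2 = Re (ip u u)"
  by (simp add: nrm_def ip_nonneg)

lemma ip_self: "u \<in> H \<Longrightarrow> ip u u = of_real ((nrm u)\<^sup>2)"
  using ip_commute[of u u] by (simp add: nrm_sq complex_eq_iff)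

lemma nrm_zero [simp]: "nrm 0 = 0"
  by (simp add: nrm_def)

lemma nrm_scale: "u \<in> H \<Longrightarrow> nrm (c *\<^sub>C u) = cmod c * nrm u"
proof -
  assume u: "u \<in> H"
  have "ip (c *\<^sub>C u) (c *\<^sub>C u) = (c * cnj c) * ip u u"
    using u by (simp add: ip_scale_left ip_scale_right)
  also have "\<dots> = of_real ((cmod c)\<^sup>2 * (nrm u)\<^sup>2)"
    using u by (simp add: ip_self flip: complex_norm_square)
  finally have "ip (c *\<^sub>C u) (c *\<^sub>C u) = of_real ((cmod c)\<^sup>2 * (nrm u)\<^sup>2)" .
  then have "nrm (c *\<^sub>C u) = sqrt ((cmod c)\<^sup>2 * (nrm u)\<^sup>2)"
    unfolding nrm_def[of "c *\<^sub>C u"] by simp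
  then show ?thesis
    using u by (simp add: real_sqrt_mult)
qed

lemma nrm_add_sq:
  assumes "u \<in> H" "v \<in> H"
  shows "(nrm (u + v))\<^sup>2 = (nrm u)\<^sup>2 + (nrm v)\<^sup>2 + 2 * Re (ip u v)"
  using assms ip_commute[of u v] by (simp add: nrm_sq ip_add_left ip_add_right)

lemma nrm_diff_sq:
  assumes "u \<in> H" "v \<in> H"
  shows "(nrm (u - v))\<^sup>2 = (nrm u)\<^sup>2 + (nrm v)\<^sup>2 - 2 * Re (ip u v)"
  using assms ip_commute[of u v] by (simp add: nrm_sq ip_diff_left ip_diff_right)

lemma parallelogram:
  assumes "u \<in> H" "v \<in> H"
  shows "(nrm (u + v))\<^sup>2 + (nrm (u - v))\<^sup>2 = 2 * (nrm u)\<^sup>2 + 2 * (nrm v)\<^sup>2"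
  using nrm_add_sq[OF assms] nrm_diff_sq[OF assms] by simp

text \<open>The quadratic \<open>t \<mapsto> \<bar>u - t\<langle>u, v\<rangle>v\<bar>\<^sup>2\<close> is nonnegative; if \<open>nrm v = 0\<close> it degenerates to an affine function,
  which forces \<open>\<langle>u, v\<rangle> = 0\<close>.\<close>
lemma Cauchy_Schwarz:
  assumes u: "u \<in> H" and v: "v \<in> H"
  shows "cmod (ip u v) \<le> nrm u * nrm v"
proof -
  define c where "c = ip u v"
  have quad: "0 \<le> (nrm u)\<^sup>2 - 2 * t * (cmod c)\<^sup>2 + t\<^sup>2 * (cmod c)\<^sup>2 * (nrm v)\<^sup>2" for t :: real
  proof -
    define s where "s = of_real t * c"
    have "0 \<le> (nrm (u - s *\<^sub>C v))\<^sup>2"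
      by simp
    also have "\<dots> = (nrm u)\<^sup>2 + (cmod s * nrm v)\<^sup>2 - 2 * Re (cnj s * c)"
      using u v by (simp add: nrm_diff_sq nrm_scale ip_scale_right c_def)
    also have "Re (cnj s * c) = t * (cmod c)\<^sup>2"
      unfolding s_def cmod_power2 by (simp add: power2_eq_square algebra_simps)
    also have "(cmod s * nrm v)\<^sup>2 = t\<^sup>2 * (cmod c)\<^sup>2 * (nrm v)\<^sup>2"
      by (simp add: s_def norm_mult power_mult_distrib)
    finally show ?thesis by simp
  qed
  have "(cmod c)\<^sup>2 \<le> (nrm u)\<^sup>2 * (nrm v)\<^sup>2"
  proof (cases "nrm v = 0")
    case True
    have "c = 0"
    proof (rule ccontr)
      assume "c \<noteq> 0"
      then show False
        using quad[of "((nrm u)\<^sup>2 + 1) / (2 * (cmod c)\<^sup>2)"] True by simp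
    qed
    then show ?thesis by simp
  next
    case False
    have "0 \<le> (nrm u)\<^sup>2 - (cmod c)\<^sup>2 / (nrm v)\<^sup>2"
      using quad[of "1 / (nrm v)\<^sup>2"] False
      by (simp add: power2_eq_square field_simps)
    then show ?thesis
      using False by (simp add: field_simps)
  qed
  then have "(cmod c)\<^sup>2 \<le> (nrm u * nrm v)\<^sup>2"
    by (simp add: power_mult_distrib)
  then show ?thesis
    unfolding c_def by (rule power2_le_imp_le) (use u v in simp)
qed

lemma nrm_triangle:
  assumes u: "u \<in> H" and v: "v \<in> H"
  shows "nrm (u + v) \<le> nrm u + nrm v"
proof (rule power2_le_imp_le)
  have "Re (ip u v) \<le> nrm u * nrm v"
    using Cauchy_Schwarz[OF u v] complex_Re_le_cmod order_trans by blast
  then show "(nrm (u + v))\<^sup>2 \<le> (nrm u + nrm v)\<^sup>2"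
    using u v by (simp add: nrm_add_sq power2_sum)
qed (use u v in simp)

lemma nrm_minus_commute:
  assumes "u \<in> H" "v \<in> H"
  shows "nrm (u - v) = nrm (v - u)"
  using nrm_scale[of "v - u" "-1"] assms by simp

lemma nrm_diff_triangle:
  assumes "u \<in> H" "v \<in> H" "w \<in> H"
  shows "nrm (u - w) \<le> nrm (u - v) + nrm (v - w)"
  using nrm_triangle[of "u - v" "v - w"] assms by simp

lemma nrm_reverse_triangle:
  assumes "u \<in> H" "v \<in> H"
  shows "\<bar>nrm u - nrm v\<bar> \<le> nrm (u - v)"
  using nrm_triangle[of "u - v" v] nrm_triangle[of "v - u" u] nrm_minus_commute[of u v] assms
  by simp

text \<open>Inner products do not depend on the choice of representatives.\<close>
lemma ip_null_left:
  assumes "u \<in> H" "v \<in> H" "nrm u = 0"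
  shows "ip u v = 0"
  using Cauchy_Schwarz[of u v] assms by simp

lemma tendsto_ip_left:
  assumes x: "\<And>j. x j \<in> H" and u: "u \<in> H" and w: "w \<in> H"
    and lim: "((\<lambda>j. nrm (x j - u)) \<longlongrightarrow> 0) F"
  shows "((\<lambda>j. ip (x j) w) \<longlongrightarrow> ip u w) F"
proof -
  have "((\<lambda>j. ip (x j) w - ip u w) \<longlongrightarrow> 0) F"
  proof (rule Lim_null_comparison)
    show "\<forall>\<^sub>F j in F. norm (ip (x j) w - ip u w) \<le> nrm (x j - u) * nrm w"
      using Cauchy_Schwarz[of "x _ - u" w] x u w by (simp add: ip_diff_left)
    show "((\<lambda>j. nrm (x j - u) * nrm w) \<longlongrightarrow> 0) F"
      using lim tendsto_mult_left_zero by blast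
  qed
  then show ?thesis
    by (simp add: LIM_zero_iff)
qed

lemma tendsto_nrm:
  assumes x: "\<And>j. x j \<in> H" and u: "u \<in> H"
    and lim: "((\<lambda>j. nrm (x j - u)) \<longlongrightarrow> 0) F"
  shows "((\<lambda>j. nrm (x j)) \<longlongrightarrow> nrm u) F"
proof -
  have "((\<lambda>j. nrm (x j) - nrm u) \<longlongrightarrow> 0) F"
  proof (rule Lim_null_comparison[OF _ lim])
    show "\<forall>\<^sub>F j in F. norm (nrm (x j) - nrm u) \<le> nrm (x j - u)"
      using nrm_reverse_triangle x u by simp
  qed
  then show ?thesis
    by (simp add: LIM_zero_iff)
qed

definition nrm_Cauchy :: "(nat \<Rightarrow> 'v) \<Rightarrow> bool" where
  "nrm_Cauchy x \<longleftrightarrow> (\<forall>\<epsilon>>0. \<exists>N. \<forall>m\<ge>N. \<forall>n\<ge>N. nrm (x m - x n) < \<epsilon>)"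

lemma nrm_CauchyI:
  assumes x: "\<And>j. x j \<in> H" and b: "\<And>\<epsilon>. \<epsilon> > 0 \<Longrightarrow> \<exists>N. \<forall>m n. N \<le> m \<longrightarrow> m \<le> n \<longrightarrow> nrm (x n - x m) < \<epsilon>"
  shows "nrm_Cauchy x"
  unfolding nrm_Cauchy_def
  by (metis b nle_le nrm_minus_commute x)

definition orthonormal_on :: "'i set \<Rightarrow> ('i \<Rightarrow> 'v) \<Rightarrow> bool" where
  "orthonormal_on I e \<longleftrightarrow>
     (\<forall>i\<in>I. e i \<in> H) \<and> (\<forall>i\<in>I. \<forall>j\<in>I. ip (e i) (e j) = (if i = j then 1 else 0))"

lemma ip_sum_orthonormal:
  assumes e: "orthonormal_on I e" and F: "finite F" "F \<subseteq> I" and j: "j \<in> I"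
  shows "ip (\<Sum>i\<in>F. c i *\<^sub>C e i) (e j) = (if j \<in> F then c j else 0)"
proof -
  have "ip (\<Sum>i\<in>F. c i *\<^sub>C e i) (e j) = (\<Sum>i\<in>F. ip (c i *\<^sub>C e i) (e j))"
    using e F j by (intro ip_sum_left) (auto simp: orthonormal_on_def)
  also have "\<dots> = (\<Sum>i\<in>F. if i = j then c i else 0)"
    using e F j by (intro sum.cong refl) (auto simp: orthonormal_on_def ip_scale_left subset_iff)
  finally show ?thesis
    using F by simp
qed

lemma mem_orthonormal_sum [simp]:
  assumes "orthonormal_on I e" "F \<subseteq> I"
  shows "(\<Sum>i\<in>F. c i *\<^sub>C e i) \<in> H"
  using assms by (auto simp: orthonormal_on_def intro!: mem_sum)

lemma ip_sum_orthonormal_left: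
  assumes e: "orthonormal_on I e" and F: "F \<subseteq> I" and v: "v \<in> H"
  shows "ip (\<Sum>i\<in>F. c i *\<^sub>C e i) v = (\<Sum>i\<in>F. c i * cnj (ip v (e i)))"
proof -
  have "ip (\<Sum>i\<in>F. c i *\<^sub>C e i) v = (\<Sum>i\<in>F. ip (c i *\<^sub>C e i) v)"
    using e F v by (intro ip_sum_left) (auto simp: orthonormal_on_def)
  also have "\<dots> = (\<Sum>i\<in>F. c i * cnj (ip v (e i)))"
  proof (intro sum.cong refl)
    fix i assume "i \<in> F"
    then have "e i \<in> H" using e F by (auto simp: orthonormal_on_def)
    then show "ip (c i *\<^sub>C e i) v = c i * cnj (ip v (e i))"
      by (simp only: ip_scale_left ip_commute[OF v, of "e i"] v)
  qed
  finally show ?thesis .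
qed

lemma nrm_sum_orthonormal:
  assumes e: "orthonormal_on I e" and F: "finite F" "F \<subseteq> I"
  shows "(nrm (\<Sum>i\<in>F. c i *\<^sub>C e i))\<^sup>2 = (\<Sum>i\<in>F. (cmod (c i))\<^sup>2)"
proof -
  let ?s = "\<Sum>i\<in>F. c i *\<^sub>C e i"
  have s: "?s \<in> H" using e F by simp
  have "ip ?s ?s = (\<Sum>i\<in>F. c i * cnj (ip ?s (e i)))"
    using ip_sum_orthonormal_left[OF e F(2) s] .
  also have "\<dots> = (\<Sum>i\<in>F. of_real ((cmod (c i))\<^sup>2))"
  proof (intro sum.cong refl)
    fix i assume "i \<in> F"
    then show "c i * cnj (ip ?s (e i)) = of_real ((cmod (c i))\<^sup>2)"
      using ip_sum_orthonormal[OF e F, of i c] F by (simp only: complex_norm_square subset_iff if_True)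
  qed
  finally show ?thesis
    using s by (simp add: nrm_sq)
qed

lemma nrm_residual_orthonormal:
  assumes e: "orthonormal_on I e" and F: "finite F" "F \<subseteq> I" and u: "u \<in> H"
  shows "(nrm (u - (\<Sum>i\<in>F. ip u (e i) *\<^sub>C e i)))\<^sup>2 = (nrm u)\<^sup>2 - (\<Sum>i\<in>F. (cmod (ip u (e i)))\<^sup>2)"
proof -
  let ?s = "\<Sum>i\<in>F. ip u (e i) *\<^sub>C e i"
  have s: "?s \<in> H" using e F by simp
  have "ip ?s u = (\<Sum>i\<in>F. of_real ((cmod (ip u (e i)))\<^sup>2))"
    unfolding ip_sum_orthonormal_left[OF e F(2) u]
    by (simp only: complex_norm_square)
  then have "Re (ip u ?s) = (\<Sum>i\<in>F. (cmod (ip u (e i)))\<^sup>2)"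
    using ip_commute[OF s u] by simp
  then show ?thesis
    using nrm_diff_sq[OF u s] nrm_sum_orthonormal[OF e F] by simp
qed

lemma Bessel:
  assumes e: "orthonormal_on I e" and F: "finite F" "F \<subseteq> I" and u: "u \<in> H"
  shows "(\<Sum>i\<in>F. (cmod (ip u (e i)))\<^sup>2) \<le> (nrm u)\<^sup>2"
  using nrm_residual_orthonormal[OF assms] zero_le_power2
  by (metis diff_ge_0_iff_ge)

lemma Bessel_summable:
  assumes e: "orthonormal_on I e" and u: "u \<in> H"
  shows "(\<lambda>i. (cmod (ip u (e i)))\<^sup>2) summable_on I"
  using Bessel[OF e _ _ u]
  by (intro nonneg_bounded_partial_sums_imp_summable_on[where C = "(nrm u)\<^sup>2"])
     (auto intro!: eventually_finite_subsets_at_top_weakI)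

lemma residual_orthogonal:
  assumes e: "orthonormal_on I e" and F: "finite F" "F \<subseteq> I" and u: "u \<in> H" and j: "j \<in> F"
  shows "ip (u - (\<Sum>i\<in>F. ip u (e i) *\<^sub>C e i)) (e j) = 0"
  using e F u j ip_sum_orthonormal[OF e F, of j "\<lambda>i. ip u (e i)"]
  by (auto simp: ip_diff_left orthonormal_on_def subset_iff)

end

locale semi_hilbert = semi_inner_space scale H ip
  for scale :: "complex \<Rightarrow> 'v::ab_group_add \<Rightarrow> 'v" (infixr "*\<^sub>C" 75) and H ip +
  assumes complete: "(\<And>j. x j \<in> H) \<Longrightarrow> nrm_Cauchy x \<Longrightarrow> \<exists>u\<in>H. (\<lambda>j. nrm (x j - u)) \<longlonglongrightarrow> 0"
begin

text \<open>The index type is arbitrary, so that the result serves both for plane waves and for a sequence of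
  eigenvectors. Finite index sets \<open>F n\<close> that miss a mass of at most \<open>4\<^sup>-\<^sup>n\<close> give a Cauchy sequence of partial
  sums.\<close>
lemma Riesz_Fischer:
  assumes e: "orthonormal_on UNIV e" and c: "(\<lambda>i. (cmod (c i))\<^sup>2) summable_on UNIV"
  shows "\<exists>u\<in>H. (\<forall>i. ip u (e i) = c i) \<and> ((\<lambda>i. (cmod (c i))\<^sup>2) has_sum (nrm u)\<^sup>2) UNIV"
proof -
  define S where "S = (\<Sum>\<^sub>\<infinity>i. (cmod (c i))\<^sup>2)"
  have hs: "((\<lambda>i. (cmod (c i))\<^sup>2) has_sum S) UNIV"
    unfolding S_def using c by (rule has_sum_infsum)
  have le_S: "sum (\<lambda>i. (cmod (c i))\<^sup>2) G \<le> S" if "finite G" for G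
    using finite_sum_le_has_sum[OF hs that] by simp
  have "\<exists>G. finite G \<and> S - (1/4)^n \<le> sum (\<lambda>i. (cmod (c i))\<^sup>2) G" for n :: nat
  proof -
    have "\<forall>\<^sub>F G in finite_subsets_at_top UNIV. S - (1/4)^n < sum (\<lambda>i. (cmod (c i))\<^sup>2) G"
      using hs unfolding has_sum_def by (rule order_tendstoD) simp
    then show ?thesis
      unfolding eventually_finite_subsets_at_top by (meson less_imp_le order_refl subset_UNIV)
  qed
  then obtain F where F: "\<And>n. finite (F n)" "\<And>n. S - (1/4)^n \<le> sum (\<lambda>i. (cmod (c i))\<^sup>2) (F n)"
    by metis
  have tail: "sum (\<lambda>i. (cmod (c i))\<^sup>2) G \<le> (1/4)^n" if "finite G" "G \<inter> F n = {}" for G n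
    using le_S[of "G \<union> F n"] F[of n] that sum.union_disjoint[of G "F n" "\<lambda>i. (cmod (c i))\<^sup>2"] by simp
  define x where "x n = (\<Sum>i\<in>F n. c i *\<^sub>C e i)" for n
  have x: "x n \<in> H" for n
    using e by (simp add: x_def)
  have xe: "ip (x n) (e i) = (if i \<in> F n then c i else 0)" for n i
    unfolding x_def using ip_sum_orthonormal[OF e F(1)] by simp
  have step: "nrm (x m - x n) \<le> 2 * (1/2)^N" if "N \<le> m" "N \<le> n" for m n N
  proof -
    \<comment> \<open>The two partial sums differ only on the symmetric difference of their index sets.\<close>
    have "x m - x n = (\<Sum>i\<in>F m - F n. c i *\<^sub>C e i) - (\<Sum>i\<in>F n - F m. c i *\<^sub>C e i)"
      unfolding x_def
      using sum.Int_Diff[OF F(1)[of m], of "\<lambda>i. c i *\<^sub>C e i" "F n"]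
        sum.Int_Diff[OF F(1)[of n], of "\<lambda>i. c i *\<^sub>C e i" "F m"]
      by (simp add: Int_commute)
    also have "nrm \<dots> \<le> nrm (\<Sum>i\<in>F m - F n. c i *\<^sub>C e i) + nrm (\<Sum>i\<in>F n - F m. c i *\<^sub>C e i)"
      using nrm_diff_triangle[of "\<Sum>i\<in>F m - F n. c i *\<^sub>C e i" 0 "\<Sum>i\<in>F n - F m. c i *\<^sub>C e i"] e
        nrm_minus_commute[of 0 "\<Sum>i\<in>F n - F m. c i *\<^sub>C e i"]
      by simp
    also have "\<dots> \<le> (1/2)^n + (1/2)^m"
    proof (rule add_mono; rule power2_le_imp_le)
      show "(nrm (\<Sum>i\<in>F m - F n. c i *\<^sub>C e i))\<^sup>2 \<le> ((1 / 2) ^ n)\<^sup>2"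
        using nrm_sum_orthonormal[OF e, of "F m - F n" c] tail[of "F m - F n" n] F
        by (auto simp: power2_eq_square simp flip: power_mult_distrib)
      show "(nrm (\<Sum>i\<in>F n - F m. c i *\<^sub>C e i))\<^sup>2 \<le> ((1 / 2) ^ m)\<^sup>2"
        using nrm_sum_orthonormal[OF e, of "F n - F m" c] tail[of "F n - F m" m] F
        by (auto simp: power2_eq_square simp flip: power_mult_distrib)
    qed auto
    also have "\<dots> \<le> 2 * (1/2)^N"
    proof -
      have "(1/2)^n \<le> (1/2::real)^N" "(1/2)^m \<le> (1/2::real)^N"
        by (rule power_decreasing; use that in simp)+
      then show ?thesis by linarith
    qed
    finally show ?thesis .
  qed
  have "nrm_Cauchy x"
    unfolding nrm_Cauchy_def
  proof (intro allI impI)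
    fix \<epsilon> :: real assume "\<epsilon> > 0"
    then obtain N where "(1/2)^N < \<epsilon> / 2"
      using real_arch_pow_inv[of "\<epsilon> / 2" "1/2"] by auto
    then show "\<exists>N. \<forall>m\<ge>N. \<forall>n\<ge>N. nrm (x m - x n) < \<epsilon>"
      using step by (intro exI[of _ N]) fastforce
  qed
  then obtain u where u: "u \<in> H" and lim: "(\<lambda>j. nrm (x j - u)) \<longlonglongrightarrow> 0"
    using complete[of x] x by blast
  have "ip u (e i) = c i" for i
  proof (rule LIMSEQ_unique)
    have "e i \<in> H" using e by (simp add: orthonormal_on_def)
    then show "(\<lambda>n. ip (x n) (e i)) \<longlonglongrightarrow> ip u (e i)"
      using tendsto_ip_left[OF x u _ lim] by simp
    have "(\<lambda>n. ip (x n) (e i) - c i) \<longlonglongrightarrow> 0"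
    proof (rule Lim_null_comparison)
      have "cmod (ip (x n) (e i) - c i) \<le> (1/2)^n" for n
      proof (cases "i \<in> F n")
        case False
        have "(cmod (c i))\<^sup>2 \<le> ((1/2)^n)\<^sup>2"
          using tail[of "{i}" n] False by (simp add: power2_eq_square flip: power_mult_distrib)
        then have "cmod (c i) \<le> (1/2)^n"
          by (rule power2_le_imp_le) simp
        then show ?thesis by (simp add: xe False)
      qed (simp add: xe)
      then show "\<forall>\<^sub>F n in sequentially. norm (ip (x n) (e i) - c i) \<le> (1/2)^n" by simp
      show "(\<lambda>n. (1/2::real)^n) \<longlonglongrightarrow> 0" by (simp add: LIMSEQ_realpow_zero)
    qed
    then show "(\<lambda>n. ip (x n) (e i)) \<longlonglongrightarrow> c i" by (simp add: LIM_zero_iff)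
  qed
  moreover have "S = (nrm u)\<^sup>2"
  proof (rule LIMSEQ_unique)
    show "(\<lambda>n. (nrm (x n))\<^sup>2) \<longlonglongrightarrow> (nrm u)\<^sup>2"
      by (intro tendsto_power tendsto_nrm x u lim)
    show "(\<lambda>n. (nrm (x n))\<^sup>2) \<longlonglongrightarrow> S"
    proof (rule tendsto_sandwich)
      show "\<forall>\<^sub>F n in sequentially. S - (1/4)^n \<le> (nrm (x n))\<^sup>2"
        "\<forall>\<^sub>F n in sequentially. (nrm (x n))\<^sup>2 \<le> S"
        unfolding x_def using F le_S by (auto simp: nrm_sum_orthonormal[OF e F(1)])
      have "(\<lambda>n. S - (1/4)^n) \<longlonglongrightarrow> S - 0"
        by (intro tendsto_intros LIMSEQ_realpow_zero) auto
      then show "(\<lambda>n. S - (1/4)^n) \<longlonglongrightarrow> S" by simp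
    qed simp
  qed
  ultimately show ?thesis
    using hs u by auto
qed

definition total :: "('i \<Rightarrow> 'v) \<Rightarrow> bool" where
  "total e \<longleftrightarrow> (\<forall>u\<in>H. (\<forall>i. ip u (e i) = 0) \<longrightarrow> nrm u = 0)"

lemma Parseval_nrm:
  assumes e: "orthonormal_on UNIV e" and tot: "total e" and u: "u \<in> H"
  shows "((\<lambda>i. (cmod (ip u (e i)))\<^sup>2) has_sum (nrm u)\<^sup>2) UNIV"
proof -
  obtain u' where u': "u' \<in> H" "\<And>i. ip u' (e i) = ip u (e i)"
    "((\<lambda>i. (cmod (ip u (e i)))\<^sup>2) has_sum (nrm u')\<^sup>2) UNIV"
    using Riesz_Fischer[OF e Bessel_summable[OF e u]] by blast
  have ei: "e i \<in> H" for i
    using e by (simp add: orthonormal_on_def)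
  have "ip (u - u') (e i) = 0" for i
    unfolding ip_diff_left[OF u u'(1) ei] u'(2) by simp
  then have "nrm (u - u') = 0"
    using tot mem_diff[OF u u'(1)] unfolding total_def by blast
  then have "nrm u = nrm u'"
    using nrm_reverse_triangle[OF u u'(1)] by simp
  then show ?thesis using u' by simp
qed

lemma expansion_tendsto:
  assumes e: "orthonormal_on UNIV e" and tot: "total e" and u: "u \<in> H"
  shows "((\<lambda>F. nrm ((\<Sum>i\<in>F. ip u (e i) *\<^sub>C e i) - u)) \<longlongrightarrow> 0) (finite_subsets_at_top UNIV)"
proof -
  have "((\<lambda>F. (nrm u)\<^sup>2 - (\<Sum>i\<in>F. (cmod (ip u (e i)))\<^sup>2)) \<longlongrightarrow> (nrm u)\<^sup>2 - (nrm u)\<^sup>2)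
      (finite_subsets_at_top UNIV)"
    using Parseval_nrm[OF assms] unfolding has_sum_def by (intro tendsto_intros)
  then have lim: "((\<lambda>F. sqrt ((nrm u)\<^sup>2 - (\<Sum>i\<in>F. (cmod (ip u (e i)))\<^sup>2))) \<longlongrightarrow> sqrt 0)
      (finite_subsets_at_top UNIV)"
    by (intro tendsto_real_sqrt) simp
  have "sqrt ((nrm u)\<^sup>2 - (\<Sum>i\<in>F. (cmod (ip u (e i)))\<^sup>2)) = nrm ((\<Sum>i\<in>F. ip u (e i) *\<^sub>C e i) - u)"
    if F: "finite F" for F
  proof -
    have s: "(\<Sum>i\<in>F. ip u (e i) *\<^sub>C e i) \<in> H"
      using e by simp
    show ?thesis
      unfolding nrm_residual_orthonormal[OF e F subset_UNIV u, symmetric] nrm_minus_commute[OF s u]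
      using s u by simp
  qed
  then have "\<forall>\<^sub>F F in finite_subsets_at_top UNIV.
      sqrt ((nrm u)\<^sup>2 - (\<Sum>i\<in>F. (cmod (ip u (e i)))\<^sup>2)) = nrm ((\<Sum>i\<in>F. ip u (e i) *\<^sub>C e i) - u)"
    by (intro eventually_finite_subsets_at_top_weakI) auto
  with lim show ?thesis
    using Lim_transform_eventually[OF lim] by simp
qed

lemma Parseval:
  assumes e: "orthonormal_on UNIV e" and tot: "total e" and u: "u \<in> H" and v: "v \<in> H"
  shows "((\<lambda>i. ip u (e i) * cnj (ip v (e i))) has_sum ip u v) UNIV"
proof -
  have "((\<lambda>F. ip (\<Sum>i\<in>F. ip u (e i) *\<^sub>C e i) v) \<longlongrightarrow> ip u v) (finite_subsets_at_top UNIV)"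
    using e by (intro tendsto_ip_left u v expansion_tendsto assms) simp
  then show ?thesis
    unfolding has_sum_def ip_sum_orthonormal_left[OF e subset_UNIV v] .
qed

end

section \<open>Eigenbases of forms with compact embedding\<close>

text \<open>The form norm is \<open>F.nrm v = sqrt (a v v)\<close>, without the norm of \<open>H\<close> added; the assumption \<open>closed\<close> thus asks for
  convergence in \<open>H\<close> separately.\<close>
locale compact_form = semi_hilbert scale H ip + F: semi_inner_space scale V a
  for scale :: "complex \<Rightarrow> 'v::ab_group_add \<Rightarrow> 'v" (infixr "*\<^sub>C" 75) and H ip V a +
  assumes V_subset: "V \<subseteq> H"
    and dense: "u \<in> H \<Longrightarrow> \<epsilon> > 0 \<Longrightarrow> \<exists>v\<in>V. nrm (u - v) < \<epsilon>"
    and closed: "(\<And>j. x j \<in> V) \<Longrightarrow> u \<in> H \<Longrightarrow> (\<lambda>j. nrm (x j - u)) \<longlonglongrightarrow> 0 \<Longrightarrow> F.nrm_Cauchy x \<Longrightarrow>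
      u \<in> V \<and> (\<lambda>j. F.nrm (x j - u)) \<longlonglongrightarrow> 0"
    and compact: "(\<And>j. x j \<in> V) \<Longrightarrow> (\<And>j. nrm (x j) \<le> C) \<Longrightarrow> (\<And>j. F.nrm (x j) \<le> C) \<Longrightarrow>
      \<exists>r. strict_mono (r :: nat \<Rightarrow> nat) \<and> nrm_Cauchy (x \<circ> r)"
    and infinite_dim: "\<exists>w :: nat \<Rightarrow> 'v. range w \<subseteq> V \<and> orthonormal_on UNIV w"
begin

lemma V_in_H [simp]: "v \<in> V \<Longrightarrow> v \<in> H"
  using V_subset by auto

text \<open>Otherwise each vector of \<open>V\<close> would, up to a null vector, be a combination of the \<open>N\<close> given ones. Counting
  the squared coefficients of \<open>N + 1\<close> orthonormal vectors by rows and by columns gives \<open>N + 1 \<le> N\<close>.\<close>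
lemma exists_unit_orthogonal:
  assumes eV: "\<And>i. i < N \<Longrightarrow> e i \<in> V" and e: "orthonormal_on {..<N::nat} e"
  shows "\<exists>v\<in>V. nrm v = 1 \<and> (\<forall>i<N. ip v (e i) = 0)"
proof (rule ccontr)
  assume none: "\<not> ?thesis"
  obtain w :: "nat \<Rightarrow> 'v" where wV: "\<And>k. w k \<in> V" and w: "orthonormal_on UNIV w"
    using infinite_dim by blast
  have nw: "nrm (w k) = 1" for k
    using w by (simp add: orthonormal_on_def nrm_def)
  have res: "(\<Sum>i<N. (cmod (ip (w k) (e i)))\<^sup>2) = 1" for k
  proof (rule ccontr)
    assume ne: "(\<Sum>i<N. (cmod (ip (w k) (e i)))\<^sup>2) \<noteq> 1"
    define r where "r = w k - (\<Sum>i<N. ip (w k) (e i) *\<^sub>C e i)"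
    have rV: "r \<in> V"
      unfolding r_def using wV eV by (intro F.mem_diff F.mem_sum F.mem_scale) auto
    have "(nrm r)\<^sup>2 = 1 - (\<Sum>i<N. (cmod (ip (w k) (e i)))\<^sup>2)"
      unfolding r_def using nrm_residual_orthonormal[OF e _ _ V_in_H[OF wV], of "{..<N}"] nw by simp
    then have nr: "nrm r \<noteq> 0"
      using ne by auto
    have orth: "ip r (e i) = 0" if "i < N" for i
      unfolding r_def using residual_orthogonal[OF e _ _ V_in_H[OF wV], of "{..<N}" i] that by simp
    define v where "v = of_real (1 / nrm r) *\<^sub>C r"
    have "v \<in> V" "nrm v = 1" "\<forall>i<N. ip v (e i) = 0"
      unfolding v_def using rV nr orth eV
      by (auto simp: nrm_scale ip_scale_left norm_divide intro!: F.mem_scale)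
    then show False using none by blast
  qed
  have "real (Suc N) = (\<Sum>k\<le>N. \<Sum>i<N. (cmod (ip (w k) (e i)))\<^sup>2)"
    using res by simp
  also have "\<dots> = (\<Sum>i<N. \<Sum>k\<le>N. (cmod (ip (w k) (e i)))\<^sup>2)"
    by (rule sum.swap)
  also have "\<dots> \<le> (\<Sum>i<N. 1)"
  proof (rule sum_mono)
    fix i assume i: "i \<in> {..<N}"
    then have eH: "e i \<in> H" and "nrm (e i) = 1"
      using e by (auto simp: orthonormal_on_def nrm_def)
    have "cmod (ip (w k) (e i)) = cmod (ip (e i) (w k))" for k
      using ip_commute[OF eH V_in_H[OF wV], of k] by simp
    then show "(\<Sum>k\<le>N. (cmod (ip (w k) (e i)))\<^sup>2) \<le> 1"
      using Bessel[OF w _ _ eH, of "{..N}"] \<open>nrm (e i) = 1\<close> by simp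
  qed
  finally show False by simp
qed

text \<open>A minimising sequence of the Rayleigh quotient has an \<open>H\<close>-convergent subsequence by compactness. The
  parallelogram law in the form norm bounds \<open>a(x\<^sub>n - x\<^sub>m)\<close> by \<open>2a(x\<^sub>n) + 2a(x\<^sub>m) - \<mu>\<bar>x\<^sub>n + x\<^sub>m\<bar>\<^sup>2\<close>, which tends to
  \<open>2\<mu> + 2\<mu> - 4\<mu> = 0\<close>; so the subsequence also converges in the form norm.\<close>
lemma exists_minimizer:
  assumes eV: "\<And>i. i < N \<Longrightarrow> e i \<in> V" and e: "orthonormal_on {..<N::nat} e"
  shows "\<exists>u\<in>V. nrm u = 1 \<and> (\<forall>i<N. ip u (e i) = 0) \<and>
    (\<forall>v\<in>V. (\<forall>i<N. ip v (e i) = 0) \<longrightarrow> (F.nrm u)\<^sup>2 * (nrm v)\<^sup>2 \<le> (F.nrm v)\<^sup>2)"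
proof -
  define W where "W = {v\<in>V. \<forall>i<N. ip v (e i) = 0}"
  have WV: "v \<in> W \<Longrightarrow> v \<in> V" for v
    by (simp add: W_def)
  have W_add: "u + v \<in> W" and W_diff: "u - v \<in> W" if "u \<in> W" "v \<in> W" for u v
    using that eV by (auto simp: W_def ip_add_left ip_diff_left)
  have W_scale: "c *\<^sub>C u \<in> W" if "u \<in> W" for u c
    using that eV by (auto simp: W_def ip_scale_left)
  define R where "R = {(F.nrm v)\<^sup>2 | v. v \<in> W \<and> nrm v = 1}"
  have R_ne: "R \<noteq> {}"
    using exists_unit_orthogonal[OF eV e] by (auto simp: R_def W_def)
  have R_bdd: "bdd_below R"
    by (rule bdd_belowI[of _ 0]) (auto simp: R_def)
  define \<mu> where "\<mu> = Inf R"
  have \<mu>: "\<mu> * (nrm v)\<^sup>2 \<le> (F.nrm v)\<^sup>2" if v: "v \<in> W" for v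
  proof (cases "nrm v = 0")
    case False
    then have "(F.nrm (of_real (1 / nrm v) *\<^sub>C v))\<^sup>2 \<in> R"
      unfolding R_def using v W_scale[OF v]
      by (intro CollectI exI[of _ "of_real (1 / nrm v) *\<^sub>C v"])
         (auto simp: nrm_scale norm_divide WV)
    then have "\<mu> \<le> (F.nrm (of_real (1 / nrm v) *\<^sub>C v))\<^sup>2"
      unfolding \<mu>_def using R_bdd by (rule cInf_lower)
    also have "\<dots> = (F.nrm v)\<^sup>2 / (nrm v)\<^sup>2"
      using v by (simp add: F.nrm_scale WV norm_divide power_divide)
    finally show ?thesis
      using False by (simp add: field_simps)
  qed simp
  have "\<exists>v\<in>W. nrm v = 1 \<and> (F.nrm v)\<^sup>2 < \<mu> + 1 / real (Suc j)" for j
  proof -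
    have "Inf R < \<mu> + 1 / real (Suc j)"
      by (simp add: \<mu>_def)
    from cInf_lessD[OF R_ne this] show ?thesis
      unfolding R_def by auto
  qed
  then obtain y where y: "\<And>j. y j \<in> W" "\<And>j. nrm (y j) = 1"
    "\<And>j. (F.nrm (y j))\<^sup>2 < \<mu> + 1 / real (Suc j)"
    by metis
  have yV: "y j \<in> V" for j using y(1) WV by blast
  have y1: "(F.nrm (y j))\<^sup>2 \<le> \<mu> + 1" for j
  proof -
    have "1 / real (Suc j) \<le> 1" by simp
    then show ?thesis using y(3)[of j] by linarith
  qed
  have "\<exists>r. strict_mono (r :: nat \<Rightarrow> nat) \<and> nrm_Cauchy (y \<circ> r)"
  proof (rule compact)
    show "y j \<in> V" for j by (rule yV)
    show "nrm (y j) \<le> max 1 (sqrt (\<mu> + 1))" for j using y by simp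
    show "F.nrm (y j) \<le> max 1 (sqrt (\<mu> + 1))" for j
      using y1[of j] real_le_rsqrt by fastforce
  qed
  then obtain r :: "nat \<Rightarrow> nat" where r: "strict_mono r" and rC: "nrm_Cauchy (y \<circ> r)"
    by blast
  define x where "x = y \<circ> r"
  have xW: "x j \<in> W" and xV: "x j \<in> V" and x1: "nrm (x j) = 1" for j
    using y yV by (auto simp: x_def)
  have x\<mu>: "(F.nrm (x j))\<^sup>2 < \<mu> + 1 / real (Suc j)" for j
  proof -
    have "1 / real (Suc (r j)) \<le> 1 / real (Suc j)"
      using seq_suble[OF r, of j] by (simp add: field_simps)
    then show ?thesis using y(3)[of "r j"] by (simp add: x_def)
  qed
  have xC: "nrm_Cauchy x" using rC by (simp add: x_def)
  obtain u where u: "u \<in> H" and lim: "(\<lambda>j. nrm (x j - u)) \<longlonglongrightarrow> 0"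
    using complete[OF _ xC] xV by auto
  have "F.nrm_Cauchy x"
  proof (rule F.nrm_CauchyI[OF xV])
    fix \<epsilon> :: real assume \<epsilon>: "\<epsilon> > 0"
    \<comment> \<open>If the squared distance in \<open>H\<close> and the excess of the form values over \<open>\<mu>\<close> are less than \<open>\<delta>\<close>, the
      parallelogram law bounds the squared distance in the form norm by \<open>(4 + \<bar>\<mu>\<bar>)\<delta> < \<epsilon>\<^sup>2\<close>.\<close>
    define \<delta> where "\<delta> = \<epsilon>\<^sup>2 / (8 + 2 * \<bar>\<mu>\<bar>)"
    have \<delta>: "\<delta> > 0" using \<epsilon> by (auto simp: \<delta>_def intro!: divide_pos_pos add_pos_nonneg)
    obtain N1 where N1: "\<And>m n. m \<ge> N1 \<Longrightarrow> n \<ge> N1 \<Longrightarrow> nrm (x m - x n) < sqrt \<delta>"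
      using xC \<delta> unfolding nrm_Cauchy_def by (meson real_sqrt_gt_zero)
    obtain N2 where N2: "1 / real (Suc N2) < \<delta>"
      using \<delta> reals_Archimedean[of \<delta>] by (auto simp: inverse_eq_divide)
    have "F.nrm (x n - x m) < \<epsilon>" if mn: "max N1 N2 \<le> m" "m \<le> n" for m n
    proof (rule power2_less_imp_less)
      have small: "(F.nrm (x k))\<^sup>2 < \<mu> + \<delta>" if "k \<ge> N2" for k
      proof -
        have "1 / real (Suc k) \<le> 1 / real (Suc N2)"
          using that by (simp add: field_simps)
        then show ?thesis using x\<mu>[of k] N2 by linarith
      qed
      have d: "(nrm (x n - x m))\<^sup>2 < \<delta>"
      proof -
        have "nrm (x n - x m) < sqrt \<delta>" using N1 mn by simp
        then have "(nrm (x n - x m))\<^sup>2 < (sqrt \<delta>)\<^sup>2"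
          using xV by (intro power_strict_mono) auto
        then show ?thesis using \<delta> by simp
      qed
      have "(F.nrm (x n - x m))\<^sup>2 = 2 * (F.nrm (x n))\<^sup>2 + 2 * (F.nrm (x m))\<^sup>2 - (F.nrm (x n + x m))\<^sup>2"
        using F.parallelogram[OF xV xV, of n m] by simp
      also have "\<dots> \<le> 2 * (F.nrm (x n))\<^sup>2 + 2 * (F.nrm (x m))\<^sup>2 - \<mu> * (nrm (x n + x m))\<^sup>2"
        using \<mu>[OF W_add[OF xW xW]] by simp
      also have "(nrm (x n + x m))\<^sup>2 = 4 - (nrm (x n - x m))\<^sup>2"
        using parallelogram[of "x n" "x m"] xV x1 by simp
      also have "2 * (F.nrm (x n))\<^sup>2 + 2 * (F.nrm (x m))\<^sup>2 - \<mu> * (4 - (nrm (x n - x m))\<^sup>2)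
          \<le> 4 * \<delta> + \<bar>\<mu>\<bar> * \<delta>"
      proof -
        have "\<mu> * (nrm (x n - x m))\<^sup>2 \<le> \<bar>\<mu>\<bar> * \<delta>"
          using d by (intro mult_mono) auto
        then show ?thesis
          using small[of n] small[of m] mn by (simp add: algebra_simps)
      qed
      also have "\<dots> < \<epsilon>\<^sup>2"
      proof -
        have "\<delta> * (8 + 2 * \<bar>\<mu>\<bar>) = \<epsilon>\<^sup>2"
          by (simp add: \<delta>_def add_pos_nonneg less_imp_neq[symmetric])
        moreover have "\<delta> * \<bar>\<mu>\<bar> \<ge> 0" using \<delta> by simp
        ultimately have "8 * \<delta> + 2 * (\<delta> * \<bar>\<mu>\<bar>) = \<epsilon>\<^sup>2" "\<delta> * \<bar>\<mu>\<bar> \<ge> 0"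
          by (simp_all add: algebra_simps)
        then show ?thesis using \<delta> mult.commute[of \<delta> "\<bar>\<mu>\<bar>"] by linarith
      qed
      finally show "(F.nrm (x n - x m))\<^sup>2 < \<epsilon>\<^sup>2" .
    qed (use \<epsilon> in simp)
    then show "\<exists>N. \<forall>m n. N \<le> m \<longrightarrow> m \<le> n \<longrightarrow> F.nrm (x n - x m) < \<epsilon>" by blast
  qed
  then have uV: "u \<in> V" and limF: "(\<lambda>j. F.nrm (x j - u)) \<longlonglongrightarrow> 0"
    using closed[OF xV u lim] by auto
  have u1: "nrm u = 1"
    using tendsto_nrm[OF _ u lim] xV x1 by (simp add: LIMSEQ_const_iff)
  have orth: "\<forall>i<N. ip u (e i) = 0"
  proof (intro allI impI)
    fix i assume i: "i < N"
    have "(\<lambda>j. ip (x j) (e i)) \<longlonglongrightarrow> ip u (e i)"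
      using xV eV[OF i] by (intro tendsto_ip_left u lim) auto
    then show "ip u (e i) = 0"
      using xW i by (simp add: W_def LIMSEQ_const_iff)
  qed
  have "(F.nrm u)\<^sup>2 \<le> \<mu>"
  proof (rule LIMSEQ_le)
    show "(\<lambda>j. (F.nrm (x j))\<^sup>2) \<longlonglongrightarrow> (F.nrm u)\<^sup>2"
      by (intro tendsto_power F.tendsto_nrm xV uV limF)
    have "(\<lambda>j. \<mu> + 1 / real (Suc j)) \<longlonglongrightarrow> \<mu> + 0"
      by (intro tendsto_intros LIMSEQ_Suc[OF lim_1_over_n])
    then show "(\<lambda>j. \<mu> + 1 / real (Suc j)) \<longlonglongrightarrow> \<mu>" by simp
    show "\<exists>N. \<forall>n\<ge>N. (F.nrm (x n))\<^sup>2 \<le> \<mu> + 1 / real (Suc n)"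
      using x\<mu> less_imp_le by blast
  qed
  then have "(F.nrm u)\<^sup>2 * (nrm v)\<^sup>2 \<le> (F.nrm v)\<^sup>2" if "v \<in> W" for v
    using \<mu>[OF that] mult_right_mono[of "(F.nrm u)\<^sup>2" \<mu> "(nrm v)\<^sup>2"] by simp
  then show ?thesis
    using uV u1 orth by (intro bexI[of _ u]) (auto simp: W_def)
qed

text \<open>By minimality \<open>a - \<mu>\<langle>\<cdot>, \<cdot>\<rangle>\<close> is again a semi-inner product on the orthogonal complement, and \<open>u\<close> is a
  null vector of it; null vectors are orthogonal to everything. This is the Euler-Lagrange equation.\<close>
lemma minimizer_eigenvector:
  assumes eV: "\<And>i. i < N \<Longrightarrow> e i \<in> V"
    and u: "u \<in> V" "nrm u = 1" "\<forall>i<N::nat. ip u (e i) = 0"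
    and min: "\<And>v. v \<in> V \<Longrightarrow> \<forall>i<N. ip v (e i) = 0 \<Longrightarrow> (F.nrm u)\<^sup>2 * (nrm v)\<^sup>2 \<le> (F.nrm v)\<^sup>2"
    and v: "v \<in> V" "\<forall>i<N. ip v (e i) = 0"
  shows "a u v = of_real ((F.nrm u)\<^sup>2) * ip u v"
proof -
  define W where "W = {v\<in>V. \<forall>i<N. ip v (e i) = 0}"
  define \<mu> where "\<mu> = (F.nrm u)\<^sup>2"
  interpret W: semi_inner_space scale W "\<lambda>u v. a u v - of_real \<mu> * ip u v"
  proof unfold_locales
    show "subspace W"
      unfolding subspace_def W_def using eV by (auto simp: ip_add_left ip_scale_left)
  next
    fix x y z assume "x \<in> W" "y \<in> W" "z \<in> W"
    then show "a (x + y) z - of_real \<mu> * ip (x + y) z =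
        a x z - of_real \<mu> * ip x z + (a y z - of_real \<mu> * ip y z)"
      by (simp add: W_def ip_add_left F.ip_add_left algebra_simps)
  next
    fix x z c assume "x \<in> W" "z \<in> W"
    then show "a (c *\<^sub>C x) z - of_real \<mu> * ip (c *\<^sub>C x) z = c * (a x z - of_real \<mu> * ip x z)"
      by (simp add: W_def ip_scale_left F.ip_scale_left algebra_simps)
  next
    fix x y assume "x \<in> W" "y \<in> W"
    then show "a y x - of_real \<mu> * ip y x = cnj (a x y - of_real \<mu> * ip x y)"
      using ip_commute[of x y] F.ip_commute[of x y] by (simp add: W_def)
  next
    fix x assume "x \<in> W"
    then show "0 \<le> Re (a x x - of_real \<mu> * ip x x)"
      using min[of x] by (simp add: W_def \<mu>_def F.nrm_sq nrm_sq)
  qed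
  have "W.nrm u = 0"
    unfolding W.nrm_def using u by (simp add: F.ip_self ip_self \<mu>_def)
  then have "a u v - of_real \<mu> * ip u v = 0"
    using u v by (intro W.ip_null_left) (auto simp: W_def)
  then show ?thesis by (simp add: \<mu>_def)
qed

lemma exists_minimizing_sequence:
  "\<exists>e. \<forall>N::nat. e N \<in> V \<and> nrm (e N) = 1 \<and> (\<forall>i<N. ip (e N) (e i) = 0) \<and>
     (\<forall>v\<in>V. (\<forall>i<N. ip v (e i) = 0) \<longrightarrow> (F.nrm (e N))\<^sup>2 * (nrm v)\<^sup>2 \<le> (F.nrm v)\<^sup>2)"
proof -
  define P where "P e N u \<longleftrightarrow> u \<in> V \<and> nrm u = 1 \<and> (\<forall>i<N. ip u (e i) = 0) \<and>
     (\<forall>v\<in>V. (\<forall>i<N. ip v (e i) = 0) \<longrightarrow> (F.nrm u)\<^sup>2 * (nrm v)\<^sup>2 \<le> (F.nrm v)\<^sup>2)"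
    for e :: "nat \<Rightarrow> 'v" and N :: nat and u
  have "\<exists>e. \<forall>N. P e N (e N)"
  proof (rule dependent_wf_choice[of less_than])
    fix f g :: "nat \<Rightarrow> 'v" and N r
    assume "\<And>i. (i, N) \<in> less_than \<Longrightarrow> f i = g i"
    then show "P f N r = P g N r" by (simp add: P_def)
  next
    fix N and e :: "nat \<Rightarrow> 'v"
    assume "\<And>i. (i, N) \<in> less_than \<Longrightarrow> P e i (e i)"
    then have P: "P e i (e i)" if "i < N" for i
      using that by simp
    have eV: "e i \<in> V" if "i < N" for i
      using P[OF that] by (simp add: P_def)
    have ii: "ip (e i) (e i) = 1" if "i < N" for i
      using P[OF that] by (simp add: P_def ip_self)
    have ij: "ip (e i) (e j) = 0" if "i < N" "j < N" "i \<noteq> j" for i j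
    proof (cases "j < i")
      case True
      then show ?thesis using P[OF that(1)] by (simp add: P_def)
    next
      case False
      then have "ip (e j) (e i) = 0" using P[OF that(2)] that by (simp add: P_def)
      then show ?thesis using ip_commute[of "e j" "e i"] eV that by simp
    qed
    have "orthonormal_on {..<N} e"
      unfolding orthonormal_on_def using eV ii ij by auto
    from exists_minimizer[OF eV this] show "\<exists>r. P e N r"
      by (auto simp: P_def)
  qed simp
  then show ?thesis unfolding P_def .
qed

text \<open>If the eigenvalues were bounded, compactness would give a convergent subsequence of orthonormal vectors.
  For \<open>v \<in> V\<close> the residual \<open>r\<close> of the expansion up to \<open>N\<close> satisfies \<open>\<lambda>\<^sub>N\<bar>r\<bar>\<^sup>2 \<le> a(r) \<le> a(v)\<close>, so it tends
  to zero; density of \<open>V\<close> then makes the system total.\<close>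
theorem eigenbasis:
  "\<exists>e (lam :: nat \<Rightarrow> real). (\<forall>k. e k \<in> V) \<and> orthonormal_on UNIV e \<and> total e \<and>
     (\<forall>k. \<forall>v\<in>V. a (e k) v = of_real (lam k) * ip (e k) v) \<and>
     incseq lam \<and> (\<forall>k. 0 \<le> lam k) \<and> filterlim lam at_top sequentially"
proof -
  obtain e where eV: "\<And>N. e N \<in> V" and e1: "\<And>N. nrm (e N) = 1"
    and orth: "\<And>N. \<forall>i<N::nat. ip (e N) (e i) = 0"
    and min: "\<And>N v. v \<in> V \<Longrightarrow> \<forall>i<N. ip v (e i) = 0 \<Longrightarrow> (F.nrm (e N))\<^sup>2 * (nrm v)\<^sup>2 \<le> (F.nrm v)\<^sup>2"
    using exists_minimizing_sequence by metis
  define lam where "lam N = (F.nrm (e N))\<^sup>2" for N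
  have eH: "e N \<in> H" for N using eV by simp
  have orth': "ip (e i) (e j) = (if i = j then 1 else 0)" for i j
  proof -
    consider "i = j" | "j < i" | "i < j" by linarith
    then show ?thesis
    proof cases
      case 3
      then have "ip (e j) (e i) = 0" using orth by simp
      then show ?thesis using 3 ip_commute[OF eH eH, of j i] by simp
    qed (use eH e1 orth in \<open>auto simp: ip_self\<close>)
  qed
  then have e: "orthonormal_on UNIV e"
    using eH by (auto simp: orthonormal_on_def)
  have aW: "a (e N) v = of_real (lam N) * ip (e N) v" if "v \<in> V" "\<forall>i<N. ip v (e i) = 0" for N v
    unfolding lam_def by (rule minimizer_eigenvector[OF eV eV e1 orth min that])
  have aee: "a (e j) (e N) = (if j = N then of_real (lam N) else 0)" for j N
  proof -
    consider "j \<le> N" | "N < j" by linarith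
    then show ?thesis
    proof cases
      case 1
      then show ?thesis
        using aW[OF eV, of j N] orth[of N] orth' by simp
    next
      case 2
      then have "a (e N) (e j) = 0"
        using aW[OF eV, of N j] orth[of j] orth' by simp
      then show ?thesis
        using 2 F.ip_commute[OF eV eV, of N j] by simp
    qed
  qed
  have eigen: "a (e N) v = of_real (lam N) * ip (e N) v" if v: "v \<in> V" for N v
  proof -
    define s where "s = (\<Sum>i<N. ip v (e i) *\<^sub>C e i)"
    have sV: "s \<in> V" unfolding s_def using eV by (intro F.mem_sum F.mem_scale)
    have r: "a (e N) (v - s) = of_real (lam N) * ip (e N) (v - s)"
    proof (rule aW)
      show "v - s \<in> V" using v sV by simp
      show "\<forall>i<N. ip (v - s) (e i) = 0"
        unfolding s_def using residual_orthogonal[OF e _ _ V_in_H[OF v], of "{..<N}"] by simp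
    qed
    have "a (e N) s = 0"
      unfolding s_def using eV by (subst F.ip_sum_right) (auto simp: F.ip_scale_right aee)
    moreover have "ip (e N) s = 0"
      unfolding s_def using eH by (subst ip_sum_right) (auto simp: ip_scale_right orth')
    ultimately show ?thesis
      using r v sV eV by (simp add: F.ip_diff_right ip_diff_right)
  qed
  have mono: "incseq lam"
  proof (rule incseq_SucI)
    fix N
    show "lam N \<le> lam (Suc N)"
      using min[OF eV, of N "Suc N"] orth[of "Suc N"] e1 by (simp add: lam_def)
  qed
  have lam0: "0 \<le> lam k" for k by (simp add: lam_def)
  have unbounded: "\<exists>k. C < lam k" for C
  proof (rule ccontr)
    assume "\<nexists>k. C < lam k"
    then have le: "lam k \<le> C" for k by (simp add: not_less)
    have "\<exists>r. strict_mono (r :: nat \<Rightarrow> nat) \<and> nrm_Cauchy (e \<circ> r)"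
    proof (rule compact[OF eV])
      show "nrm (e j) \<le> max 1 (sqrt C)" for j using e1 by simp
      show "F.nrm (e j) \<le> max 1 (sqrt C)" for j
        using le[of j] real_le_rsqrt unfolding lam_def by fastforce
    qed
    then obtain r :: "nat \<Rightarrow> nat" where r: "strict_mono r" and "nrm_Cauchy (e \<circ> r)" by blast
    then obtain N where N: "\<And>m n. m \<ge> N \<Longrightarrow> n \<ge> N \<Longrightarrow> nrm (e (r m) - e (r n)) < 1"
      unfolding nrm_Cauchy_def by (metis comp_apply zero_less_one)
    have "r N \<noteq> r (Suc N)"
      using strict_monoD[OF r, of N "Suc N"] by simp
    then have "(nrm (e (r N) - e (r (Suc N))))\<^sup>2 = 2"
      using nrm_diff_sq[OF eH eH] e1 orth' by simp
    moreover have "(nrm (e (r N) - e (r (Suc N))))\<^sup>2 < 1\<^sup>2"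
      using N[of N "Suc N"] eH by (intro power_strict_mono) auto
    ultimately show False by simp
  qed
  have lim: "filterlim lam at_top sequentially"
    unfolding filterlim_at_top_gt[where c = 0]
  proof (intro allI impI)
    fix Z :: real
    obtain k where "Z < lam k" using unbounded by blast
    then have "\<forall>j\<ge>k. Z \<le> lam j"
      using incseqD[OF mono] by (meson less_imp_le order_trans)
    then show "\<forall>\<^sub>F x in sequentially. Z \<le> lam x"
      by (auto simp: eventually_sequentially)
  qed
  have approx: "\<exists>N. nrm (v - (\<Sum>i<N. ip v (e i) *\<^sub>C e i)) < \<epsilon>" if v: "v \<in> V" and \<epsilon>: "\<epsilon> > 0" for v \<epsilon>
  proof -
    obtain N where N: "(F.nrm v)\<^sup>2 / \<epsilon>\<^sup>2 < lam N" using unbounded by blast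
    define s where "s = (\<Sum>i<N. ip v (e i) *\<^sub>C e i)"
    define r where "r = v - s"
    have sV: "s \<in> V" unfolding s_def using eV by (intro F.mem_sum F.mem_scale)
    have rV: "r \<in> V" using v sV by (simp add: r_def)
    have r0: "\<forall>i<N. ip r (e i) = 0"
      unfolding r_def s_def using residual_orthogonal[OF e _ _ V_in_H[OF v], of "{..<N}"] by simp
    have "a s r = (\<Sum>i<N. ip v (e i) * a (e i) r)"
      unfolding s_def using eV rV by (subst F.ip_sum_left) (auto simp: F.ip_scale_left)
    also have "\<dots> = 0"
      using r0 ip_commute[OF V_in_H[OF rV] eH] by (simp add: eigen[OF rV])
    finally have asr: "a s r = 0" .
    have "(F.nrm v)\<^sup>2 = (F.nrm (s + r))\<^sup>2" by (simp add: r_def)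
    also have "\<dots> = (F.nrm s)\<^sup>2 + (F.nrm r)\<^sup>2"
      using F.nrm_add_sq[OF sV rV] asr by simp
    finally have "(F.nrm r)\<^sup>2 \<le> (F.nrm v)\<^sup>2" by simp
    moreover have "lam N * (nrm r)\<^sup>2 \<le> (F.nrm r)\<^sup>2"
      unfolding lam_def using min[OF rV r0] .
    ultimately have le: "lam N * (nrm r)\<^sup>2 \<le> (F.nrm v)\<^sup>2" by linarith
    have "nrm r < \<epsilon>"
    proof (rule ccontr)
      assume "\<not> nrm r < \<epsilon>"
      then have "\<epsilon>\<^sup>2 \<le> (nrm r)\<^sup>2" using \<epsilon> by (intro power_mono) auto
      then have "lam N * \<epsilon>\<^sup>2 \<le> (F.nrm v)\<^sup>2"
        using le mult_left_mono[OF _ lam0[of N], of "\<epsilon>\<^sup>2" "(nrm r)\<^sup>2"] by linarith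
      then show False using N \<epsilon> by (simp add: field_simps)
    qed
    then show ?thesis unfolding r_def s_def by blast
  qed
  have "total e"
    unfolding total_def
  proof (intro ballI impI)
    fix u assume u: "u \<in> H" and u0: "\<forall>i. ip u (e i) = 0"
    have bound: "(nrm u)\<^sup>2 \<le> nrm u * (2 * \<epsilon>)" if \<epsilon>: "\<epsilon> > 0" for \<epsilon>
    proof -
      obtain v where v: "v \<in> V" "nrm (u - v) < \<epsilon>" using dense[OF u \<epsilon>] by blast
      obtain N where N: "nrm (v - (\<Sum>i<N. ip v (e i) *\<^sub>C e i)) < \<epsilon>" using approx[OF v(1) \<epsilon>] by blast
      define s where "s = (\<Sum>i<N. ip v (e i) *\<^sub>C e i)"
      have sH: "s \<in> H" unfolding s_def using eH by (intro mem_sum mem_scale)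
      have "ip u s = 0"
        unfolding s_def using eH u u0 by (subst ip_sum_right) (auto simp: ip_scale_right)
      then have "(nrm u)\<^sup>2 = Re (ip u (u - s))"
        using u sH by (simp add: nrm_sq ip_diff_right)
      also have "\<dots> \<le> cmod (ip u (u - s))" by (rule complex_Re_le_cmod)
      also have "\<dots> \<le> nrm u * nrm (u - s)" using u sH by (intro Cauchy_Schwarz) auto
      also have "\<dots> \<le> nrm u * (2 * \<epsilon>)"
        using nrm_diff_triangle[OF u V_in_H[OF v(1)] sH] v(2) N u
        by (intro mult_left_mono) (auto simp: s_def)
      finally show ?thesis .
    qed
    show "nrm u = 0"
    proof (rule ccontr)
      assume "nrm u \<noteq> 0"
      then have "nrm u > 0" using nrm_nonneg[OF u] by linarith
      then show False
        using bound[of "nrm u / 4"] by (simp add: power2_eq_square)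
    qed
  qed
  then show ?thesis
    using eV e eigen mono lam0 lim by blast
qed

end

section \<open>The operator of a diagonalised form\<close>

text \<open>The self-adjoint operator associated with the form \<open>a\<close>, as a graph.\<close>
definition (in compact_form) form_graph :: "('v \<times> 'v) set" where
  "form_graph = {(u, f). u \<in> V \<and> f \<in> H \<and> (\<forall>v\<in>V. a u v = ip f v)}"

locale diagonal_form = compact_form scale H ip V a
  for scale :: "complex \<Rightarrow> 'v::ab_group_add \<Rightarrow> 'v" (infixr "*\<^sub>C" 75) and H ip V a +
  fixes e :: "nat \<Rightarrow> 'v" and lam :: "nat \<Rightarrow> real"
  assumes e_in_V: "e k \<in> V"
    and orthonormal_e: "orthonormal_on UNIV e"
    and total_e: "total e"
    and eigen: "v \<in> V \<Longrightarrow> a (e k) v = of_real (lam k) * ip (e k) v"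
    and lam_nonneg: "0 \<le> lam k"
    and incseq_lam: "incseq lam"
    and lam_tendsto: "filterlim lam at_top sequentially"
begin

lemma e_in_H [simp]: "e k \<in> H"
  using e_in_V by simp

lemma ip_ee: "ip (e i) (e j) = (if i = j then 1 else 0)"
  using orthonormal_e by (simp add: orthonormal_on_def)

lemma norm_sum_form:
  assumes "finite K"
  shows "(F.nrm (\<Sum>k\<in>K. c k *\<^sub>C e k))\<^sup>2 = (\<Sum>k\<in>K. lam k * (cmod (c k))\<^sup>2)"
proof -
  define s where "s = (\<Sum>k\<in>K. c k *\<^sub>C e k)"
  have sV: "s \<in> V" unfolding s_def using e_in_V by (intro F.mem_sum F.mem_scale)
  have es: "ip (e k) s = (if k \<in> K then cnj (c k) else 0)" for k
    using ip_commute[of s "e k"] ip_sum_orthonormal[OF orthonormal_e assms, of k c] sV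
    by (simp add: s_def)
  have "a s s = (\<Sum>k\<in>K. a (c k *\<^sub>C e k) s)"
    using sV e_in_V unfolding s_def by (subst F.ip_sum_left) auto
  also have "\<dots> = (\<Sum>k\<in>K. of_real (lam k * (cmod (c k))\<^sup>2))"
  proof (intro sum.cong refl)
    fix k assume "k \<in> K"
    then have "a (c k *\<^sub>C e k) s = of_real (lam k) * (c k * cnj (c k))"
      using F.ip_scale_left[OF e_in_V sV] eigen[OF sV] es by simp
    then show "a (c k *\<^sub>C e k) s = of_real (lam k * (cmod (c k))\<^sup>2)"
      by (simp only: of_real_mult complex_norm_square)
  qed
  finally show ?thesis
    using F.nrm_sq[OF sV] by (simp add: s_def)
qed

lemma partial_sums_tendsto:
  assumes u: "u \<in> H"
  shows "(\<lambda>N. nrm ((\<Sum>k<N. ip u (e k) *\<^sub>C e k) - u)) \<longlonglongrightarrow> 0"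
  using filterlim_compose[OF expansion_tendsto[OF orthonormal_e total_e u] filterlim_lessThan_at_top]
  by simp

lemma coefficient_series:
  assumes u: "u \<in> H" and v: "v \<in> H"
  shows "(\<lambda>N. \<Sum>k<N. ip u (e k) * ip (e k) v) \<longlonglongrightarrow> ip u v"
proof -
  have "(\<lambda>N. ip (\<Sum>k<N. ip u (e k) *\<^sub>C e k) v) \<longlonglongrightarrow> ip u v"
    by (intro tendsto_ip_left u v partial_sums_tendsto mem_sum mem_scale e_in_H)
  moreover have "ip (\<Sum>k<N. ip u (e k) *\<^sub>C e k) v = (\<Sum>k<N. ip u (e k) * ip (e k) v)" for N
    using v by (subst ip_sum_left) (auto simp: ip_scale_left)
  ultimately show ?thesis by simp
qed

lemma ip_eqI:
  assumes u: "u \<in> H" and v: "v \<in> H" and "\<And>k. ip u (e k) = ip v (e k)"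
  shows "nrm (u - v) = 0"
  using total_e assms by (auto simp: total_def ip_diff_left)

text \<open>The operator is multiplication by \<open>\<lambda>\<^sub>k\<close> on coefficients. In the direction from right to left, membership of \<open>u\<close>
  in \<open>V\<close> is not given: \<open>\<lambda>\<^sub>k\<bar>u\<^sub>k\<bar>\<^sup>2 = \<bar>f\<^sub>k\<bar>\<bar>u\<^sub>k\<bar>\<close> is summable, hence the partial sums are Cauchy in the form norm and
  closedness applies.\<close>
lemma form_graph_iff:
  "(u, f) \<in> form_graph \<longleftrightarrow> u \<in> H \<and> f \<in> H \<and> (\<forall>k. ip f (e k) = of_real (lam k) * ip u (e k))"
proof (intro iffI conjI allI)
  assume A: "(u, f) \<in> form_graph"
  then have uV: "u \<in> V" and f: "f \<in> H" and uf: "\<And>v. v \<in> V \<Longrightarrow> a u v = ip f v"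
    by (auto simp: form_graph_def)
  show "u \<in> H" "f \<in> H" using uV f by auto
  fix k
  have "ip f (e k) = cnj (a (e k) u)"
    using uf[OF e_in_V] F.ip_commute[OF e_in_V uV] by simp
  also have "\<dots> = of_real (lam k) * ip u (e k)"
    using eigen[OF uV] ip_commute[of "e k" u] uV by simp
  finally show "ip f (e k) = of_real (lam k) * ip u (e k)" .
next
  assume A: "u \<in> H \<and> f \<in> H \<and> (\<forall>k. ip f (e k) = of_real (lam k) * ip u (e k))"
  then have u: "u \<in> H" and f: "f \<in> H" and fk: "\<And>k. ip f (e k) = of_real (lam k) * ip u (e k)"
    by auto
  define x where "x N = (\<Sum>k<N. ip u (e k) *\<^sub>C e k)" for N
  have xV: "x N \<in> V" for N
    unfolding x_def using e_in_V by (intro F.mem_sum F.mem_scale)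
  have lim: "(\<lambda>N. nrm (x N - u)) \<longlonglongrightarrow> 0"
    unfolding x_def using partial_sums_tendsto[OF u] .
  have sq_summable: "summable (\<lambda>k. (cmod (ip h (e k)))\<^sup>2)" if "h \<in> H" for h
    using Bessel_summable[OF orthonormal_e that]
    by (simp add: summable_on_UNIV_nonneg_real_iff)
  have "summable (\<lambda>k. lam k * (cmod (ip u (e k)))\<^sup>2)"
  proof (rule summable_comparison_test')
    show "summable (\<lambda>k. (cmod (ip f (e k)))\<^sup>2 + (cmod (ip u (e k)))\<^sup>2)"
      by (intro summable_add sq_summable u f)
    fix k
    have "lam k * (cmod (ip u (e k)))\<^sup>2 = cmod (ip f (e k)) * cmod (ip u (e k))"
      using lam_nonneg[of k] by (simp add: fk norm_mult power2_eq_square)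
    also have "\<dots> \<le> (cmod (ip f (e k)))\<^sup>2 + (cmod (ip u (e k)))\<^sup>2"
      using sum_squares_bound[of "cmod (ip f (e k))" "cmod (ip u (e k))"]
        mult_nonneg_nonneg[OF norm_ge_zero norm_ge_zero, of "ip f (e k)" "ip u (e k)"] by linarith
    finally show "norm (lam k * (cmod (ip u (e k)))\<^sup>2) \<le> (cmod (ip f (e k)))\<^sup>2 + (cmod (ip u (e k)))\<^sup>2"
      using lam_nonneg[of k] by simp
  qed
  then have cau: "Cauchy (\<lambda>N. \<Sum>k<N. lam k * (cmod (ip u (e k)))\<^sup>2)"
    by (simp add: summable_iff_convergent Cauchy_convergent_iff)
  have "F.nrm_Cauchy x"
  proof (rule F.nrm_CauchyI[OF xV])
    fix \<epsilon> :: real assume \<epsilon>: "\<epsilon> > 0"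
    then obtain N where N: "\<And>m n. m \<ge> N \<Longrightarrow> n \<ge> N \<Longrightarrow>
        dist (\<Sum>k<m. lam k * (cmod (ip u (e k)))\<^sup>2) (\<Sum>k<n. lam k * (cmod (ip u (e k)))\<^sup>2) < \<epsilon>\<^sup>2"
      using metric_CauchyD[OF cau, of "\<epsilon>\<^sup>2"] by auto
    have "F.nrm (x n - x m) < \<epsilon>" if "N \<le> m" "m \<le> n" for m n
    proof (rule power2_less_imp_less)
      have diff: "(\<Sum>k<n. g k) - (\<Sum>k<m. g k) = (\<Sum>k\<in>{m..<n}. g k)" for g :: "nat \<Rightarrow> 'b::ab_group_add"
        using sum_diff_nat_ivl[of 0 m n g] that by (simp add: atLeast0LessThan)
      have "x n - x m = (\<Sum>k\<in>{m..<n}. ip u (e k) *\<^sub>C e k)"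
        unfolding x_def by (rule diff)
      then have "(F.nrm (x n - x m))\<^sup>2 = (\<Sum>k\<in>{m..<n}. lam k * (cmod (ip u (e k)))\<^sup>2)"
        using norm_sum_form by simp
      also have "\<dots> < \<epsilon>\<^sup>2"
        using N[of n m] that by (simp add: dist_real_def diff)
      finally show "(F.nrm (x n - x m))\<^sup>2 < \<epsilon>\<^sup>2" .
    qed (use \<epsilon> in simp)
    then show "\<exists>N. \<forall>m n. N \<le> m \<longrightarrow> m \<le> n \<longrightarrow> F.nrm (x n - x m) < \<epsilon>" by blast
  qed
  then have uV: "u \<in> V" and limF: "(\<lambda>N. F.nrm (x N - u)) \<longlonglongrightarrow> 0"
    using closed[OF xV u lim] by auto
  have "a u v = ip f v" if v: "v \<in> V" for v
  proof (rule LIMSEQ_unique)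
    show "(\<lambda>N. a (x N) v) \<longlonglongrightarrow> a u v"
      by (rule F.tendsto_ip_left[OF xV uV v limF])
    have "a (x N) v = (\<Sum>k<N. ip f (e k) * ip (e k) v)" for N
      unfolding x_def using v e_in_V
      by (subst F.ip_sum_left) (auto simp: F.ip_scale_left eigen fk mult_ac)
    then show "(\<lambda>N. a (x N) v) \<longlonglongrightarrow> ip f v"
      using coefficient_series[OF f V_in_H[OF v]] by simp
  qed
  then show "(u, f) \<in> form_graph"
    using uV f by (auto simp: form_graph_def)
qed

lemma eigenvector_in_graph: "(e k, of_real (lam k) *\<^sub>C e k) \<in> form_graph"
  by (auto simp: form_graph_iff ip_scale_left ip_ee)

lemma dense_domain:
  assumes f: "f \<in> H" and \<epsilon>: "\<epsilon> > 0"
  shows "\<exists>u g. (u, g) \<in> form_graph \<and> nrm (f - u) < \<epsilon>"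
proof -
  have "\<forall>\<^sub>F N in sequentially. nrm ((\<Sum>k<N. ip f (e k) *\<^sub>C e k) - f) < \<epsilon>"
    using order_tendstoD(2)[OF partial_sums_tendsto[OF f] \<epsilon>] .
  then obtain N where N: "nrm ((\<Sum>k<N. ip f (e k) *\<^sub>C e k) - f) < \<epsilon>"
    using eventually_happens'[OF sequentially_bot] by blast
  define u where "u = (\<Sum>k<N. ip f (e k) *\<^sub>C e k)"
  define g where "g = (\<Sum>k<N. (of_real (lam k) * ip f (e k)) *\<^sub>C e k)"
  have u: "u \<in> H" and "g \<in> H" by (auto simp: u_def g_def)
  moreover have "ip g (e k) = of_real (lam k) * ip u (e k)" for k
    unfolding u_def g_def by (simp add: ip_sum_orthonormal[OF orthonormal_e])
  ultimately have "(u, g) \<in> form_graph"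
    by (simp add: form_graph_iff)
  moreover have "nrm (f - u) < \<epsilon>"
    using N nrm_minus_commute[OF f u] by (simp add: u_def)
  ultimately show ?thesis by blast
qed

lemma adjoint_form_graph:
  "{(v, g). v \<in> H \<and> g \<in> H \<and> (\<forall>(u, f)\<in>form_graph. ip f v = ip u g)} = form_graph"
proof (intro set_eqI iffI; clarify)
  fix v g assume v: "v \<in> H" and g: "g \<in> H" and adj: "\<forall>(u, f)\<in>form_graph. ip f v = ip u g"
  have "ip g (e k) = of_real (lam k) * ip v (e k)" for k
  proof -
    have "of_real (lam k) * ip (e k) v = ip (e k) g"
      using adj eigenvector_in_graph[of k] v by (auto simp: ip_scale_left)
    then have "cnj (of_real (lam k) * ip (e k) v) = cnj (ip (e k) g)" by simp
    then show ?thesis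
      using ip_commute[of "e k" v] ip_commute[of "e k" g] v g by simp
  qed
  then show "(v, g) \<in> form_graph" using v g by (simp add: form_graph_iff)
next
  fix v g assume vg: "(v, g) \<in> form_graph"
  then have v: "v \<in> H" and g: "g \<in> H" and gk: "\<And>k. ip g (e k) = of_real (lam k) * ip v (e k)"
    by (auto simp: form_graph_iff)
  have "ip f v = ip u g" if "(u, f) \<in> form_graph" for u f
  proof (rule has_sum_unique)
    from that have u: "u \<in> H" and f: "f \<in> H"
      and fk: "\<And>k. ip f (e k) = of_real (lam k) * ip u (e k)"
      by (auto simp: form_graph_iff)
    show "((\<lambda>k. ip f (e k) * cnj (ip v (e k))) has_sum ip f v) UNIV"
      by (rule Parseval[OF orthonormal_e total_e f v])
    have "((\<lambda>k. ip u (e k) * cnj (ip g (e k))) has_sum ip u g) UNIV"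
      by (rule Parseval[OF orthonormal_e total_e u g])
    moreover have "ip u (e k) * cnj (ip g (e k)) = ip f (e k) * cnj (ip v (e k))" for k
      by (simp add: fk gk)
    ultimately show "((\<lambda>k. ip f (e k) * cnj (ip v (e k))) has_sum ip u g) UNIV" by simp
  qed
  then show "v \<in> H \<and> g \<in> H \<and> (\<forall>(u, f)\<in>form_graph. ip f v = ip u g)"
    using v g by auto
qed

lemma finite_eigenindices: "finite {k. lam k \<le> C}"
proof -
  have "\<forall>\<^sub>F k in sequentially. C < lam k"
    using lam_tendsto by (simp add: filterlim_at_top_dense)
  then obtain N where N: "\<And>k. k \<ge> N \<Longrightarrow> C < lam k"
    by (auto simp: eventually_sequentially)
  have "k < N" if "lam k \<le> C" for k
    using N[of k] that by (cases "k < N") auto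
  then have "{k. lam k \<le> C} \<subseteq> {..<N}" by auto
  then show ?thesis by (rule finite_subset) simp
qed

text \<open>Eigenvalues above \<open>\<bar>z\<bar> + 1\<close> have distance at least one from \<open>z\<close>, and only finitely many others remain.\<close>
lemma discrete_eigenvalues:
  "\<exists>\<delta>>0. \<forall>k. complex_of_real (lam k) \<noteq> z \<longrightarrow> \<delta> \<le> cmod (of_real (lam k) - z)"
proof -
  define K where "K = {k. lam k \<le> cmod z + 1 \<and> complex_of_real (lam k) \<noteq> z}"
  define D where "D = insert 1 ((\<lambda>k. cmod (of_real (lam k) - z)) ` K)"
  have "finite D"
    unfolding D_def K_def using finite_subset[OF _ finite_eigenindices[of "cmod z + 1"]] by auto
  moreover have "d > 0" if "d \<in> D" for d
    using that by (auto simp: D_def K_def)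
  ultimately have pos: "Min D > 0"
    by (subst Min_gr_iff) (auto simp: D_def)
  have "Min D \<le> cmod (of_real (lam k) - z)" if "complex_of_real (lam k) \<noteq> z" for k
  proof (cases "lam k \<le> cmod z + 1")
    case True
    then show ?thesis
      using that \<open>finite D\<close> by (intro Min_le) (auto simp: D_def K_def)
  next
    case False
    have "Min D \<le> 1" using \<open>finite D\<close> by (intro Min_le) (auto simp: D_def)
    also have "1 \<le> cmod (of_real (lam k) - z)"
      using norm_triangle_ineq2[of "complex_of_real (lam k)" z] False lam_nonneg[of k] by simp
    finally show ?thesis .
  qed
  then show ?thesis using pos by blast
qed

lemma resolvent:
  assumes z: "\<And>k. complex_of_real (lam k) \<noteq> z"
  shows "\<forall>f\<in>H. \<exists>(u, g)\<in>form_graph. nrm (g - z *\<^sub>C u - f) = 0"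
    and "\<exists>C. \<forall>(u, g)\<in>form_graph. nrm u \<le> C * nrm (g - z *\<^sub>C u)"
proof -
  obtain \<delta> where \<delta>: "\<delta> > 0" "\<And>k. \<delta> \<le> cmod (of_real (lam k) - z)"
    using discrete_eigenvalues[of z] z by blast
  have "\<exists>(u, g)\<in>form_graph. nrm (g - z *\<^sub>C u - f) = 0" if f: "f \<in> H" for f
  proof -
    define c where "c k = ip f (e k) / (of_real (lam k) - z)" for k
    have "summable (\<lambda>k. (cmod (c k))\<^sup>2)"
    proof (rule summable_comparison_test')
      show "summable (\<lambda>k. (cmod (ip f (e k)))\<^sup>2 * (1 / \<delta>\<^sup>2))"
        using Bessel_summable[OF orthonormal_e f]
        by (intro summable_mult2) (simp add: summable_on_UNIV_nonneg_real_iff)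
      fix k
      have "\<delta>\<^sup>2 \<le> (cmod (of_real (lam k) - z))\<^sup>2"
        using \<delta> by (intro power_mono) auto
      then have "(cmod (ip f (e k)))\<^sup>2 / (cmod (of_real (lam k) - z))\<^sup>2 \<le> (cmod (ip f (e k)))\<^sup>2 / \<delta>\<^sup>2"
        using \<delta>(1) by (intro divide_left_mono) (auto intro!: mult_pos_pos simp: z)
      then show "norm ((cmod (c k))\<^sup>2) \<le> (cmod (ip f (e k)))\<^sup>2 * (1 / \<delta>\<^sup>2)"
        by (simp add: c_def norm_divide power_divide)
    qed
    then have "(\<lambda>k. (cmod (c k))\<^sup>2) summable_on UNIV"
      by (simp add: summable_on_UNIV_nonneg_real_iff)
    from Riesz_Fischer[OF orthonormal_e this]
    obtain u where u: "u \<in> H" and uk: "\<And>k. ip u (e k) = c k" by blast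
    define g where "g = f + z *\<^sub>C u"
    have g: "g \<in> H" using f u by (simp add: g_def)
    have "ip g (e k) = of_real (lam k) * ip u (e k)" for k
      using f u z[of k] by (simp add: g_def ip_add_left ip_scale_left uk c_def field_simps)
    then have "(u, g) \<in> form_graph" using u g by (simp add: form_graph_iff)
    moreover have "nrm (g - z *\<^sub>C u - f) = 0" by (simp add: g_def)
    ultimately show ?thesis by auto
  qed
  then show "\<forall>f\<in>H. \<exists>(u, g)\<in>form_graph. nrm (g - z *\<^sub>C u - f) = 0" by blast
  have "nrm u \<le> (1 / \<delta>) * nrm (g - z *\<^sub>C u)" if "(u, g) \<in> form_graph" for u g
  proof -
    from that have u: "u \<in> H" and g: "g \<in> H"
      and gk: "\<And>k. ip g (e k) = of_real (lam k) * ip u (e k)"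
      by (auto simp: form_graph_iff)
    have w: "g - z *\<^sub>C u \<in> H" using u g by simp
    have "\<delta>\<^sup>2 * (nrm u)\<^sup>2 \<le> (nrm (g - z *\<^sub>C u))\<^sup>2"
    proof (rule has_sum_mono)
      show "((\<lambda>k. \<delta>\<^sup>2 * (cmod (ip u (e k)))\<^sup>2) has_sum \<delta>\<^sup>2 * (nrm u)\<^sup>2) UNIV"
        by (intro has_sum_cmult_right Parseval_nrm[OF orthonormal_e total_e u])
      show "((\<lambda>k. (cmod (ip (g - z *\<^sub>C u) (e k)))\<^sup>2) has_sum (nrm (g - z *\<^sub>C u))\<^sup>2) UNIV"
        by (rule Parseval_nrm[OF orthonormal_e total_e w])
      fix k
      have "ip (g - z *\<^sub>C u) (e k) = (of_real (lam k) - z) * ip u (e k)"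
        using u g by (simp add: ip_diff_left ip_scale_left gk algebra_simps)
      then show "\<delta>\<^sup>2 * (cmod (ip u (e k)))\<^sup>2 \<le> (cmod (ip (g - z *\<^sub>C u) (e k)))\<^sup>2"
        using \<delta> by (auto simp: norm_mult power_mult_distrib intro!: mult_right_mono power_mono)
    qed
    then have "(\<delta> * nrm u)\<^sup>2 \<le> (nrm (g - z *\<^sub>C u))\<^sup>2" by (simp add: power_mult_distrib)
    then have "\<delta> * nrm u \<le> nrm (g - z *\<^sub>C u)"
      by (rule power2_le_imp_le) (use w in simp)
    then show ?thesis using \<delta>(1) by (simp add: field_simps)
  qed
  then show "\<exists>C. \<forall>(u, g)\<in>form_graph. nrm u \<le> C * nrm (g - z *\<^sub>C u)" by blast
qed

lemma eigenspace_expansion: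
  assumes "(u, z *\<^sub>C u) \<in> form_graph"
  shows "finite {k. complex_of_real (lam k) = z}"
    and "nrm (u - (\<Sum>k | complex_of_real (lam k) = z. ip u (e k) *\<^sub>C e k)) = 0"
proof -
  show fin: "finite {k. complex_of_real (lam k) = z}"
    by (rule finite_subset[OF _ finite_eigenindices[of "Re z"]]) auto
  from assms have u: "u \<in> H" and uk: "\<And>k. ip (z *\<^sub>C u) (e k) = of_real (lam k) * ip u (e k)"
    by (auto simp: form_graph_iff)
  have "ip u (e k) = 0" if "complex_of_real (lam k) \<noteq> z" for k
    using uk[of k] u that by (auto simp: ip_scale_left)
  then show "nrm (u - (\<Sum>k | complex_of_real (lam k) = z. ip u (e k) *\<^sub>C e k)) = 0"
    using u fin ip_sum_orthonormal[OF orthonormal_e fin]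
    by (intro ip_eqI) auto
qed

end

section \<open>Square-integrable functions on the torus\<close>

lemma norm_diff_sq_le: "(norm (x - z))\<^sup>2 \<le> 2 * (norm (x - y))\<^sup>2 + 2 * (norm (y - z))\<^sup>2"
  for x y z :: "'a::real_normed_vector"
proof -
  have "(norm (x - z))\<^sup>2 \<le> (norm (x - y) + norm (y - z))\<^sup>2"
    using norm_triangle_ineq[of "x - y" "y - z"] by (intro power_mono) auto
  also have "\<dots> \<le> 2 * (norm (x - y))\<^sup>2 + 2 * (norm (y - z))\<^sup>2"
    using sum_squares_bound[of "norm (x - y)" "norm (y - z)"] by (simp add: power2_sum)
  finally show ?thesis .
qed

text \<open>Completeness of \<open>L2\<close>, in a form that exhibits the limit as the pointwise \<open>lim\<close> of a subsequence: the limit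
  then inherits periodicity from the sequence at every point. Almost everywhere convergence of the rapidly
  convergent subsequence follows from \<open>d \<le> 2\<^sup>-\<^sup>k + 2\<^sup>kd\<^sup>2\<close>, which trades the increments for their squares.\<close>
lemma square_mean_limit:
  fixes u :: "nat \<Rightarrow> 'a \<Rightarrow> 'b::{banach, second_countable_topology}"
  assumes meas: "\<And>n. u n \<in> borel_measurable M"
    and int: "\<And>m n. integrable M (\<lambda>x. (norm (u m x - u n x))\<^sup>2)"
    and cau: "\<And>\<epsilon>. \<epsilon> > 0 \<Longrightarrow> \<exists>N. \<forall>m\<ge>N. \<forall>n\<ge>N. (LINT x|M. (norm (u m x - u n x))\<^sup>2) < \<epsilon>"
  obtains r :: "nat \<Rightarrow> nat" where
    "\<And>n. integrable M (\<lambda>x. (norm (u n x - lim (\<lambda>k. u (r k) x)))\<^sup>2)"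
    "(\<lambda>n. LINT x|M. (norm (u n x - lim (\<lambda>k. u (r k) x)))\<^sup>2) \<longlonglongrightarrow> 0"
proof -
  note [measurable] = meas
  have "\<exists>N. \<forall>m\<ge>N. \<forall>n\<ge>N. (LINT x|M. (norm (u m x - u n x))\<^sup>2) < (1/8)^k" for k :: nat
    by (rule cau) simp
  then obtain N where N: "\<And>k m n. m \<ge> N k \<Longrightarrow> n \<ge> N k \<Longrightarrow> (LINT x|M. (norm (u m x - u n x))\<^sup>2) < (1/8)^k"
    by metis
  \<comment> \<open>An increasing sequence with \<open>r k \<ge> N k\<close>.\<close>
  define r where "r k = (\<Sum>j\<le>k. N j) + k" for k
  have rN: "r k \<ge> N k" for k
    using member_le_sum[of k "{..k}" N] by (simp add: r_def)
  have rk: "r k \<ge> k" for k by (simp add: r_def)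
  have rSuc: "r (Suc k) \<ge> r k" for k by (simp add: r_def)
  define d where "d k x = norm (u (r (Suc k)) x - u (r k) x)" for k x
  have [measurable]: "d k \<in> borel_measurable M" for k
    unfolding d_def by measurable
  have nnd: "(\<integral>\<^sup>+x. ennreal (2^k * (d k x)\<^sup>2) \<partial>M) \<le> ennreal ((1/2)^k)" for k
  proof -
    have "(\<integral>\<^sup>+x. ennreal (2^k * (d k x)\<^sup>2) \<partial>M) = ennreal (LINT x|M. 2^k * (d k x)\<^sup>2)"
      unfolding d_def by (intro nn_integral_eq_integral integrable_mult_right int) auto
    also have "(LINT x|M. 2^k * (d k x)\<^sup>2) \<le> 2^k * (1/8)^k"
      using N[of k "r (Suc k)" "r k"] rN[of k] rSuc[of k] by (simp add: d_def)
    also have "2^k * (1/8::real)^k \<le> (1/2)^k"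
      by (simp add: power_mono flip: power_mult_distrib)
    finally show ?thesis by (simp add: ennreal_leI)
  qed
  have "(\<integral>\<^sup>+x. (\<Sum>k. ennreal (2^k * (d k x)\<^sup>2)) \<partial>M) = (\<Sum>k. \<integral>\<^sup>+x. ennreal (2^k * (d k x)\<^sup>2) \<partial>M)"
    by (rule nn_integral_suminf) measurable
  also have "\<dots> \<le> (\<Sum>k. ennreal ((1/2)^k))"
    by (intro suminf_le nnd) auto
  also have "\<dots> < \<infinity>"
    by (subst suminf_ennreal_eq[where x = 2]) (use power_half_series sums_mult[OF geometric_sums[of "1/2::real"], of 1] in auto)
  finally have "(\<integral>\<^sup>+x. (\<Sum>k. ennreal (2^k * (d k x)\<^sup>2)) \<partial>M) \<noteq> \<infinity>" by simp
  then have "AE x in M. (\<Sum>k. ennreal (2^k * (d k x)\<^sup>2)) \<noteq> \<infinity>"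
    by (intro nn_integral_PInf_AE) auto
  then have lim: "AE x in M. (\<lambda>k. u (r k) x) \<longlonglongrightarrow> lim (\<lambda>k. u (r k) x)"
  proof eventually_elim
    case (elim x)
    have "summable (\<lambda>k. 2^k * (d k x)\<^sup>2)"
      using elim by (intro summable_suminf_not_top) auto
    then have "summable (\<lambda>k. (1/2)^k + 2^k * (d k x)\<^sup>2)"
      by (intro summable_add summable_geometric) auto
    then have "summable (\<lambda>k. d k x)"
    proof (rule summable_comparison_test'[where N = 0])
      fix k
      have "d k x \<le> (1/2)^k + 2^k * (d k x)\<^sup>2"
      proof (cases "d k x \<le> (1/2)^k")
        case False
        then have "(1/2)^k * d k x \<le> d k x * d k x"
          by (intro mult_right_mono) (auto simp: d_def)
        then have "2^k * ((1/2)^k * d k x) \<le> 2^k * (d k x * d k x)"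
          by (intro mult_left_mono) auto
        moreover have "2^k * ((1/2)^k * d k x) = d k x"
          by (simp add: power_one_over)
        ultimately have "d k x \<le> 2^k * (d k x)\<^sup>2"
          by (simp add: power2_eq_square)
        then show ?thesis by (simp add: add_increasing)
      qed (simp add: add_increasing2)
      then show "norm (d k x) \<le> (1/2)^k + 2^k * (d k x)\<^sup>2"
        by (simp add: d_def)
    qed
    then have "summable (\<lambda>k. u (r (Suc k)) x - u (r k) x)"
      unfolding d_def by (rule summable_norm_cancel)
    then have "convergent (\<lambda>n. \<Sum>k<n. u (r (Suc k)) x - u (r k) x)"
      by (simp add: summable_iff_convergent)
    then have "convergent (\<lambda>n. u (r n) x - u (r 0) x)"
      by (simp only: sum_lessThan_telescope[of "\<lambda>k. u (r k) x"])
    then have "convergent (\<lambda>n. (u (r n) x - u (r 0) x) + u (r 0) x)"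
      by (intro convergent_add convergent_const)
    then show ?case by (simp add: convergent_LIMSEQ_iff)
  qed
  define w where "w x = lim (\<lambda>k. u (r k) x)" for x
  have [measurable]: "w \<in> borel_measurable M"
    unfolding w_def by measurable
  have fatou: "(\<integral>\<^sup>+x. ennreal ((norm (u n x - w x))\<^sup>2) \<partial>M) \<le> ennreal ((1/8)^k)" if n: "n \<ge> N k" for n k
  proof -
    have "(\<integral>\<^sup>+x. ennreal ((norm (u n x - w x))\<^sup>2) \<partial>M)
        = (\<integral>\<^sup>+x. liminf (\<lambda>j. ennreal ((norm (u n x - u (r j) x))\<^sup>2)) \<partial>M)"
    proof (rule nn_integral_cong_AE)
      show "AE x in M. ennreal ((norm (u n x - w x))\<^sup>2)
          = liminf (\<lambda>j. ennreal ((norm (u n x - u (r j) x))\<^sup>2))"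
        using lim
      proof eventually_elim
        case (elim x)
        then have "(\<lambda>j. ennreal ((norm (u n x - u (r j) x))\<^sup>2)) \<longlonglongrightarrow> ennreal ((norm (u n x - w x))\<^sup>2)"
          unfolding w_def by (intro tendsto_ennrealI tendsto_intros)
        then show ?case
          by (rule lim_imp_Liminf[OF sequentially_bot, symmetric])
      qed
    qed
    also have "\<dots> \<le> liminf (\<lambda>j. \<integral>\<^sup>+x. ennreal ((norm (u n x - u (r j) x))\<^sup>2) \<partial>M)"
      by (rule nn_integral_liminf) measurable
    also have "\<dots> \<le> ennreal ((1/8)^k)"
    proof (rule order_trans[OF Liminf_mono Liminf_le])
      show "\<forall>\<^sub>F j in sequentially.
          (\<integral>\<^sup>+x. ennreal ((norm (u n x - u (r j) x))\<^sup>2) \<partial>M) \<le> ennreal ((1/8)^k)"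
      proof (rule eventually_sequentiallyI)
        fix j assume "j \<ge> N k"
        then have "r j \<ge> N k" using rk[of j] by simp
        have "(\<integral>\<^sup>+x. ennreal ((norm (u n x - u (r j) x))\<^sup>2) \<partial>M)
            = ennreal (LINT x|M. (norm (u n x - u (r j) x))\<^sup>2)"
          by (intro nn_integral_eq_integral int) auto
        also have "\<dots> \<le> ennreal ((1/8)^k)"
          using N[OF n \<open>r j \<ge> N k\<close>] by (intro ennreal_leI) simp
        finally show "(\<integral>\<^sup>+x. ennreal ((norm (u n x - u (r j) x))\<^sup>2) \<partial>M) \<le> ennreal ((1/8)^k)" .
      qed
    qed auto
    finally show ?thesis .
  qed
  have intw0: "integrable M (\<lambda>x. (norm (u (N 0) x - w x))\<^sup>2)"
    by (rule integrableI_bounded)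
       (auto intro: le_less_trans[OF fatou[OF order_refl, of 0]])
  have intw: "integrable M (\<lambda>x. (norm (u n x - w x))\<^sup>2)" for n
  proof (rule Bochner_Integration.integrable_bound)
    show "integrable M (\<lambda>x. 2 * (norm (u n x - u (N 0) x))\<^sup>2 + 2 * (norm (u (N 0) x - w x))\<^sup>2)"
      by (intro Bochner_Integration.integrable_add integrable_mult_right int intw0)
    show "AE x in M. norm ((norm (u n x - w x))\<^sup>2)
        \<le> norm (2 * (norm (u n x - u (N 0) x))\<^sup>2 + 2 * (norm (u (N 0) x - w x))\<^sup>2)"
      using norm_diff_sq_le by (intro AE_I2) auto
  qed measurable
  have "(\<lambda>n. LINT x|M. (norm (u n x - w x))\<^sup>2) \<longlonglongrightarrow> 0"
  proof (rule LIMSEQ_I)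
    fix \<epsilon> :: real assume "\<epsilon> > 0"
    then obtain k where k: "(1/8)^k < \<epsilon>"
      using real_arch_pow_inv[of \<epsilon> "1/8"] by auto
    show "\<exists>N. \<forall>n\<ge>N. norm ((LINT x|M. (norm (u n x - w x))\<^sup>2) - 0) < \<epsilon>"
    proof (intro exI allI impI)
      fix n assume "N k \<le> n"
      have "ennreal (LINT x|M. (norm (u n x - w x))\<^sup>2) = (\<integral>\<^sup>+x. ennreal ((norm (u n x - w x))\<^sup>2) \<partial>M)"
        by (intro nn_integral_eq_integral[symmetric] intw) auto
      also have "\<dots> \<le> ennreal ((1/8)^k)" by (rule fatou[OF \<open>N k \<le> n\<close>])
      finally have "(LINT x|M. (norm (u n x - w x))\<^sup>2) \<le> (1/8)^k" by simp
      then show "norm ((LINT x|M. (norm (u n x - w x))\<^sup>2) - 0) < \<epsilon>"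
        using k by simp
    qed
  qed
  then show thesis
    using intw by (intro that[of r]) (auto simp: w_def)
qed

definition vscale :: "complex \<Rightarrow> (real^2 \<Rightarrow> complex^3) \<Rightarrow> real^2 \<Rightarrow> complex^3" where
  "vscale c u = (\<lambda>x. c *s u x)"

lemma vscale_apply [simp]: "vscale c u x = c *s u x"
  by (simp add: vscale_def)

lemma sum_fun_apply [simp]: "(\<Sum>i\<in>I. f i) x = (\<Sum>i\<in>I. f i x)"
  for f :: "'i \<Rightarrow> 'a \<Rightarrow> 'b::ab_group_add"
  by (induction I rule: infinite_finite_induct) auto

lemma norm_vec_sq: "(norm v)\<^sup>2 = (\<Sum>i\<in>UNIV. (cmod (v $ i))\<^sup>2)" for v :: "complex^'n"
  by (simp add: norm_vec_def L2_set_def sum_nonneg)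

lemma norm_vector_scalar: "norm (c *s v) = cmod c * norm v" for v :: "complex^'n"
proof -
  have "(norm (c *s v))\<^sup>2 = (cmod c * norm v)\<^sup>2"
    unfolding norm_vec_sq power_mult_distrib by (simp add: norm_mult power_mult_distrib sum_distrib_left)
  then show ?thesis by (simp add: power2_eq_iff_nonneg)
qed

lemma bounded_bilinear_vector_scalar: "bounded_bilinear (\<lambda>c (v::complex^'n). c *s v)"
proof
  show "\<exists>K. \<forall>c (v::complex^'n). norm (c *s v) \<le> norm c * norm v * K"
    by (rule exI[of _ 1]) (simp add: norm_vector_scalar)
qed (simp_all add: vec_eq_iff algebra_simps)

lemma measurable_vector_scalar [measurable (raw)]:
  fixes c :: "'a \<Rightarrow> complex" and v :: "'a \<Rightarrow> complex^'n"
  assumes "c \<in> borel_measurable M" "v \<in> borel_measurable M"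
  shows "(\<lambda>x. c x *s v x) \<in> borel_measurable M"
  using assms by (rule borel_measurable_continuous_Pair)
    (intro bounded_bilinear.continuous_on[OF bounded_bilinear_vector_scalar] continuous_intros)

lemma measurable_vec_component [measurable (raw)]:
  fixes v :: "'a \<Rightarrow> complex^'n"
  assumes "v \<in> borel_measurable M"
  shows "(\<lambda>x. v x $ i) \<in> borel_measurable M"
  using assms by (rule borel_measurable_continuous_on[rotated]) (intro continuous_intros)

definition herm :: "complex^3 \<Rightarrow> complex^3 \<Rightarrow> complex" where
  "herm u v = (\<Sum>i\<in>UNIV. u $ i * cnj (v $ i))"

lemma herm_add_left: "herm (u + v) w = herm u w + herm v w"
  and herm_scale_left: "herm (c *s u) w = c * herm u w"
  and herm_commute: "herm v u = cnj (herm u v)"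
  and herm_scale_right: "herm u (c *s w) = cnj c * herm u w"
  by (simp_all add: herm_def sum.distrib sum_distrib_left algebra_simps)

lemma herm_self: "herm u u = of_real ((norm u)\<^sup>2)"
  unfolding herm_def norm_vec_sq of_real_sum by (simp only: complex_norm_square)

lemma norm_herm_le: "cmod (herm u v) \<le> (norm u)\<^sup>2 + (norm v)\<^sup>2"
proof -
  have "cmod (herm u v) \<le> (\<Sum>i\<in>UNIV. cmod (u $ i) * cmod (v $ i))"
    unfolding herm_def by (rule order_trans[OF norm_sum]) (simp add: norm_mult)
  also have "\<dots> \<le> (\<Sum>i\<in>UNIV. (cmod (u $ i))\<^sup>2 + (cmod (v $ i))\<^sup>2)"
  proof (rule sum_mono)
    fix i
    show "cmod (u $ i) * cmod (v $ i) \<le> (cmod (u $ i))\<^sup>2 + (cmod (v $ i))\<^sup>2"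
      using sum_squares_bound[of "cmod (u $ i)" "cmod (v $ i)"]
        mult_nonneg_nonneg[OF norm_ge_zero norm_ge_zero, of "u $ i" "v $ i"] by linarith
  qed
  finally show ?thesis by (simp add: norm_vec_sq sum.distrib)
qed

lemma measurable_cnj [measurable (raw)]: "f \<in> borel_measurable M \<Longrightarrow> (\<lambda>x. cnj (f x)) \<in> borel_measurable M"
  by (rule borel_measurable_continuous_on[of cnj]) (intro continuous_intros)

lemma measurable_herm [measurable (raw)]:
  "u \<in> borel_measurable M \<Longrightarrow> v \<in> borel_measurable M \<Longrightarrow> (\<lambda>x. herm (u x) (v x)) \<in> borel_measurable M"
  unfolding herm_def
  by (intro borel_measurable_sum borel_measurable_times measurable_cnj measurable_vec_component)

locale torus =
  fixes a1 a2 :: "real^2"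
  assumes neq: "a1 \<noteq> a2" and indep: "independent {a1, a2}"
begin

definition det2 :: real where "det2 = a1 $ 1 * a2 $ 2 - a1 $ 2 * a2 $ 1"

lemma lin_indep: "c *\<^sub>R a1 + d *\<^sub>R a2 = 0 \<Longrightarrow> c = 0 \<and> d = 0"
proof -
  assume cd: "c *\<^sub>R a1 + d *\<^sub>R a2 = 0"
  have s: "(\<Sum>v\<in>{a1, a2}. (if v = a1 then c else d) *\<^sub>R v) = 0"
    using cd neq by simp
  have "(if v = a1 then c else d) = 0" if "v \<in> {a1, a2}" for v
    using independentD[OF indep _ order_refl s that] by simp
  from this[of a1] this[of a2] show ?thesis using neq by auto
qed

lemma det2_nonzero: "det2 \<noteq> 0"
proof
  assume d: "det2 = 0"
  have "a2 $ 2 *\<^sub>R a1 + (- (a1 $ 2)) *\<^sub>R a2 = 0" "a2 $ 1 *\<^sub>R a1 + (- (a1 $ 1)) *\<^sub>R a2 = 0"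
    using d by (auto simp: vec_eq_iff forall_2 det2_def algebra_simps)
  from lin_indep[OF this(1)] lin_indep[OF this(2)] have "a1 = 0"
    by (auto simp: vec_eq_iff forall_2)
  then show False using lin_indep[of 1 0] by simp
qed

text \<open>The dual basis: \<open>b\<^sub>i \<bullet> a\<^sub>j = 2\<pi>\<delta>\<^sub>i\<^sub>j\<close>.\<close>

definition b1 :: "real^2" where "b1 = (2 * pi / det2) *\<^sub>R vector [a2 $ 2, - (a2 $ 1)]"
definition b2 :: "real^2" where "b2 = (2 * pi / det2) *\<^sub>R vector [- (a1 $ 2), a1 $ 1]"

lemma dual_basis [simp]:
  "a1 \<bullet> b1 = 2 * pi" "a2 \<bullet> b1 = 0" "a1 \<bullet> b2 = 0" "a2 \<bullet> b2 = 2 * pi"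
proof -
  have d: "a1 $ 1 * a2 $ 2 - a1 $ 2 * a2 $ 1 \<noteq> 0"
    using det2_nonzero by (simp add: det2_def)
  show "a2 \<bullet> b1 = 0" "a1 \<bullet> b2 = 0"
    by (simp_all add: b1_def b2_def inner_vec_def sum_2)
  have "a1 \<bullet> b1 = 2 * pi / det2 * det2" "a2 \<bullet> b2 = 2 * pi / det2 * det2"
    using d by (simp_all add: b1_def b2_def inner_vec_def sum_2 det2_def divide_simps) (simp_all add: algebra_simps)
  then show "a1 \<bullet> b1 = 2 * pi" "a2 \<bullet> b2 = 2 * pi"
    using det2_nonzero by simp_all
qed

lemma coords: "x = (x \<bullet> b1 / (2 * pi)) *\<^sub>R a1 + (x \<bullet> b2 / (2 * pi)) *\<^sub>R a2"
proof -
  have c: "x \<bullet> b1 / (2 * pi) = (x $ 1 * a2 $ 2 - x $ 2 * a2 $ 1) / det2"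
    "x \<bullet> b2 / (2 * pi) = (x $ 2 * a1 $ 1 - x $ 1 * a1 $ 2) / det2"
    using det2_nonzero by (simp_all add: b1_def b2_def inner_vec_def sum_2 divide_simps)
      (simp_all add: algebra_simps)
  have "det2 * x $ 1 = (x $ 1 * a2 $ 2 - x $ 2 * a2 $ 1) * a1 $ 1 + (x $ 2 * a1 $ 1 - x $ 1 * a1 $ 2) * a2 $ 1"
    "det2 * x $ 2 = (x $ 1 * a2 $ 2 - x $ 2 * a2 $ 1) * a1 $ 2 + (x $ 2 * a1 $ 1 - x $ 1 * a1 $ 2) * a2 $ 2"
    by (simp_all add: det2_def algebra_simps)
  then have "x $ 1 = ((x $ 1 * a2 $ 2 - x $ 2 * a2 $ 1) * a1 $ 1 + (x $ 2 * a1 $ 1 - x $ 1 * a1 $ 2) * a2 $ 1) / det2"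
    "x $ 2 = ((x $ 1 * a2 $ 2 - x $ 2 * a2 $ 1) * a1 $ 2 + (x $ 2 * a1 $ 1 - x $ 1 * a1 $ 2) * a2 $ 2) / det2"
    using det2_nonzero by (metis nonzero_mult_div_cancel_left)+
  then show ?thesis
    unfolding c by (simp add: vec_eq_iff forall_2 add_divide_distrib)
qed

text \<open>The half-open period parallelogram, described in dual coordinates.\<close>
definition P :: "(real^2) set" where
  "P = {x. 0 \<le> x \<bullet> b1 \<and> x \<bullet> b1 < 2 * pi \<and> 0 \<le> x \<bullet> b2 \<and> x \<bullet> b2 < 2 * pi}"

lemma P_eq: "{s *\<^sub>R a1 + t *\<^sub>R a2 | s t. 0 \<le> s \<and> s < 1 \<and> 0 \<le> t \<and> t < 1} = P"
proof (intro set_eqI iffI)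
  fix x assume "x \<in> P"
  then show "x \<in> {s *\<^sub>R a1 + t *\<^sub>R a2 | s t. 0 \<le> s \<and> s < 1 \<and> 0 \<le> t \<and> t < 1}"
    using coords[of x]
    by (intro CollectI exI[of _ "x \<bullet> b1 / (2 * pi)"] exI[of _ "x \<bullet> b2 / (2 * pi)"])
       (auto simp: P_def)
qed (auto simp: P_def inner_add_left)

definition M :: "(real^2) measure" where "M = lebesgue_on P"

lemma torus_measure_eq: "torus_measure a1 a2 = M"
  by (simp add: torus_measure_def P_eq M_def)

lemma P_borel [measurable]: "P \<in> sets borel"
  unfolding P_def by measurable

lemma P_lebesgue [measurable]: "P \<in> sets lebesgue"
  by (simp add: sets_completionI_sets)

lemma space_M [simp]: "space M = P"
  by (simp add: M_def)

lemma measurable_M: "f \<in> borel_measurable lebesgue \<Longrightarrow> f \<in> borel_measurable M"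
  unfolding M_def by (rule measurable_restrict_space1)

lemma AE_M: "(AE x in M. Q x) \<longleftrightarrow> (AE x in lebesgue. x \<in> P \<longrightarrow> Q x)"
  unfolding M_def by (rule AE_restrict_space_iff) simp

lemma bounded_P: "bounded P"
proof (rule boundedI)
  fix x assume x: "x \<in> P"
  have "norm x \<le> \<bar>x \<bullet> b1 / (2 * pi)\<bar> * norm a1 + \<bar>x \<bullet> b2 / (2 * pi)\<bar> * norm a2"
    using norm_triangle_ineq[of "(x \<bullet> b1 / (2 * pi)) *\<^sub>R a1" "(x \<bullet> b2 / (2 * pi)) *\<^sub>R a2"] coords[of x]
    by simp
  also have "\<dots> \<le> 1 * norm a1 + 1 * norm a2"
    using x by (intro add_mono mult_right_mono) (auto simp: P_def)
  finally show "norm x \<le> norm a1 + norm a2" by simp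
qed

lemma emeasure_M_finite: "emeasure M P < \<infinity>"
  using emeasure_bounded_finite[OF bounded_P] by (simp add: M_def emeasure_restrict_space)

sublocale finite_measure M
  by standard (use emeasure_M_finite in auto)

lemma emeasure_M_pos: "emeasure M P > 0"
proof -
  define U where "U = {x::real^2. 0 < x \<bullet> b1 \<and> x \<bullet> b1 < 2 * pi \<and> 0 < x \<bullet> b2 \<and> x \<bullet> b2 < 2 * pi}"
  have "open U"
    unfolding U_def
    by (intro open_Collect_conj open_Collect_less continuous_intros)
  moreover have "(1/2) *\<^sub>R a1 + (1/2) *\<^sub>R a2 \<in> U"
    by (simp add: U_def inner_add_left)
  ultimately have "\<not> negligible U"
    using open_not_negligible by blast
  moreover have "U \<subseteq> P" by (auto simp: U_def P_def)
  ultimately have "\<not> negligible P" using negligible_subset by blast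
  then have "emeasure lebesgue P \<noteq> 0"
    by (simp add: negligible_iff_emeasure0)
  then show ?thesis
    by (simp add: M_def emeasure_restrict_space zero_less_iff_neq_zero)
qed

definition A :: real where "A = measure M P"

lemma A_pos: "A > 0"
  using emeasure_M_pos emeasure_eq_measure[of P] by (simp add: A_def ennreal_less_zero_iff)

lemma L2_alt: "v \<in> L2 a1 a2 \<longleftrightarrow> v \<in> borel_measurable lebesgue \<and> periodic a1 a2 v \<and>
    integrable M (\<lambda>x. (norm (v x))\<^sup>2)"
  by (simp add: L2_def torus_measure_eq)

lemma L2_inner_herm: "L2_inner a1 a2 u v = (LINT x|M. herm (u x) (v x))"
  by (simp add: L2_inner_def herm_def torus_measure_eq)

lemma L2_measurable [simp, measurable_dest]: "v \<in> L2 a1 a2 \<Longrightarrow> v \<in> borel_measurable M"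
  by (simp add: L2_alt measurable_M)

lemma L2_integrable_sq: "v \<in> L2 a1 a2 \<Longrightarrow> integrable M (\<lambda>x. (norm (v x))\<^sup>2)"
  by (simp add: L2_alt)

lemma integrable_herm:
  assumes u: "u \<in> L2 a1 a2" and v: "v \<in> L2 a1 a2"
  shows "integrable M (\<lambda>x. herm (u x) (v x))"
proof (rule Bochner_Integration.integrable_bound)
  show "integrable M (\<lambda>x. (norm (u x))\<^sup>2 + (norm (v x))\<^sup>2)"
    using u v by (intro Bochner_Integration.integrable_add L2_integrable_sq)
  show "(\<lambda>x. herm (u x) (v x)) \<in> borel_measurable M"
    using L2_measurable[OF u] L2_measurable[OF v] by measurable
qed (use norm_herm_le in auto)

lemma L2_add: "u \<in> L2 a1 a2 \<Longrightarrow> v \<in> L2 a1 a2 \<Longrightarrow> u + v \<in> L2 a1 a2"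
  unfolding L2_alt
proof (elim conjE, intro conjI)
  assume [measurable]: "u \<in> borel_measurable lebesgue" "v \<in> borel_measurable lebesgue"
    and int: "integrable M (\<lambda>x. (norm (u x))\<^sup>2)" "integrable M (\<lambda>x. (norm (v x))\<^sup>2)"
  show "u + v \<in> borel_measurable lebesgue"
    unfolding plus_fun_def by measurable
  note [measurable] = measurable_M[of u] measurable_M[of v]
  show "integrable M (\<lambda>x. (norm ((u + v) x))\<^sup>2)"
  proof (rule Bochner_Integration.integrable_bound)
    show "integrable M (\<lambda>x. 2 * (norm (u x))\<^sup>2 + 2 * (norm (v x))\<^sup>2)"
      using int by (intro Bochner_Integration.integrable_add integrable_mult_right)
    show "AE x in M. norm ((norm ((u + v) x))\<^sup>2) \<le> norm (2 * (norm (u x))\<^sup>2 + 2 * (norm (v x))\<^sup>2)"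
      using norm_diff_sq_le[of "u _" "- v _" 0] by (intro AE_I2) simp
  qed simp
qed (auto simp: periodic_def)

lemma L2_scale: "u \<in> L2 a1 a2 \<Longrightarrow> vscale c u \<in> L2 a1 a2"
  unfolding L2_alt
proof (elim conjE, intro conjI)
  assume [measurable]: "u \<in> borel_measurable lebesgue"
  show "vscale c u \<in> borel_measurable lebesgue"
    unfolding vscale_def by measurable
qed (auto simp: periodic_def norm_vector_scalar power_mult_distrib)

lemma L2_zero: "0 \<in> L2 a1 a2"
  by (simp add: L2_alt periodic_def zero_fun_def)

end

interpretation VS: vector_space vscale
  by unfold_locales (auto simp: fun_eq_iff vec_eq_iff algebra_simps)

context torus
begin

sublocale L2: semi_inner_space vscale "L2 a1 a2" "L2_inner a1 a2"
proof unfold_locales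
  show "VS.subspace (L2 a1 a2)"
    by (simp add: VS.subspace_def L2_add L2_scale L2_zero)
next
  fix u v w assume "u \<in> L2 a1 a2" "v \<in> L2 a1 a2" "w \<in> L2 a1 a2"
  then show "L2_inner a1 a2 (u + v) w = L2_inner a1 a2 u w + L2_inner a1 a2 v w"
    by (simp add: L2_inner_herm herm_add_left integrable_herm)
next
  fix u w c assume "u \<in> L2 a1 a2" "w \<in> L2 a1 a2"
  then show "L2_inner a1 a2 (vscale c u) w = c * L2_inner a1 a2 u w"
    by (simp add: L2_inner_herm herm_scale_left)
next
  fix u v assume "u \<in> L2 a1 a2" "v \<in> L2 a1 a2"
  then show "L2_inner a1 a2 v u = cnj (L2_inner a1 a2 u v)"
    unfolding L2_inner_herm by (subst herm_commute) (simp add: complex_cnj_cancel_iff)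
next
  fix u assume "u \<in> L2 a1 a2"
  show "0 \<le> Re (L2_inner a1 a2 u u)"
    unfolding L2_inner_herm herm_self integral_complex_of_real by simp
qed

lemma L2_norm_eq: "L2_norm a1 a2 u = L2.nrm u"
  unfolding L2_norm_def L2.nrm_def L2_inner_herm herm_self torus_measure_eq integral_complex_of_real
  by simp

lemma L2_nrm_sq: "(L2.nrm u)\<^sup>2 = (LINT x|M. (norm (u x))\<^sup>2)"
  unfolding L2.nrm_def L2_inner_herm herm_self integral_complex_of_real by simp

lemma L2_nrm_zero_iff:
  assumes "u \<in> L2 a1 a2"
  shows "L2.nrm u = 0 \<longleftrightarrow> (AE x in M. u x = 0)"
proof -
  have "L2.nrm u = 0 \<longleftrightarrow> (LINT x|M. (norm (u x))\<^sup>2) = 0"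
    using L2_nrm_sq[of u] by (metis zero_eq_power2)
  also have "\<dots> \<longleftrightarrow> (AE x in M. (norm (u x))\<^sup>2 = 0)"
    by (rule integral_nonneg_eq_0_iff_AE) (use L2_integrable_sq assms in auto)
  finally show ?thesis by simp
qed

text \<open>The Riesz-Fischer completeness theorem for periodic square-integrable fields.\<close>
sublocale L2: semi_hilbert vscale "L2 a1 a2" "L2_inner a1 a2"
proof unfold_locales
  fix u assume u: "\<And>j::nat. u j \<in> L2 a1 a2" and cau: "L2.nrm_Cauchy u"
  have meas: "u j \<in> borel_measurable lebesgue" and per: "periodic a1 a2 (u j)" for j
    using u by (simp_all add: L2_alt)
  have diff: "(\<lambda>x. (norm ((u m - u n) x))\<^sup>2) = (\<lambda>x. (norm (u m x - u n x))\<^sup>2)" for m n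
    by simp
  obtain r :: "nat \<Rightarrow> nat" where
    int: "\<And>n. integrable M (\<lambda>x. (norm (u n x - lim (\<lambda>k. u (r k) x)))\<^sup>2)" and
    lim: "(\<lambda>n. LINT x|M. (norm (u n x - lim (\<lambda>k. u (r k) x)))\<^sup>2) \<longlonglongrightarrow> 0"
  proof (rule square_mean_limit[of u M])
    show "u n \<in> borel_measurable M" for n using u by simp
    show "integrable M (\<lambda>x. (norm (u m x - u n x))\<^sup>2)" for m n
      using L2_integrable_sq[OF L2.mem_diff[OF u u], of m n] by simp
    fix \<epsilon> :: real assume "\<epsilon> > 0"
    then obtain N where "\<And>m n. m \<ge> N \<Longrightarrow> n \<ge> N \<Longrightarrow> L2.nrm (u m - u n) < sqrt \<epsilon>"
      using cau unfolding L2.nrm_Cauchy_def by (meson real_sqrt_gt_zero)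
    then have "(L2.nrm (u m - u n))\<^sup>2 < (sqrt \<epsilon>)\<^sup>2" if "m \<ge> N" "n \<ge> N" for m n
      using that u by (intro power_strict_mono) auto
    then show "\<exists>N. \<forall>m\<ge>N. \<forall>n\<ge>N. (LINT x|M. (norm (u m x - u n x))\<^sup>2) < \<epsilon>"
      using \<open>\<epsilon> > 0\<close> unfolding L2_nrm_sq by auto
  qed blast
  define w where "w x = lim (\<lambda>k. u (r k) x)" for x
  have wm: "w \<in> borel_measurable lebesgue"
    unfolding w_def using meas by measurable
  have "periodic a1 a2 w"
    using per by (simp add: periodic_def w_def)
  moreover have "integrable M (\<lambda>x. (norm (w x))\<^sup>2)"
  proof (rule Bochner_Integration.integrable_bound)
    show "integrable M (\<lambda>x. 2 * (norm (u 0 x - w x))\<^sup>2 + 2 * (norm (u 0 x))\<^sup>2)"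
      using int[of 0] L2_integrable_sq[OF u[of 0]]
      by (intro Bochner_Integration.integrable_add integrable_mult_right) (auto simp: w_def)
    show "AE x in M. norm ((norm (w x))\<^sup>2) \<le> norm (2 * (norm (u 0 x - w x))\<^sup>2 + 2 * (norm (u 0 x))\<^sup>2)"
      using norm_diff_sq_le[of "w _" 0 "u 0 _"] by (intro AE_I2) (simp add: norm_minus_commute)
    show "(\<lambda>x. (norm (w x))\<^sup>2) \<in> borel_measurable M"
      using measurable_M[OF wm] by measurable
  qed
  ultimately have wL: "w \<in> L2 a1 a2" using wm by (simp add: L2_alt)
  have "(\<lambda>j. (L2.nrm (u j - w))\<^sup>2) \<longlonglongrightarrow> 0"
    using lim unfolding L2_nrm_sq by (simp add: w_def)
  then have "(\<lambda>j. sqrt ((L2.nrm (u j - w))\<^sup>2)) \<longlonglongrightarrow> sqrt 0"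
    by (rule tendsto_real_sqrt)
  then have "(\<lambda>j. L2.nrm (u j - w)) \<longlonglongrightarrow> 0"
    using u wL by simp
  then show "\<exists>u'\<in>L2 a1 a2. (\<lambda>j. L2.nrm (u j - u')) \<longlonglongrightarrow> 0"
    using wL by blast
qed

end

section \<open>Integrals of derivatives of periodic functions\<close>

lemma lborel_integral_shift:
  fixes f :: "'a::euclidean_space \<Rightarrow> 'b::{banach, second_countable_topology}"
  assumes "f \<in> borel_measurable borel"
  shows "(LINT x|lborel. f (x + c)) = (LINT x|lborel. f x)"
proof -
  have "(LINT x|lborel. f x) = (LINT x|distr lborel borel ((+) c). f x)"
    by (simp add: lborel_distr_plus)
  also have "\<dots> = (LINT x|lborel. f (c + x))"
    using assms by (intro integral_distr) auto
  finally show ?thesis by (simp add: add.commute)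
qed

lemma has_derivative_difference_quotient:
  fixes f :: "'a::real_normed_vector \<Rightarrow> 'b::real_normed_vector"
  assumes f: "(f has_derivative D) (at x)"
  shows "(\<lambda>k. real (Suc k) *\<^sub>R (f (x + (1 / real (Suc k)) *\<^sub>R a) - f x)) \<longlonglongrightarrow> D a"
proof (cases "a = 0")
  case True
  then show ?thesis using linear_0[OF has_derivative_linear[OF f]] by simp
next
  case False
  define h where "h k = (1 / real (Suc k)) *\<^sub>R a" for k
  have D: "bounded_linear D" and lim: "(\<lambda>h. norm (f (x + h) - f x - D h) / norm h) \<midarrow>0\<rightarrow> 0"
    using f by (simp_all add: has_derivative_at)
  have "h \<longlonglongrightarrow> 0 *\<^sub>R a"
    unfolding h_def by (intro tendsto_intros LIMSEQ_Suc[OF lim_1_over_n])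
  then have "filterlim h (at 0) sequentially"
    using False by (simp add: filterlim_at h_def)
  then have "(\<lambda>k. norm (f (x + h k) - f x - D (h k)) / norm (h k)) \<longlonglongrightarrow> 0"
    by (rule filterlim_compose[OF lim])
  then have "(\<lambda>k. norm (f (x + h k) - f x - D (h k)) / norm (h k) * norm a) \<longlonglongrightarrow> 0 * norm a"
    by (rule tendsto_mult_right)
  moreover have "norm (f (x + h k) - f x - D (h k)) / norm (h k) * norm a
      = norm (real (Suc k) *\<^sub>R (f (x + h k) - f x) - D a)" for k
  proof -
    have "D (h k) = (1 / real (Suc k)) *\<^sub>R D a"
      using D by (simp add: h_def bounded_linear.linear linear_scale)
    then have "real (Suc k) *\<^sub>R (f (x + h k) - f x) - D a = real (Suc k) *\<^sub>R (f (x + h k) - f x - D (h k))"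
      by (simp add: scaleR_diff_right)
    moreover have "norm (h k) = norm a / real (Suc k)"
      by (simp add: h_def)
    ultimately show ?thesis
      using False by (simp only: norm_scaleR) (simp del: of_nat_Suc)
  qed
  ultimately have "(\<lambda>k. norm (real (Suc k) *\<^sub>R (f (x + h k) - f x) - D a)) \<longlonglongrightarrow> 0" by simp
  then show ?thesis
    unfolding h_def by (simp add: tendsto_norm_zero_iff LIM_zero_iff)
qed

lemma norm_increment_le:
  fixes f :: "'a::real_normed_vector \<Rightarrow> 'b::real_normed_vector"
  assumes f: "\<And>y. (f has_derivative D y) (at y)"
    and K: "\<And>t. 0 \<le> t \<Longrightarrow> t \<le> \<tau> \<Longrightarrow> norm (D (x + t *\<^sub>R a) a) \<le> K" and \<tau>: "0 \<le> \<tau>"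
  shows "norm (f (x + \<tau> *\<^sub>R a) - f x) \<le> K * \<tau>"
proof -
  have "norm ((\<lambda>t. f (x + t *\<^sub>R a)) \<tau> - (\<lambda>t. f (x + t *\<^sub>R a)) 0) \<le> K * norm (\<tau> - 0)"
  proof (rule differentiable_bound)
    show "convex {0..\<tau>}" by simp
    fix t assume t: "t \<in> {0..\<tau>}"
    have "((\<lambda>t. f (x + t *\<^sub>R a)) has_derivative (\<lambda>s. D (x + t *\<^sub>R a) (s *\<^sub>R a))) (at t within {0..\<tau>})"
      by (rule has_derivative_compose[OF _ f]) (auto intro!: derivative_eq_intros)
    then show "((\<lambda>t. f (x + t *\<^sub>R a)) has_derivative (\<lambda>s. D (x + t *\<^sub>R a) (s *\<^sub>R a))) (at t within {0..\<tau>})" .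
    have lin: "linear (D (x + t *\<^sub>R a))"
      using has_derivative_linear[OF f] .
    have "0 \<le> K" using order_trans[OF norm_ge_zero K[of 0]] \<tau> by simp
    show "onorm (\<lambda>s. D (x + t *\<^sub>R a) (s *\<^sub>R a)) \<le> K"
    proof (rule onorm_bound)
      show "0 \<le> K" by fact
      fix s :: real
      have "norm (D (x + t *\<^sub>R a) (s *\<^sub>R a)) = \<bar>s\<bar> * norm (D (x + t *\<^sub>R a) a)"
        by (simp add: linear_scale[OF lin])
      also have "\<dots> \<le> \<bar>s\<bar> * K" using K t by (intro mult_left_mono) auto
      finally show "norm (D (x + t *\<^sub>R a) (s *\<^sub>R a)) \<le> K * norm s" by (simp add: mult.commute)
    qed
  qed (use \<tau> in auto)
  then show ?thesis using \<tau> by simp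
qed

context torus
begin

lemma integral_M_lborel:
  fixes f :: "real^2 \<Rightarrow> complex"
  assumes "f \<in> borel_measurable borel"
  shows "(LINT x|M. f x) = (LINT x|lborel. indicator P x *\<^sub>R f x)"
proof -
  have "(LINT x|M. f x) = (LINT x|lebesgue. indicator P x *\<^sub>R f x)"
    unfolding M_def by (subst integral_restrict_space) auto
  also have "\<dots> = (LINT x|lborel. indicator P x *\<^sub>R f x)"
    using assms by (intro integral_completion) measurable
  finally show ?thesis .
qed

lemma borel_imp_M: "f \<in> borel_measurable borel \<Longrightarrow> f \<in> borel_measurable M"
  by (rule measurable_M) (auto intro: measurable_completion)

lemma continuous_imp_M:
  "continuous_on UNIV f \<Longrightarrow> f \<in> borel_measurable M" for f :: "real^2 \<Rightarrow> 'b::topological_space"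
  by (intro borel_imp_M borel_measurable_continuous_onI)

lemma continuous_bounded_on:
  fixes f :: "real^2 \<Rightarrow> 'b::real_normed_vector"
  assumes "continuous_on UNIV f"
  obtains K where "\<And>x. norm x \<le> R \<Longrightarrow> norm (f x) \<le> K"
proof -
  have "compact (f ` cball 0 R)"
    by (intro compact_continuous_image continuous_on_subset[OF assms]) auto
  then obtain K where "\<forall>y\<in>f ` cball 0 R. norm y \<le> K"
    using compact_imp_bounded bounded_iff by blast
  then show thesis by (intro that[of K]) auto
qed

lemma continuous_bounded_P:
  fixes f :: "real^2 \<Rightarrow> 'b::real_normed_vector"
  assumes "continuous_on UNIV f"
  obtains K where "\<And>x. x \<in> P \<Longrightarrow> norm (f x) \<le> K"
proof -
  obtain R where "\<And>x. x \<in> P \<Longrightarrow> norm x \<le> R" using bounded_P bounded_iff by blast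
  then show thesis using continuous_bounded_on[OF assms, of R] that by metis
qed

lemma continuous_integrable_M:
  fixes f :: "real^2 \<Rightarrow> 'b::{banach, second_countable_topology}"
  assumes "continuous_on UNIV f"
  shows "integrable M f"
proof -
  obtain K where "\<And>x. x \<in> P \<Longrightarrow> norm (f x) \<le> K" using continuous_bounded_P[OF assms] by blast
  then show ?thesis
    by (intro integrable_const_bound[of _ K] continuous_imp_M assms) (auto intro!: AE_I2)
qed

lemma integrable_indicator_bounded:
  fixes f :: "real^2 \<Rightarrow> complex"
  assumes f: "continuous_on UNIV f" and S: "S \<in> sets borel" "bounded S"
  shows "integrable lborel (\<lambda>x. indicator S x *\<^sub>R f x)"
proof -
  obtain R where R: "\<And>x. x \<in> S \<Longrightarrow> norm x \<le> R" using S(2) bounded_iff by blast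
  obtain K where K: "\<And>x. norm x \<le> R \<Longrightarrow> norm (f x) \<le> K" using continuous_bounded_on[OF f] by blast
  have "set_integrable lborel S f"
    unfolding set_integrable_def
  proof (rule Bochner_Integration.integrable_bound)
    show "integrable lborel (\<lambda>x. K * indicator S x :: real)"
      using S emeasure_bounded_finite[OF S(2)] by (intro integrable_mult_right integrable_real_indicator) auto
    show "(\<lambda>x. indicator S x *\<^sub>R f x) \<in> borel_measurable lborel"
      using S borel_measurable_continuous_onI[OF f] by measurable
    show "AE x in lborel. norm (indicator S x *\<^sub>R f x) \<le> norm (K * indicator S x :: real)"
      using K R by (intro AE_I2) (fastforce simp: indicator_def)
  qed
  then show ?thesis by (simp add: set_integrable_def)
qed

text \<open>\<open>P + \<tau>a\<close> is cut along \<open>x \<bullet> b = 2\<pi>\<close>; moving the protruding piece back by \<open>a\<close> yields \<open>P\<close>.\<close>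
lemma integral_shift_direction:
  fixes f :: "real^2 \<Rightarrow> complex"
  assumes f: "continuous_on UNIV f" and per: "\<And>x. f (x + a) = f x"
    and ab: "a \<bullet> b = 2 * pi" "a \<bullet> b' = 0" "0 \<le> \<tau>" "\<tau> \<le> 1"
    and PQ: "P = {x. 0 \<le> x \<bullet> b \<and> x \<bullet> b < 2 * pi} \<inter> {x. 0 \<le> x \<bullet> b' \<and> x \<bullet> b' < 2 * pi}"
  shows "(LINT x|M. f (x + \<tau> *\<^sub>R a)) = (LINT x|M. f x)"
proof -
  define S where "S = {x::real^2. 0 \<le> x \<bullet> b' \<and> x \<bullet> b' < 2 * pi}"
  define Q where "Q s t = {x. s \<le> x \<bullet> b \<and> x \<bullet> b < t} \<inter> S" for s t
  define c where "c = \<tau> *\<^sub>R a"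
  define T where "T = 2 * pi * \<tau>"
  have c: "c \<bullet> b = T" "c \<bullet> b' = 0"
    by (simp_all add: c_def T_def ab)
  have T: "0 \<le> T" "T \<le> 2 * pi" using ab by (auto simp: T_def)
  have P: "P = Q 0 (2 * pi)" by (simp add: Q_def S_def PQ)
  have Qm [measurable]: "Q s t \<in> sets borel" for s t
    unfolding Q_def S_def by measurable
  have [measurable]: "f \<in> borel_measurable borel"
    using f by (rule borel_measurable_continuous_onI)
  have Q1: "integrable lborel (\<lambda>x. indicator (Q s t) x *\<^sub>R f x)" if "0 \<le> s" "t \<le> 2 * pi" for s t
  proof (rule integrable_indicator_bounded[OF f Qm])
    show "bounded (Q s t)"
      by (rule bounded_subset[OF bounded_P]) (use that in \<open>auto simp: P Q_def\<close>)
  qed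
  have Q2: "integrable lborel (\<lambda>x. indicator (Q (2 * pi) (2 * pi + T)) x *\<^sub>R f x)"
  proof (rule integrable_indicator_bounded[OF f Qm])
    have "Q (2 * pi) (2 * pi + T) \<subseteq> (\<lambda>x. a + x) ` P"
    proof
      fix x assume "x \<in> Q (2 * pi) (2 * pi + T)"
      then have "x - a \<in> P" using T unfolding P Q_def S_def by (simp add: inner_diff_left ab)
      then show "x \<in> (\<lambda>x. a + x) ` P" by (intro image_eqI[of _ _ "x - a"]) auto
    qed
    then show "bounded (Q (2 * pi) (2 * pi + T))"
      by (rule bounded_subset[OF bounded_translation[OF bounded_P, of a]])
  qed
  have "(LINT x|M. f (x + c)) = (LINT x|lborel. indicator P x *\<^sub>R f (x + c))"
    by (rule integral_M_lborel) measurable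
  also have "\<dots> = (LINT x|lborel. indicator P (x - c) *\<^sub>R f x)"
    using lborel_integral_shift[of "\<lambda>x. indicator P x *\<^sub>R f (x + c)" "- c"] by simp
  also have "\<dots> = (LINT x|lborel. indicator (Q T (2 * pi)) x *\<^sub>R f x
      + indicator (Q (2 * pi) (2 * pi + T)) x *\<^sub>R f x)"
  proof (intro Bochner_Integration.integral_cong refl)
    fix x
    have "x - c \<in> P \<longleftrightarrow> T \<le> x \<bullet> b \<and> x \<bullet> b < 2 * pi + T \<and> x \<in> S"
      unfolding P Q_def S_def by (auto simp: inner_diff_left c)
    also have "\<dots> \<longleftrightarrow> x \<in> Q T (2 * pi) \<or> x \<in> Q (2 * pi) (2 * pi + T)"
      unfolding Q_def using T by auto
    finally have "x - c \<in> P \<longleftrightarrow> x \<in> Q T (2 * pi) \<or> x \<in> Q (2 * pi) (2 * pi + T)" .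
    moreover have "\<not> (x \<in> Q T (2 * pi) \<and> x \<in> Q (2 * pi) (2 * pi + T))"
      by (auto simp: Q_def)
    ultimately show "indicator P (x - c) *\<^sub>R f x
      = indicator (Q T (2 * pi)) x *\<^sub>R f x + indicator (Q (2 * pi) (2 * pi + T)) x *\<^sub>R f x"
      by (auto simp: indicator_def)
  qed
  also have "\<dots> = (LINT x|lborel. indicator (Q T (2 * pi)) x *\<^sub>R f x)
      + (LINT x|lborel. indicator (Q (2 * pi) (2 * pi + T)) x *\<^sub>R f x)"
    using T by (intro Bochner_Integration.integral_add Q1 Q2) auto
  also have "(LINT x|lborel. indicator (Q (2 * pi) (2 * pi + T)) x *\<^sub>R f x)
      = (LINT x|lborel. indicator (Q (2 * pi) (2 * pi + T)) (x + a) *\<^sub>R f (x + a))"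
    by (rule lborel_integral_shift[symmetric]) measurable
  also have "\<dots> = (LINT x|lborel. indicator (Q 0 T) x *\<^sub>R f x)"
    by (intro Bochner_Integration.integral_cong refl)
       (auto simp: per indicator_def Q_def S_def inner_add_left ab)
  also have "(LINT x|lborel. indicator (Q T (2 * pi)) x *\<^sub>R f x) + \<dots>
      = (LINT x|lborel. indicator (Q T (2 * pi)) x *\<^sub>R f x + indicator (Q 0 T) x *\<^sub>R f x)"
    using T by (intro Bochner_Integration.integral_add[symmetric] Q1) auto
  also have "\<dots> = (LINT x|lborel. indicator P x *\<^sub>R f x)"
  proof (intro Bochner_Integration.integral_cong refl)
    fix x
    have "x \<in> P \<longleftrightarrow> x \<in> Q T (2 * pi) \<or> x \<in> Q 0 T" "\<not> (x \<in> Q T (2 * pi) \<and> x \<in> Q 0 T)"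
      unfolding P Q_def using T by auto
    then show "indicator (Q T (2 * pi)) x *\<^sub>R f x + indicator (Q 0 T) x *\<^sub>R f x = indicator P x *\<^sub>R f x"
      by (auto simp: indicator_def)
  qed
  also have "\<dots> = (LINT x|M. f x)"
    by (rule integral_M_lborel[symmetric]) measurable
  finally show ?thesis unfolding c_def .
qed

text \<open>The difference quotients have integral zero by translation invariance and converge dominatedly to the
  derivative.\<close>
lemma integral_directional_derivative:
  fixes f :: "real^2 \<Rightarrow> complex"
  assumes f: "\<And>x. (f has_derivative D x) (at x)" and cont: "continuous_on UNIV (\<lambda>x. D x a)"
    and shift: "\<And>\<tau>. 0 \<le> \<tau> \<Longrightarrow> \<tau> \<le> 1 \<Longrightarrow> (LINT x|M. f (x + \<tau> *\<^sub>R a)) = (LINT x|M. f x)"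
  shows "(LINT x|M. D x a) = 0"
proof (rule LIMSEQ_unique)
  have fc: "continuous_on UNIV f"
    by (intro continuous_at_imp_continuous_on ballI has_derivative_continuous[OF f])
  define q where "q k x = real (Suc k) *\<^sub>R (f (x + (1 / real (Suc k)) *\<^sub>R a) - f x)" for k x
  have fs: "continuous_on UNIV (\<lambda>x. f (x + c))" for c
    by (rule continuous_on_compose2[OF fc]) (auto intro: continuous_intros)
  have qc: "continuous_on UNIV (q k)" for k
    unfolding q_def by (intro continuous_intros fs fc)
  obtain R where R: "\<And>x. x \<in> P \<Longrightarrow> norm x \<le> R" using bounded_P bounded_iff by blast
  obtain K where K: "\<And>x. norm x \<le> R + norm a \<Longrightarrow> norm (D x a) \<le> K"
    using continuous_bounded_on[OF cont] by blast
  show "(\<lambda>k. LINT x|M. q k x) \<longlonglongrightarrow> (LINT x|M. D x a)"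
  proof (rule integral_dominated_convergence[where w = "\<lambda>_. K"])
    show "(\<lambda>x. D x a) \<in> borel_measurable M" "q k \<in> borel_measurable M" for k
      by (intro continuous_imp_M cont qc)+
    show "integrable M (\<lambda>_. K)" by simp
    show "AE x in M. (\<lambda>k. q k x) \<longlonglongrightarrow> D x a"
      unfolding q_def using has_derivative_difference_quotient[OF f] by (intro AE_I2)
    show "AE x in M. norm (q k x) \<le> K" for k
    proof (rule AE_I2)
      fix x assume "x \<in> space M"
      then have xR: "norm x \<le> R" using R by simp
      have "norm (f (x + (1 / real (Suc k)) *\<^sub>R a) - f x) \<le> K * (1 / real (Suc k))"
      proof (rule norm_increment_le[OF f])
        fix t assume t: "0 \<le> t" "t \<le> 1 / real (Suc k)"
        have "1 / real (Suc k) \<le> 1" by simp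
        then have "t \<le> 1" using t by linarith
        then have "t * norm a \<le> 1 * norm a" by (intro mult_right_mono) auto
        then have "norm (x + t *\<^sub>R a) \<le> R + norm a"
          using norm_triangle_ineq[of x "t *\<^sub>R a"] xR t by simp
        then show "norm (D (x + t *\<^sub>R a) a) \<le> K" by (rule K)
      qed simp
      then have "real (Suc k) * norm (f (x + (1 / real (Suc k)) *\<^sub>R a) - f x) \<le> real (Suc k) * (K * (1 / real (Suc k)))"
        by (intro mult_left_mono) auto
      then show "norm (q k x) \<le> K"
        unfolding q_def norm_scaleR by (simp del: of_nat_Suc)
    qed
  qed
  have "(LINT x|M. q k x) = 0" for k
    unfolding q_def using shift[of "1 / real (Suc k)"] continuous_integrable_M[OF fs] continuous_integrable_M[OF fc]
    by simp
  then show "(\<lambda>k. LINT x|M. q k x) \<longlonglongrightarrow> 0" by simp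
qed

lemma lattice_mem: "a1 \<in> period_lattice a1 a2" "a2 \<in> period_lattice a1 a2"
proof -
  have "a1 = of_int 1 *\<^sub>R a1 + of_int 0 *\<^sub>R a2" "a2 = of_int 0 *\<^sub>R a1 + of_int 1 *\<^sub>R a2" by simp_all
  then show "a1 \<in> period_lattice a1 a2" "a2 \<in> period_lattice a1 a2"
    unfolding period_lattice_def by blast+
qed

text \<open>Coordinate directions are combinations of \<open>a1\<close> and \<open>a2\<close>, along which the integral over \<open>P\<close> is translation
  invariant.\<close>
lemma integral_pdiff:
  fixes f :: "real^2 \<Rightarrow> complex"
  assumes f: "\<And>x. f differentiable (at x)" and cont: "\<And>j. continuous_on UNIV (pdiff j f)"
    and per: "periodic a1 a2 f"
  shows "(LINT x|M. pdiff j f x) = 0"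
proof -
  define D where "D x = frechet_derivative f (at x)" for x
  have D: "(f has_derivative D x) (at x)" for x
    unfolding D_def using f frechet_derivative_works by blast
  have lin: "linear (D x)" for x using has_derivative_linear[OF D] .
  have Da: "D x a = of_real (a $ 1) * pdiff 1 f x + of_real (a $ 2) * pdiff 2 f x" for x a
  proof -
    have "a = (a $ 1) *\<^sub>R axis 1 1 + (a $ 2) *\<^sub>R axis 2 1"
      by (simp add: vec_eq_iff forall_2 axis_def)
    then have "D x a = D x ((a $ 1) *\<^sub>R axis 1 1 + (a $ 2) *\<^sub>R axis 2 1)"
      by (rule arg_cong)
    also have "\<dots> = (a $ 1) *\<^sub>R D x (axis 1 1) + (a $ 2) *\<^sub>R D x (axis 2 1)"
      by (simp only: linear_add[OF lin] linear_scale[OF lin])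
    finally show ?thesis by (simp add: pdiff_def D_def scaleR_conv_of_real)
  qed
  have Dc: "continuous_on UNIV (\<lambda>x. D x a)" for a
    unfolding Da by (intro continuous_intros cont)
  have fc: "continuous_on UNIV f"
    by (intro continuous_at_imp_continuous_on ballI has_derivative_continuous[OF D])
  have p: "f (x + a1) = f x" "f (x + a2) = f x" for x
    using per lattice_mem by (auto simp: periodic_def)
  have 1: "(LINT x|M. D x a1) = 0"
    by (rule integral_directional_derivative[OF D Dc],
        rule integral_shift_direction[OF fc p(1), where b = b1 and b' = b2]) (auto simp: P_def)
  have 2: "(LINT x|M. D x a2) = 0"
    by (rule integral_directional_derivative[OF D Dc],
        rule integral_shift_direction[OF fc p(2), where b = b2 and b' = b1]) (auto simp: P_def)
  define c where "c = (axis j 1 \<bullet> b1 / (2 * pi))"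
  define d where "d = (axis j 1 \<bullet> b2 / (2 * pi))"
  have "pdiff j f x = c *\<^sub>R D x a1 + d *\<^sub>R D x a2" for x
  proof -
    have ax: "axis j 1 = c *\<^sub>R a1 + d *\<^sub>R a2"
      unfolding c_def d_def by (rule coords)
    have "pdiff j f x = D x (c *\<^sub>R a1 + d *\<^sub>R a2)"
      unfolding pdiff_def D_def ax ..
    also have "\<dots> = c *\<^sub>R D x a1 + d *\<^sub>R D x a2"
      by (simp only: linear_add[OF lin] linear_scale[OF lin])
    finally show ?thesis .
  qed
  then have "(LINT x|M. pdiff j f x) = (LINT x|M. c *\<^sub>R D x a1 + d *\<^sub>R D x a2)" by (simp only:)
  also have "\<dots> = c *\<^sub>R (LINT x|M. D x a1) + d *\<^sub>R (LINT x|M. D x a2)"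
    by (simp only: Bochner_Integration.integral_add integrable_scaleR_right integral_scaleR_right
        continuous_integrable_M[OF Dc])
  finally show ?thesis unfolding 1 2 by simp
qed

end

section \<open>Plane waves and their completeness\<close>

context torus
begin

definition freq :: "int \<times> int \<Rightarrow> real^2" where
  "freq h = of_int (fst h) *\<^sub>R b1 + of_int (snd h) *\<^sub>R b2"

definition wave :: "int \<times> int \<Rightarrow> real^2 \<Rightarrow> complex" where
  "wave h x = cis (freq h \<bullet> x)"

lemma freq_zero [simp]: "freq 0 = 0"
  by (simp add: freq_def zero_prod_def)

lemma freq_add: "freq (h + k) = freq h + freq k"
  by (simp add: freq_def algebra_simps)

lemma freq_minus: "freq (- h) = - freq h"
  by (simp add: freq_def)

lemma freq_eq_0_iff: "freq h = 0 \<longleftrightarrow> h = 0"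
proof
  assume "freq h = 0"
  then have "a1 \<bullet> freq h = 0" "a2 \<bullet> freq h = 0" by simp_all
  then show "h = 0" by (simp add: freq_def inner_add_right prod_eq_iff)
qed simp

lemma wave_zero [simp]: "wave 0 x = 1"
  by (simp add: wave_def)

lemma wave_add: "wave (h + k) x = wave h x * wave k x"
  by (simp add: wave_def freq_add inner_add_left cis_mult)

lemma cnj_wave: "cnj (wave h x) = wave (- h) x"
  by (simp add: wave_def freq_minus cis_cnj)

lemma norm_wave [simp]: "norm (wave h x) = 1"
  by (simp add: wave_def)

lemma continuous_wave: "continuous_on UNIV (wave h)"
  unfolding wave_def by (intro continuous_intros)

lemma periodic_wave: "periodic a1 a2 (wave h)"
  unfolding periodic_def
proof (intro allI ballI)
  fix x k assume "k \<in> period_lattice a1 a2"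
  then obtain k1 k2 :: int where k: "k = of_int k1 *\<^sub>R a1 + of_int k2 *\<^sub>R a2"
    by (auto simp: period_lattice_def)
  have "freq h \<bullet> k = 2 * pi * of_int (fst h * k1 + snd h * k2)"
    by (simp add: k freq_def inner_add_left inner_add_right inner_commute[of b1] inner_commute[of b2] algebra_simps)
  then have "cis (freq h \<bullet> k) = 1"
    by (simp add: cis_multiple_2pi)
  then show "wave h (x + k) = wave h x"
    by (simp add: wave_def inner_add_right flip: cis_mult)
qed

lemma has_derivative_wave':
  "(wave h has_derivative (\<lambda>y. \<i> * of_real (freq h \<bullet> y) * wave h x)) (at x)"
proof -
  have "((\<lambda>x. \<i> * complex_of_real (freq h \<bullet> x)) has_derivative (\<lambda>y. \<i> * of_real (freq h \<bullet> y))) (at x)"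
    by (intro has_derivative_mult_right has_derivative_of_real has_derivative_inner_right has_derivative_ident)
  from has_derivative_compose[OF this has_field_derivative_imp_has_derivative[OF DERIV_exp]]
  show ?thesis
    by (simp add: wave_def[abs_def] cis_conv_exp mult_ac)
qed

lemma has_derivative_wave:
  "((\<lambda>x. c * wave h x) has_derivative (\<lambda>y. c * (\<i> * of_real (freq h \<bullet> y) * wave h x))) (at x)"
  by (rule has_derivative_mult_right[OF has_derivative_wave'])

lemma pdiff_wave: "pdiff j (\<lambda>x. c * wave h x) = (\<lambda>x. (c * \<i> * of_real (freq h $ j)) * wave h x)"
proof
  fix x
  show "pdiff j (\<lambda>x. c * wave h x) x = (c * \<i> * of_real (freq h $ j)) * wave h x"
    unfolding pdiff_def frechet_derivative_at[OF has_derivative_wave, symmetric]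
    by (simp add: inner_axis)
qed

lemma iterated_pdiff_wave: "\<exists>c'. foldr pdiff js (\<lambda>x. c * wave h x) = (\<lambda>x. c' * wave h x)"
  by (induction js) (auto simp: pdiff_wave)

lemma test_fun_wave: "wave h \<in> test_fun a1 a2"
proof -
  have "foldr pdiff js (wave h) differentiable (at x)" for js x
  proof -
    obtain c' where "foldr pdiff js (\<lambda>x. 1 * wave h x) = (\<lambda>x. c' * wave h x)"
      using iterated_pdiff_wave by blast
    then have "foldr pdiff js (wave h) = (\<lambda>x. c' * wave h x)" by simp
    then show ?thesis using has_derivative_wave unfolding differentiable_def by metis
  qed
  then show ?thesis by (simp add: test_fun_def periodic_wave)
qed

lemma test_fun_pdiff: "\<phi> \<in> test_fun a1 a2 \<Longrightarrow> foldr pdiff js \<phi> differentiable (at x)"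
  by (simp add: test_fun_def)

lemma test_fun_differentiable: "\<phi> \<in> test_fun a1 a2 \<Longrightarrow> \<phi> differentiable (at x)"
  using test_fun_pdiff[of \<phi> "[]"] by simp

lemma test_fun_continuous: "\<phi> \<in> test_fun a1 a2 \<Longrightarrow> continuous_on UNIV \<phi>"
  by (intro continuous_at_imp_continuous_on ballI differentiable_imp_continuous_within
      test_fun_differentiable)

lemma test_fun_continuous_pdiff:
  assumes "\<phi> \<in> test_fun a1 a2"
  shows "continuous_on UNIV (pdiff j \<phi>)"
  using test_fun_pdiff[OF assms, of "[j]"]
  by (intro continuous_at_imp_continuous_on ballI differentiable_imp_continuous_within) simp

text \<open>Integration by parts: the product of the two periodic functions is periodic, so its derivative has
  integral zero.\<close>
lemma integral_pdiff_wave: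
  assumes \<phi>: "\<phi> \<in> test_fun a1 a2"
  shows "(LINT x|M. pdiff j \<phi> x * wave h x) = - \<i> * of_real (freq h $ j) * (LINT x|M. \<phi> x * wave h x)"
proof -
  let ?f = "\<lambda>x. \<phi> x * wave h x"
  define D where "D x = frechet_derivative \<phi> (at x)" for x
  have D: "(\<phi> has_derivative D x) (at x)" for x
    unfolding D_def using test_fun_differentiable[OF \<phi>] frechet_derivative_works by blast
  have der: "(?f has_derivative (\<lambda>y. \<phi> x * (\<i> * of_real (freq h \<bullet> y) * wave h x) + D x y * wave h x)) (at x)" for x
    using has_derivative_mult[OF D has_derivative_wave[of 1 h]] by simp
  have pd: "pdiff j ?f = (\<lambda>x. pdiff j \<phi> x * wave h x + \<i> * of_real (freq h $ j) * (\<phi> x * wave h x))" for j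
    unfolding pdiff_def fun_eq_iff frechet_derivative_at[OF der, symmetric]
    by (simp add: D_def inner_axis algebra_simps)
  note cont = test_fun_continuous[OF \<phi>] test_fun_continuous_pdiff[OF \<phi>] continuous_wave
  have "(LINT x|M. pdiff j ?f x) = 0"
  proof (rule integral_pdiff)
    show "?f differentiable (at x)" for x using der by (auto simp: differentiable_def)
    show "continuous_on UNIV (pdiff j ?f)" for j
      unfolding pd by (intro continuous_intros cont)
    show "periodic a1 a2 ?f" using \<phi> periodic_wave by (simp add: periodic_def test_fun_def)
  qed
  moreover have "integrable M (\<lambda>x. pdiff j \<phi> x * wave h x)" "integrable M ?f"
    by (intro continuous_integrable_M continuous_intros cont)+
  ultimately have "(LINT x|M. pdiff j \<phi> x * wave h x) + \<i> * of_real (freq h $ j) * (LINT x|M. ?f x) = 0"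
    unfolding pd by simp
  then show ?thesis by (simp add: add_eq_0_iff)
qed

text \<open>Orthogonality of plane waves is integration by parts against the constant function \<open>wave 0\<close>.\<close>
lemma integral_wave: "(LINT x|M. wave h x) = (if h = 0 then of_real A else 0)"
proof (cases "h = 0")
  case True
  then show ?thesis by (simp add: A_def scaleR_conv_of_real)
next
  case False
  then obtain j where j: "freq h $ j \<noteq> 0"
    using freq_eq_0_iff[of h] by (auto simp: vec_eq_iff)
  have "(LINT x|M. pdiff j (wave 0) x * wave h x) = - \<i> * of_real (freq h $ j) * (LINT x|M. wave 0 x * wave h x)"
    by (rule integral_pdiff_wave[OF test_fun_wave])
  moreover have "pdiff j (wave 0) = (\<lambda>x. 0)"
  proof -
    have "wave 0 = (\<lambda>x. 1)" by (simp add: fun_eq_iff)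
    then show ?thesis using pdiff_wave[of j 1 0] by simp
  qed
  ultimately show ?thesis using j False by simp
qed

text \<open>Suppose that all Fourier coefficients of \<open>f\<close> vanish. The functions \<open>p\<close> for which multiplication by \<open>p\<close>
  preserves the vanishing of all coefficients of products \<open>f q\<close> form an algebra; this form of the hypothesis,
  rather than vanishing of the coefficients of \<open>f p\<close> alone, is stable under products.\<close>

definition orth :: "(real^2 \<Rightarrow> complex) \<Rightarrow> (real^2 \<Rightarrow> complex) \<Rightarrow> bool" where
  "orth f q \<longleftrightarrow> continuous_on UNIV q \<and> (\<forall>h. (LINT x|M. f x * (q x * wave h x)) = 0)"

definition multiplier :: "(real^2 \<Rightarrow> complex) \<Rightarrow> (real^2 \<Rightarrow> complex) \<Rightarrow> bool" where
  "multiplier f p \<longleftrightarrow> continuous_on UNIV p \<and> (\<forall>q. orth f q \<longrightarrow> orth f (\<lambda>x. q x * p x))"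

lemma integrable_mult_continuous:
  fixes f :: "real^2 \<Rightarrow> complex"
  assumes f: "integrable M f" and q: "continuous_on UNIV q"
  shows "integrable M (\<lambda>x. f x * q x)"
proof -
  obtain K where K: "\<And>x. x \<in> P \<Longrightarrow> norm (q x) \<le> K" using continuous_bounded_P[OF q] by blast
  show ?thesis
  proof (rule Bochner_Integration.integrable_bound)
    show "integrable M (\<lambda>x. K * norm (f x))"
      using f by (intro integrable_mult_right integrable_norm)
    show "(\<lambda>x. f x * q x) \<in> borel_measurable M"
      using f continuous_imp_M[OF q] by measurable
    show "AE x in M. norm (f x * q x) \<le> norm (K * norm (f x))"
    proof (rule AE_I2)
      fix x assume "x \<in> space M"
      then have "norm (f x) * norm (q x) \<le> norm (f x) * \<bar>K\<bar>"
        using K[of x] by (intro mult_left_mono) auto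
      then show "norm (f x * q x) \<le> norm (K * norm (f x))"
        by (simp add: norm_mult abs_mult mult.commute)
    qed
  qed
qed

lemma multiplier_add:
  assumes f: "integrable M f" and p: "multiplier f p" "multiplier f p'"
  shows "multiplier f (\<lambda>x. p x + p' x)"
  unfolding multiplier_def
proof (intro conjI allI impI)
  show "continuous_on UNIV (\<lambda>x. p x + p' x)"
    using p by (auto simp: multiplier_def intro!: continuous_intros)
  fix q assume q: "orth f q"
  have o: "orth f (\<lambda>x. q x * p x)" "orth f (\<lambda>x. q x * p' x)"
    using p q by (auto simp: multiplier_def)
  show "orth f (\<lambda>x. q x * (p x + p' x))"
    unfolding orth_def
  proof (intro conjI allI)
    show "continuous_on UNIV (\<lambda>x. q x * (p x + p' x))"
      using q p by (auto simp: multiplier_def orth_def intro!: continuous_intros)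
    fix h
    have i: "integrable M (\<lambda>x. f x * (q x * p x * wave h x))" "integrable M (\<lambda>x. f x * (q x * p' x * wave h x))"
      using o by (auto simp: orth_def intro!: integrable_mult_continuous f continuous_intros continuous_wave)
    have "(LINT x|M. f x * (q x * (p x + p' x) * wave h x))
        = (LINT x|M. f x * (q x * p x * wave h x) + f x * (q x * p' x * wave h x))"
      by (simp add: algebra_simps)
    also have "\<dots> = (LINT x|M. f x * (q x * p x * wave h x)) + (LINT x|M. f x * (q x * p' x * wave h x))"
      by (rule Bochner_Integration.integral_add[OF i])
    also have "(LINT x|M. f x * (q x * p x * wave h x)) = 0"
      using o(1) unfolding orth_def by blast
    also have "(LINT x|M. f x * (q x * p' x * wave h x)) = 0"
      using o(2) unfolding orth_def by blast
    also have "(0::complex) + 0 = 0" by simp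
    finally show "(LINT x|M. f x * (q x * (p x + p' x) * wave h x)) = 0" .
  qed
qed

lemma multiplier_mult:
  assumes "multiplier f p" "multiplier f p'"
  shows "multiplier f (\<lambda>x. p x * p' x)"
  using assms unfolding multiplier_def by (auto intro!: continuous_intros simp flip: mult.assoc)

lemma multiplier_const: "multiplier f (\<lambda>x. c)"
  unfolding multiplier_def
proof (intro conjI allI impI)
  fix q assume q: "orth f q"
  have "(LINT x|M. f x * (q x * c * wave h x)) = (LINT x|M. c * (f x * (q x * wave h x)))" for h
    by (simp add: mult_ac)
  then show "orth f (\<lambda>x. q x * c)"
    using q unfolding orth_def by (auto intro!: continuous_intros)
qed simp

lemma multiplier_wave: "multiplier f (wave k)"
  unfolding multiplier_def
proof (intro conjI allI impI continuous_wave)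
  fix q assume q: "orth f q"
  have "(LINT x|M. f x * (q x * wave k x * wave h x)) = (LINT x|M. f x * (q x * wave (k + h) x))" for h
    by (simp add: wave_add mult.assoc)
  then show "orth f (\<lambda>x. q x * wave k x)"
    using q unfolding orth_def by (auto intro!: continuous_intros continuous_wave)
qed

text \<open>The covering map onto the torus of pairs of unit complex numbers; it is injective on \<open>P\<close>.\<close>

definition \<Phi> :: "real^2 \<Rightarrow> complex \<times> complex" where
  "\<Phi> x = (wave (1, 0) x, wave (0, 1) x)"

lemma continuous_\<Phi>: "continuous_on S \<Phi>"
  unfolding \<Phi>_def using continuous_on_subset[OF continuous_wave, of S]
  by (auto intro!: continuous_intros)

lemma inj_on_\<Phi>: "inj_on \<Phi> P"
proof (rule inj_onI)
  fix x y assume x: "x \<in> P" and y: "y \<in> P" and eq: "\<Phi> x = \<Phi> y"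
  have unique: "s = t" if "cis s = cis t" "0 \<le> s" "s < 2 * pi" "0 \<le> t" "t < 2 * pi" for s t
  proof -
    have "sin s = sin t \<and> cos s = cos t" using that(1) by (simp add: complex_eq_iff)
    then obtain n :: int where n: "s = t + 2 * pi * of_int n" using sin_cos_eq_iff by blast
    then have "real_of_int n * (2 * pi) = s - t" by simp
    then have "real_of_int n * (2 * pi) < 1 * (2 * pi)" "(- 1) * (2 * pi) < real_of_int n * (2 * pi)"
      using that(2-) by linarith+
    then have "real_of_int n < 1" "- 1 < real_of_int n"
      by (simp_all only: mult_less_cancel_right_pos[of "2 * pi"] pi_gt_zero zero_less_mult_iff zero_less_numeral simp_thms)
    then have "n = 0" by linarith
    then show ?thesis using n by simp
  qed
  have eqs: "x \<bullet> b1 = y \<bullet> b1" "x \<bullet> b2 = y \<bullet> b2"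
    using x y eq by (auto intro!: unique simp: \<Phi>_def wave_def freq_def P_def inner_commute)
  have "x = (x \<bullet> b1 / (2 * pi)) *\<^sub>R a1 + (x \<bullet> b2 / (2 * pi)) *\<^sub>R a2" by (rule coords)
  also have "\<dots> = y" unfolding eqs by (rule coords[symmetric])
  finally show "x = y" .
qed

text \<open>Real and imaginary parts of the components of \<open>\<Phi>\<close> are combinations of plane waves, and multipliers form an
  algebra.\<close>
lemma multiplier_polynomial:
  assumes f: "integrable M f" and p: "real_polynomial_function p"
  shows "multiplier f (\<lambda>x. of_real (p (\<Phi> x)))"
  using p
proof induction
  case (linear L)
  have lin: "linear L" using linear by (rule bounded_linear.linear)
  have "of_real (L (\<Phi> x)) =
      (of_real (L (1, 0)) / 2) * (wave (1, 0) x + wave (-1, 0) x) + (of_real (L (\<i>, 0)) / (2 * \<i>)) * (wave (1, 0) x + (-1) * wave (-1, 0) x)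
    + ((of_real (L (0, 1)) / 2) * (wave (0, 1) x + wave (0, -1) x) + (of_real (L (0, \<i>)) / (2 * \<i>)) * (wave (0, 1) x + (-1) * wave (0, -1) x))"
    for x
  proof -
    define z where "z = wave (1, 0) x"
    define w where "w = wave (0, 1) x"
    have cz: "wave (-1, 0) x = cnj z" "wave (0, -1) x = cnj w"
      by (simp_all add: z_def w_def cnj_wave)
    have "\<Phi> x = Re z *\<^sub>R (1, 0) + Im z *\<^sub>R (\<i>, 0) + (Re w *\<^sub>R (0, 1) + Im w *\<^sub>R (0, \<i>))"
      by (simp add: \<Phi>_def z_def w_def complex_eq_iff)
    then have "L (\<Phi> x) = L (Re z *\<^sub>R (1, 0) + Im z *\<^sub>R (\<i>, 0) + (Re w *\<^sub>R (0, 1) + Im w *\<^sub>R (0, \<i>)))"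
      by (rule arg_cong)
    also have "\<dots> = Re z * L (1, 0) + Im z * L (\<i>, 0) + (Re w * L (0, 1) + Im w * L (0, \<i>))"
      by (simp only: linear_add[OF lin] linear_scale[OF lin] real_scaleR_def)
    finally have L: "L (\<Phi> x) = Re z * L (1, 0) + Im z * L (\<i>, 0) + (Re w * L (0, 1) + Im w * L (0, \<i>))" .
    have re: "(u + cnj u) = 2 * of_real (Re u)" and im: "(u + (-1) * cnj u) = 2 * \<i> * of_real (Im u)" for u
      by (simp_all add: complex_eq_iff)
    show ?thesis
      unfolding cz z_def[symmetric] w_def[symmetric] re im L by (simp add: complex_eq_iff)
  qed
  then show ?case
    by (simp only:) (intro multiplier_add multiplier_mult multiplier_const multiplier_wave f)
next
  case (add p q)
  then show ?case using multiplier_add[OF f] by simp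
next
  case (mult p q)
  then show ?case using multiplier_mult by simp
qed (simp add: multiplier_const)

lemma integral_vanishing_continuous:
  fixes f :: "real^2 \<Rightarrow> complex" and F :: "complex \<times> complex \<Rightarrow> real"
  assumes f: "integrable M f" and coef: "\<And>h. (LINT x|M. f x * wave h x) = 0"
    and F: "continuous_on UNIV F"
  shows "(LINT x|M. f x * of_real (F (\<Phi> x))) = 0"
proof -
  have FP: "continuous_on UNIV (\<lambda>x. complex_of_real (F (\<Phi> x)))"
    by (intro continuous_intros continuous_on_compose2[OF F continuous_\<Phi>]) auto
  have bound: "norm (LINT x|M. f x * of_real (F (\<Phi> x))) \<le> \<epsilon> * (LINT x|M. norm (f x))" if \<epsilon>: "\<epsilon> > 0" for \<epsilon>
  proof -
    define S :: "(complex \<times> complex) set" where "S = sphere 0 1 \<times> sphere 0 1"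
    have "compact S" unfolding S_def by (intro compact_Times compact_sphere)
    then obtain p where p: "real_polynomial_function p" and Fp: "\<And>z. z \<in> S \<Longrightarrow> \<bar>F z - p z\<bar> < \<epsilon>"
      using Stone_Weierstrass_real_polynomial_function[of S F \<epsilon>] continuous_on_subset[OF F] \<epsilon> by auto
    have mp: "multiplier f (\<lambda>x. of_real (p (\<Phi> x)))"
      by (rule multiplier_polynomial[OF f p])
    have "orth f (\<lambda>x. 1)" using coef by (simp add: orth_def)
    then have "orth f (\<lambda>x. 1 * of_real (p (\<Phi> x)))" using mp unfolding multiplier_def by blast
    then have "(LINT x|M. f x * (1 * of_real (p (\<Phi> x)) * wave 0 x)) = 0"
      unfolding orth_def by blast
    then have p0: "(LINT x|M. f x * of_real (p (\<Phi> x))) = 0" by simp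
    have pP: "continuous_on UNIV (\<lambda>x. complex_of_real (p (\<Phi> x)))"
      using mp unfolding multiplier_def by blast
    have "(LINT x|M. f x * of_real (F (\<Phi> x)))
        = (LINT x|M. f x * of_real (F (\<Phi> x))) - (LINT x|M. f x * of_real (p (\<Phi> x)))"
      using p0 by simp
    also have "\<dots> = (LINT x|M. f x * of_real (F (\<Phi> x)) - f x * of_real (p (\<Phi> x)))"
      by (intro Bochner_Integration.integral_diff[symmetric] integrable_mult_continuous f FP pP)
    also have "norm \<dots> \<le> (LINT x|M. norm (f x * of_real (F (\<Phi> x)) - f x * of_real (p (\<Phi> x))))"
      by (rule integral_norm_bound)
    also have "\<dots> \<le> (LINT x|M. \<epsilon> * norm (f x))"
    proof (rule integral_mono)
      show "integrable M (\<lambda>x. norm (f x * of_real (F (\<Phi> x)) - f x * of_real (p (\<Phi> x))))"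
        by (intro integrable_norm Bochner_Integration.integrable_diff integrable_mult_continuous f FP pP)
      show "integrable M (\<lambda>x. \<epsilon> * norm (f x))"
        by (intro integrable_mult_right integrable_norm f)
      fix x
      have "\<Phi> x \<in> S" by (simp add: \<Phi>_def S_def)
      then have "norm (complex_of_real (F (\<Phi> x)) - of_real (p (\<Phi> x))) \<le> \<epsilon>"
        using Fp[of "\<Phi> x"] by (simp flip: of_real_diff)
      then have "norm (f x) * norm (complex_of_real (F (\<Phi> x)) - of_real (p (\<Phi> x))) \<le> norm (f x) * \<epsilon>"
        by (intro mult_left_mono) auto
      then show "norm (f x * of_real (F (\<Phi> x)) - f x * of_real (p (\<Phi> x))) \<le> \<epsilon> * norm (f x)"
        by (simp add: mult.commute flip: norm_mult right_diff_distrib)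
    qed
    finally show ?thesis by simp
  qed
  show ?thesis
  proof (rule ccontr)
    assume ne: "(LINT x|M. f x * of_real (F (\<Phi> x))) \<noteq> 0" (is "?I \<noteq> 0")
    define N where "N = (LINT x|M. norm (f x))"
    have N0: "N \<ge> 0" by (simp add: N_def)
    have "norm ?I / (2 * (N + 1)) > 0" using ne N0 by (intro divide_pos_pos) auto
    then have "norm ?I \<le> (norm ?I / (2 * (N + 1))) * N"
      using bound unfolding N_def by blast
    also have "\<dots> = norm ?I * (N / (2 * (N + 1)))" by simp
    also have "\<dots> \<le> norm ?I * (1/2)"
      using N0 by (intro mult_left_mono) (auto simp: field_simps)
    finally show False using ne by simp
  qed
qed

text \<open>The indicator function of \<open>K\<close> on \<open>P\<close> is the limit of the continuous functions \<open>max 0 (1 - k dist(\<Phi> x, \<Phi> K))\<close> of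
  \<open>\<Phi> x\<close>, because \<open>\<Phi>\<close> is injective on \<open>P\<close>.\<close>
lemma integral_vanishing_compact:
  fixes f :: "real^2 \<Rightarrow> complex"
  assumes f: "integrable M f" and coef: "\<And>h. (LINT x|M. f x * wave h x) = 0"
    and K: "compact K" "K \<subseteq> P"
  shows "(LINT x|M. f x * of_real (indicator K x)) = 0"
proof (cases "K = {}")
  case False
  define C where "C = \<Phi> ` K"
  have C: "closed C" "C \<noteq> {}"
    using K False unfolding C_def
    by (auto intro!: compact_imp_closed compact_continuous_image continuous_\<Phi>)
  define F where "F k z = max 0 (1 - real k * infdist z C)" for k z
  have Fc: "continuous_on UNIV (F k)" for k
    unfolding F_def by (intro continuous_intros)
  have F0: "0 \<le> F k z" "F k z \<le> 1" for k z
    by (auto simp: F_def infdist_nonneg)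
  have Flim: "(\<lambda>k. F k (\<Phi> x)) \<longlonglongrightarrow> indicator K x" if x: "x \<in> P" for x
  proof (cases "x \<in> K")
    case True
    then have "infdist (\<Phi> x) C = 0" by (simp add: C_def)
    then show ?thesis using True by (simp add: F_def)
  next
    case False
    have "\<Phi> x \<notin> C"
      using False inj_onD[OF inj_on_\<Phi> _ x] K by (auto simp: C_def)
    then have pos: "infdist (\<Phi> x) C > 0"
      using in_closed_iff_infdist_zero[OF C] infdist_nonneg[of "\<Phi> x" C] by fastforce
    obtain m where m: "1 / infdist (\<Phi> x) C < real m" using reals_Archimedean2 by blast
    have "F k (\<Phi> x) = 0" if "k \<ge> m" for k
    proof -
      have "1 / infdist (\<Phi> x) C \<le> real k" using m that by linarith
      then have "1 \<le> real k * infdist (\<Phi> x) C" using pos by (simp add: field_simps)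
      then show ?thesis by (simp add: F_def)
    qed
    then have "\<forall>\<^sub>F k in sequentially. F k (\<Phi> x) = 0" by (auto simp: eventually_sequentially)
    then show ?thesis using False by (simp add: tendsto_eventually)
  qed
  have FP: "continuous_on UNIV (\<lambda>x. complex_of_real (F k (\<Phi> x)))" for k
    by (intro continuous_intros continuous_on_compose2[OF Fc continuous_\<Phi>]) auto
  have "(\<lambda>k. LINT x|M. f x * of_real (F k (\<Phi> x))) \<longlonglongrightarrow> (LINT x|M. f x * of_real (indicator K x))"
  proof (rule integral_dominated_convergence[where w = "\<lambda>x. norm (f x)"])
    have "K \<in> sets borel" using K by (simp add: borel_compact)
    then have "(indicator K :: real^2 \<Rightarrow> real) \<in> borel_measurable M"
      by (intro borel_imp_M borel_measurable_indicator)
    then show "(\<lambda>x. f x * of_real (indicator K x)) \<in> borel_measurable M"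
      using f by measurable
    show "(\<lambda>x. f x * of_real (F k (\<Phi> x))) \<in> borel_measurable M" for k
      using integrable_mult_continuous[OF f FP] by (rule borel_measurable_integrable)
    show "integrable M (\<lambda>x. norm (f x))" using f by (rule integrable_norm)
    show "AE x in M. (\<lambda>k. f x * of_real (F k (\<Phi> x))) \<longlonglongrightarrow> f x * of_real (indicator K x)"
      using Flim by (intro AE_I2 tendsto_intros) simp
    show "AE x in M. norm (f x * of_real (F k (\<Phi> x))) \<le> norm (f x)" for k
    proof (rule AE_I2)
      fix x
      have "norm (complex_of_real (F k (\<Phi> x))) \<le> 1" using F0[of k "\<Phi> x"] by simp
      then show "norm (f x * of_real (F k (\<Phi> x))) \<le> norm (f x)"
        unfolding norm_mult by (rule mult_left_le[OF _ norm_ge_zero])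
    qed
  qed
  then show ?thesis
    using integral_vanishing_continuous[OF f coef Fc] by (simp add: LIMSEQ_const_iff)
qed simp

text \<open>The set where \<open>g\<close> is positive is exhausted by compact sets up to arbitrarily small measure, and each of
  them is a null set.\<close>
lemma AE_zero_if_integrals_vanish:
  fixes g :: "real^2 \<Rightarrow> real"
  assumes g: "integrable M g"
    and vanish: "\<And>K. compact K \<Longrightarrow> K \<subseteq> P \<Longrightarrow> (LINT x|M. g x * indicator K x) = 0"
  shows "AE x in M. g x \<le> 0"
proof -
  define E where "E = {x\<in>P. g x > 0}"
  have gm: "g \<in> borel_measurable M" using g by simp
  have "E \<in> sets M"
    using borel_measurable_less[OF borel_measurable_const gm, of 0] by (simp add: E_def)
  then have E: "E \<in> sets lebesgue"
    by (simp add: M_def sets_restrict_space_iff)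
  have small: "emeasure lebesgue E < ennreal \<epsilon>" if \<epsilon>: "\<epsilon> > 0" for \<epsilon>
  proof -
    obtain K where K: "closed K" "K \<subseteq> E" "emeasure lebesgue (E - K) < ennreal \<epsilon>"
      using sets_lebesgue_inner_closed[OF E \<epsilon>] by metis
    have KP: "K \<subseteq> P" using K by (auto simp: E_def)
    have cK: "compact K"
      using K(1) bounded_subset[OF bounded_P KP] by (simp add: compact_eq_bounded_closed)
    have KM: "K \<in> sets M"
      using K(1) KP by (simp add: M_def sets_restrict_space_iff)
    have "AE x in M. g x * indicator K x = 0"
    proof (subst integral_nonneg_eq_0_iff_AE[symmetric])
      show "integrable M (\<lambda>x. g x * indicator K x)"
        using integrable_real_mult_indicator[OF KM g] by (simp add: mult.commute)
      show "AE x in M. 0 \<le> g x * indicator K x"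
        using K by (intro AE_I2) (auto simp: indicator_def E_def less_imp_le)
      show "(LINT x|M. g x * indicator K x) = 0" by (rule vanish[OF cK KP])
    qed
    then have "AE x in M. x \<notin> K"
      by eventually_elim (use K in \<open>auto simp: indicator_def E_def split: if_splits\<close>)
    then have "emeasure M K = 0"
      using KM by (subst (asm) AE_iff_measurable[of K]) (use sets.sets_into_space[OF KM] in auto)
    then have K0: "emeasure lebesgue K = 0"
      using KP by (simp add: M_def emeasure_restrict_space)
    have Km: "K \<in> sets lebesgue" using K(1) by (simp add: borel_closed sets_completionI_sets)
    have un: "(E - K) \<union> K = E" using K by blast
    have "emeasure lebesgue E \<le> emeasure lebesgue (E - K) + emeasure lebesgue K"
      using emeasure_subadditive[OF sets.Diff[OF E Km] Km] unfolding un .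
    then have "emeasure lebesgue E \<le> emeasure lebesgue (E - K)"
      unfolding K0 by simp
    then show ?thesis using K(3) by simp
  qed
  have "emeasure lebesgue E \<le> 0"
  proof (rule ennreal_le_epsilon)
    fix \<epsilon> :: real assume "0 < \<epsilon>"
    then show "emeasure lebesgue E \<le> 0 + ennreal \<epsilon>"
      using small[of \<epsilon>] by simp
  qed
  then have "emeasure lebesgue E = 0" by simp
  then have "emeasure M E = 0"
    using \<open>E \<in> sets M\<close> by (simp add: M_def emeasure_restrict_space E_def)
  then show ?thesis
    using \<open>E \<in> sets M\<close> by (subst AE_iff_measurable[of E]) (auto simp: E_def not_le)
qed

text \<open>Completeness of the plane waves; the real and imaginary parts are bounded by zero from both sides.\<close>
theorem AE_zero_if_coefficients_vanish:
  fixes f :: "real^2 \<Rightarrow> complex"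
  assumes f: "integrable M f" and coef: "\<And>h. (LINT x|M. f x * wave h x) = 0"
  shows "AE x in M. f x = 0"
proof -
  have fK: "integrable M (\<lambda>x. f x * of_real (indicator K x))" if "compact K" "K \<subseteq> P" for K
  proof -
    have "K \<in> sets M"
      using that by (simp add: M_def sets_restrict_space_iff borel_compact)
    from integrable_mult_indicator[OF this f] show ?thesis
      by (simp add: scaleR_conv_of_real mult.commute)
  qed
  have re: "(LINT x|M. Re (f x) * indicator K x) = 0"
    and im: "(LINT x|M. Im (f x) * indicator K x) = 0" if K: "compact K" "K \<subseteq> P" for K
  proof -
    have eq: "Re (f x * of_real (indicator K x)) = Re (f x) * indicator K x"
      "Im (f x * of_real (indicator K x)) = Im (f x) * indicator K x" for x
      by simp_all
    show "(LINT x|M. Re (f x) * indicator K x) = 0"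
      unfolding eq[symmetric] integral_Re[OF fK[OF K]] integral_vanishing_compact[OF f coef K] by simp
    show "(LINT x|M. Im (f x) * indicator K x) = 0"
      unfolding eq[symmetric] integral_Im[OF fK[OF K]] integral_vanishing_compact[OF f coef K] by simp
  qed
  have "AE x in M. Re (f x) \<le> 0"
    by (rule AE_zero_if_integrals_vanish[OF integrable_Re[OF f] re])
  moreover have "AE x in M. - Re (f x) \<le> 0"
  proof (rule AE_zero_if_integrals_vanish)
    show "integrable M (\<lambda>x. - Re (f x))"
      by (intro Bochner_Integration.integrable_minus integrable_Re f)
    show "(LINT x|M. - Re (f x) * indicator K x) = 0" if "compact K" "K \<subseteq> P" for K
      using re[OF that] by simp
  qed
  moreover have "AE x in M. Im (f x) \<le> 0"
    by (rule AE_zero_if_integrals_vanish[OF integrable_Im[OF f] im])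
  moreover have "AE x in M. - Im (f x) \<le> 0"
  proof (rule AE_zero_if_integrals_vanish)
    show "integrable M (\<lambda>x. - Im (f x))"
      by (intro Bochner_Integration.integrable_minus integrable_Im f)
    show "(LINT x|M. - Im (f x) * indicator K x) = 0" if "compact K" "K \<subseteq> P" for K
      using im[OF that] by simp
  qed
  ultimately show ?thesis
    by eventually_elim (rule complex_eqI; simp only: zero_complex.sel; linarith)
qed

end

section \<open>Fourier coefficients of functions and distributions\<close>

lemma has_sum_minus:
  fixes f g :: "'a \<Rightarrow> 'b::real_normed_vector"
  shows "(f has_sum a) A \<Longrightarrow> (g has_sum b) A \<Longrightarrow> ((\<lambda>x. f x - g x) has_sum (a - b)) A"
  unfolding has_sum_def sum_subtractf by (rule tendsto_diff)

lemma herm_axis: "herm v (axis i 1) = v $ i"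
proof -
  have "herm v (axis i 1) = (\<Sum>j\<in>UNIV. if j = i then v $ i else 0)"
    unfolding herm_def by (intro sum.cong refl) (auto simp: axis_def)
  then show ?thesis by simp
qed

definition ccross :: "complex^3 \<Rightarrow> complex^3 \<Rightarrow> complex^3" where
  "ccross u v = vector [u $ 2 * v $ 3 - u $ 3 * v $ 2, u $ 3 * v $ 1 - u $ 1 * v $ 3, u $ 1 * v $ 2 - u $ 2 * v $ 1]"

definition cdot :: "complex^3 \<Rightarrow> complex^3 \<Rightarrow> complex" where
  "cdot u v = (\<Sum>i\<in>UNIV. u $ i * v $ i)"

context torus
begin

text \<open>Fourier coefficients without the normalising factor \<open>1 / A\<close>, where \<open>A\<close> is the area of the torus; this makes them
  values of the distribution \<open>regular a1 a2 v\<close> at plane waves.\<close>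
definition fcoeff :: "(real^2 \<Rightarrow> complex^3) \<Rightarrow> int \<times> int \<Rightarrow> complex^3" where
  "fcoeff v h = (\<chi> i. LINT x|M. v x $ i * wave (- h) x)"

definition mode :: "int \<times> int \<Rightarrow> complex^3 \<Rightarrow> real^2 \<Rightarrow> complex^3" where
  "mode h c x = wave h x *s c"

lemma continuous_L2:
  assumes v: "continuous_on UNIV v" and per: "periodic a1 a2 v"
  shows "v \<in> L2 a1 a2"
  unfolding L2_alt
proof (intro conjI per)
  show "v \<in> borel_measurable lebesgue"
    using borel_measurable_continuous_onI[OF v] by (auto intro: measurable_completion)
  show "integrable M (\<lambda>x. (norm (v x))\<^sup>2)"
    by (intro continuous_integrable_M continuous_intros v)
qed

lemma continuous_vector_scalar:
  fixes c :: "'a::topological_space \<Rightarrow> complex" and v :: "'a \<Rightarrow> complex^3"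
  shows "continuous_on S c \<Longrightarrow> continuous_on S v \<Longrightarrow> continuous_on S (\<lambda>x. c x *s v x)"
  by (rule bounded_bilinear.continuous_on[OF bounded_bilinear_vector_scalar])

lemma mode_L2 [simp]: "mode h c \<in> L2 a1 a2"
proof (rule continuous_L2)
  show "continuous_on UNIV (mode h c)"
    unfolding mode_def by (intro continuous_vector_scalar continuous_wave continuous_on_const)
  show "periodic a1 a2 (mode h c)"
    using periodic_wave[of h] by (simp add: periodic_def mode_def)
qed

lemma integrable_component:
  assumes v: "v \<in> L2 a1 a2"
  shows "integrable M (\<lambda>x. v x $ i)"
proof (rule Bochner_Integration.integrable_bound)
  show "integrable M (\<lambda>x. 1 + (norm (v x))\<^sup>2)"
    by (intro Bochner_Integration.integrable_add L2_integrable_sq v integrable_const)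
  show "(\<lambda>x. v x $ i) \<in> borel_measurable M"
    using v by (intro measurable_vec_component L2_measurable)
  show "AE x in M. norm (v x $ i) \<le> norm (1 + (norm (v x))\<^sup>2)"
  proof (rule AE_I2)
    fix x
    have "norm (v x $ i) \<le> norm (v x)" by (rule Finite_Cartesian_Product.norm_nth_le)
    also have "\<dots> \<le> 1 + (norm (v x))\<^sup>2"
      using sum_squares_bound[of 1 "norm (v x)"] norm_ge_zero[of "v x"] by (simp, linarith)
    finally show "norm (v x $ i) \<le> norm (1 + (norm (v x))\<^sup>2)" by simp
  qed
qed

lemma integrable_component_mult:
  assumes "v \<in> L2 a1 a2" "continuous_on UNIV \<phi>"
  shows "integrable M (\<lambda>x. v x $ i * \<phi> x)"
  by (intro integrable_mult_continuous integrable_component assms)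

lemma L2_inner_mode:
  assumes v: "v \<in> L2 a1 a2"
  shows "L2_inner a1 a2 v (mode h c) = herm (fcoeff v h) c"
proof -
  have "L2_inner a1 a2 v (mode h c) = (LINT x|M. (\<Sum>i\<in>UNIV. (v x $ i * wave (- h) x) * cnj (c $ i)))"
    unfolding L2_inner_herm herm_def mode_def by (simp add: cnj_wave mult_ac)
  also have "\<dots> = (\<Sum>i\<in>UNIV. LINT x|M. (v x $ i * wave (- h) x) * cnj (c $ i))"
    by (intro Bochner_Integration.integral_sum integrable_mult_left integrable_component_mult v continuous_wave)
  also have "\<dots> = herm (fcoeff v h) c"
    unfolding herm_def fcoeff_def by simp
  finally show ?thesis .
qed

lemma fcoeff_add: "u \<in> L2 a1 a2 \<Longrightarrow> v \<in> L2 a1 a2 \<Longrightarrow> fcoeff (u + v) h = fcoeff u h + fcoeff v h"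
  by (simp add: fcoeff_def vec_eq_iff algebra_simps integrable_component_mult continuous_wave)

lemma fcoeff_scale: "fcoeff (vscale c u) h = c *s fcoeff u h"
  by (simp add: fcoeff_def vec_eq_iff mult.assoc)

lemma fcoeff_diff: "u \<in> L2 a1 a2 \<Longrightarrow> v \<in> L2 a1 a2 \<Longrightarrow> fcoeff (u - v) h = fcoeff u h - fcoeff v h"
  by (simp add: fcoeff_def vec_eq_iff algebra_simps integrable_component_mult continuous_wave)

lemma fcoeff_mode: "fcoeff (mode h c) k = (if h = k then of_real A *s c else 0)"
proof -
  have "(LINT x|M. mode h c x $ i * wave (- k) x) = c $ i * (LINT x|M. wave (h - k) x)" for i
  proof -
    have "(LINT x|M. mode h c x $ i * wave (- k) x) = (LINT x|M. c $ i * wave (h - k) x)"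
      by (intro Bochner_Integration.integral_cong refl) (simp add: mode_def mult_ac flip: wave_add)
    then show ?thesis by simp
  qed
  then show ?thesis
    by (simp add: fcoeff_def vec_eq_iff integral_wave)
qed

lemma fcoeff_zero_imp_null:
  assumes v: "v \<in> L2 a1 a2" and z: "\<And>h. fcoeff v h = 0"
  shows "L2.nrm v = 0"
proof -
  have "AE x in M. v x $ i = 0" for i
  proof (rule AE_zero_if_coefficients_vanish[OF integrable_component[OF v]])
    fix h
    have "fcoeff v (- h) $ i = 0" by (simp add: z)
    then show "(LINT x|M. v x $ i * wave h x) = 0" by (simp add: fcoeff_def)
  qed
  then have "AE x in M. \<forall>i. v x $ i = 0" by (subst AE_all_countable) blast
  then have "AE x in M. v x = 0" by eventually_elim (simp add: vec_eq_iff)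
  then show ?thesis using L2_nrm_zero_iff[OF v] by simp
qed

definition unit_mode :: "(int \<times> int) \<times> 3 \<Rightarrow> real^2 \<Rightarrow> complex^3" where
  "unit_mode p = mode (fst p) (of_real (1 / sqrt A) *s axis (snd p) 1)"

lemma unit_mode_L2 [simp]: "unit_mode p \<in> L2 a1 a2"
  by (simp add: unit_mode_def)

lemma L2_inner_unit_mode:
  "v \<in> L2 a1 a2 \<Longrightarrow> L2_inner a1 a2 v (unit_mode p) = fcoeff v (fst p) $ snd p / of_real (sqrt A)"
  by (simp add: unit_mode_def L2_inner_mode herm_scale_right herm_axis)

lemma orthonormal_unit_mode: "L2.orthonormal_on UNIV unit_mode"
  unfolding L2.orthonormal_on_def
proof (intro conjI ballI)
  fix p q
  have sq: "complex_of_real A / of_real (sqrt A) / of_real (sqrt A) = 1"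
  proof -
    have "A / sqrt A / sqrt A = 1" using A_pos by simp
    then show ?thesis by (metis of_real_divide of_real_1)
  qed
  have "L2_inner a1 a2 (unit_mode p) (unit_mode q) = fcoeff (unit_mode p) (fst q) $ snd q / of_real (sqrt A)"
    by (rule L2_inner_unit_mode) simp
  also have "\<dots> = (if p = q then of_real A / of_real (sqrt A) / of_real (sqrt A) else 0)"
    by (auto simp: unit_mode_def fcoeff_mode axis_def prod_eq_iff)
  finally show "L2_inner a1 a2 (unit_mode p) (unit_mode q) = (if p = q then 1 else 0)"
    using sq by simp
qed simp

lemma total_unit_mode: "L2.total unit_mode"
  unfolding L2.total_def
proof (intro ballI impI)
  fix u assume u: "u \<in> L2 a1 a2" and z: "\<forall>p. L2_inner a1 a2 u (unit_mode p) = 0"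
  have "fcoeff u h $ i = 0" for h i
    using L2_inner_unit_mode[OF u, of "(h, i)"] A_pos unfolding spec[OF z, of "(h, i)"] by simp
  then show "L2.nrm u = 0"
    using fcoeff_zero_imp_null[OF u] by (simp add: vec_eq_iff)
qed

text \<open>Parseval's identity for the scalar modes, with the three components of each frequency collected.\<close>
lemma fourier_inner:
  assumes u: "u \<in> L2 a1 a2" and v: "v \<in> L2 a1 a2"
  shows "((\<lambda>h. herm (fcoeff u h) (fcoeff v h) / of_real A) has_sum L2_inner a1 a2 u v) UNIV"
proof (rule has_sum_SigmaD)
  show "((\<lambda>p. L2_inner a1 a2 u (unit_mode p) * cnj (L2_inner a1 a2 v (unit_mode p))) has_sum
      L2_inner a1 a2 u v) (Sigma UNIV (\<lambda>_. UNIV))"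
    using L2.Parseval[OF orthonormal_unit_mode total_unit_mode u v] by simp
  fix h
  have "complex_of_real (sqrt A) * of_real (sqrt A) = of_real A"
    using A_pos by (simp flip: of_real_mult)
  then have "L2_inner a1 a2 u (unit_mode (h, i)) * cnj (L2_inner a1 a2 v (unit_mode (h, i)))
      = fcoeff u h $ i * cnj (fcoeff v h $ i) / of_real A" for i
    by (simp add: L2_inner_unit_mode u v)
  then have "((\<lambda>i. L2_inner a1 a2 u (unit_mode (h, i)) * cnj (L2_inner a1 a2 v (unit_mode (h, i))))
      has_sum (\<Sum>i\<in>UNIV. fcoeff u h $ i * cnj (fcoeff v h $ i) / of_real A)) UNIV"
    by (simp add: has_sum_finite)
  then show "((\<lambda>i. L2_inner a1 a2 u (unit_mode (h, i)) * cnj (L2_inner a1 a2 v (unit_mode (h, i))))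
      has_sum (herm (fcoeff u h) (fcoeff v h) / of_real A)) UNIV"
    by (simp add: herm_def sum_divide_distrib)
qed

lemma fourier_nrm:
  assumes u: "u \<in> L2 a1 a2"
  shows "((\<lambda>h. (norm (fcoeff u h))\<^sup>2 / A) has_sum (L2.nrm u)\<^sup>2) UNIV"
proof -
  have "((\<lambda>h. Re (herm (fcoeff u h) (fcoeff u h) / of_real A)) has_sum Re (L2_inner a1 a2 u u)) UNIV"
    by (rule has_sum_Re[OF fourier_inner[OF u u]])
  moreover have "Re (herm (fcoeff u h) (fcoeff u h) / of_real A) = (norm (fcoeff u h))\<^sup>2 / A" for h
    unfolding herm_self by (simp flip: of_real_divide of_real_power)
  ultimately show ?thesis
    by (simp only: L2.nrm_sq[OF u])
qed

lemma fourier_summable: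
  assumes u: "u \<in> L2 a1 a2"
  shows "(\<lambda>h. (norm (fcoeff u h))\<^sup>2) summable_on UNIV"
proof -
  have "(\<lambda>h. A * ((norm (fcoeff u h))\<^sup>2 / A)) summable_on UNIV"
    using fourier_nrm[OF u] by (intro summable_on_cmult_right) (auto simp: summable_on_def)
  then show ?thesis using A_pos by simp
qed

lemma fourier_exists:
  assumes c: "(\<lambda>h. (norm (c h))\<^sup>2) summable_on UNIV"
  shows "\<exists>u\<in>L2 a1 a2. \<forall>h. fcoeff u h = c h"
proof -
  define d where "d p = c (fst p) $ snd p / of_real (sqrt A)" for p
  have "(\<lambda>p. (cmod (d p))\<^sup>2) summable_on (Sigma UNIV (\<lambda>_. UNIV))"
  proof (rule summable_on_SigmaI)
    fix h :: "int \<times> int"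
    have "(cmod (d (h, i)))\<^sup>2 = (cmod (c h $ i))\<^sup>2 / A" for i
      using A_pos by (simp add: d_def norm_divide power_divide)
    then show "((\<lambda>i. (cmod (d (h, i)))\<^sup>2) has_sum ((norm (c h))\<^sup>2 / A)) UNIV"
      unfolding norm_vec_sq sum_divide_distrib by (simp add: has_sum_finite)
    show "(\<lambda>h. (norm (c h))\<^sup>2 / A) summable_on UNIV"
      using summable_on_cmult_left[OF c, of "1 / A"] by simp
  qed auto
  then have "(\<lambda>p. (cmod (d p))\<^sup>2) summable_on UNIV" by simp
  from L2.Riesz_Fischer[OF orthonormal_unit_mode this]
  obtain u where u: "u \<in> L2 a1 a2" and ud: "\<And>p. L2_inner a1 a2 u (unit_mode p) = d p" by blast
  have "fcoeff u h $ i = c h $ i" for h i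
    using ud[of "(h, i)"] A_pos by (simp add: L2_inner_unit_mode[OF u] d_def)
  then show ?thesis using u by (auto simp: vec_eq_iff)
qed

lemma fourier_unique:
  assumes "u \<in> L2 a1 a2" "v \<in> L2 a1 a2" "\<And>h. fcoeff u h = fcoeff v h"
  shows "L2.nrm (u - v) = 0"
  using assms by (intro fcoeff_zero_imp_null L2.mem_diff) (simp_all add: fcoeff_diff)

text \<open>The Fourier coefficient of a test function at the frequency \<open>- h\<close>, which is paired with \<open>fcoeff v h\<close>.\<close>
definition test_coeff :: "(real^2 \<Rightarrow> complex) \<Rightarrow> int \<times> int \<Rightarrow> complex" where
  "test_coeff \<phi> h = (LINT x|M. \<phi> x * wave h x)"

lemma test_coeff_pdiff: "\<phi> \<in> test_fun a1 a2 \<Longrightarrow> test_coeff (pdiff j \<phi>) h = - \<i> * of_real (freq h $ j) * test_coeff \<phi> h"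
  unfolding test_coeff_def by (rule integral_pdiff_wave)

lemma test_coeff_wave: "test_coeff (wave (- k)) h = (if h = k then of_real A else 0)"
proof -
  have "test_coeff (wave (- k)) h = (LINT x|M. wave (h - k) x)"
    unfolding test_coeff_def by (simp add: mult.commute flip: wave_add)
  then show ?thesis by (simp add: integral_wave)
qed

lemma regular_component:
  assumes v: "v \<in> L2 a1 a2" and \<phi>: "continuous_on UNIV \<phi>"
  shows "regular a1 a2 v \<phi> $ i = (LINT x|M. v x $ i * \<phi> x)"
proof -
  have "integrable M (\<lambda>x. \<phi> x *s v x)"
  proof -
    have eq: "\<phi> x *s v x = (\<Sum>i\<in>UNIV. (v x $ i * \<phi> x) *s axis i 1)" for x
      by (simp add: vec_eq_iff axis_def if_distrib cong: if_cong)
    have "integrable M (\<lambda>x. (v x $ i * \<phi> x) *s (axis i 1 :: complex^3))" for i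
      by (rule integrable_bounded_linear[OF bounded_bilinear.bounded_linear_left[OF bounded_bilinear_vector_scalar]
            integrable_component_mult[OF v \<phi>]])
    then show ?thesis unfolding eq by (intro Bochner_Integration.integrable_sum)
  qed
  then have "regular a1 a2 v \<phi> $ i = (LINT x|M. (\<phi> x *s v x) $ i)"
    unfolding regular_def torus_measure_eq
    by (rule integral_bounded_linear[OF bounded_linear_vec_nth, symmetric])
  then show ?thesis by (simp add: mult.commute)
qed

text \<open>The pairing of \<open>v\<close> with \<open>\<phi>\<close> is an inner product in \<open>L2\<close>, so Parseval's identity applies.\<close>
lemma regular_has_sum:
  assumes v: "v \<in> L2 a1 a2" and \<phi>: "continuous_on UNIV \<phi>" "periodic a1 a2 \<phi>"
  shows "((\<lambda>h. test_coeff \<phi> h * fcoeff v h $ i / of_real A) has_sum regular a1 a2 v \<phi> $ i) UNIV"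
proof -
  define w :: "real^2 \<Rightarrow> complex^3" where "w = (\<lambda>x. cnj (\<phi> x) *s axis i 1)"
  have w: "w \<in> L2 a1 a2"
  proof (rule continuous_L2)
    show "continuous_on UNIV w"
      unfolding w_def by (intro continuous_vector_scalar continuous_intros \<phi>)
    show "periodic a1 a2 w" using \<phi>(2) by (simp add: periodic_def w_def)
  qed
  have inner: "L2_inner a1 a2 v w = regular a1 a2 v \<phi> $ i"
    unfolding L2_inner_herm regular_component[OF v \<phi>(1)] w_def herm_scale_right herm_axis
    by (simp add: mult.commute)
  have fcw: "fcoeff w h = cnj (test_coeff \<phi> h) *s axis i 1" for h
  proof -
    have "(LINT x|M. cnj (\<phi> x) * wave (- h) x) = cnj (test_coeff \<phi> h)"
      unfolding test_coeff_def by (simp add: cnj_wave flip: Bochner_Integration.integral_cnj)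
    then show ?thesis
      by (auto simp: fcoeff_def w_def vec_eq_iff axis_def)
  qed
  have "herm (fcoeff v h) (fcoeff w h) = test_coeff \<phi> h * fcoeff v h $ i" for h
    unfolding fcw herm_scale_right herm_axis by simp
  then show ?thesis
    using fourier_inner[OF v w] unfolding inner by simp
qed

lemma regular_test_has_sum:
  assumes v: "v \<in> L2 a1 a2" and \<phi>: "\<phi> \<in> test_fun a1 a2"
  shows "((\<lambda>h. test_coeff \<phi> h * fcoeff v h $ i / of_real A) has_sum regular a1 a2 v \<phi> $ i) UNIV"
  using \<phi> by (intro regular_has_sum v test_fun_continuous) (auto simp: test_fun_def)

lemma periodic_pdiff:
  assumes \<phi>: "\<phi> \<in> test_fun a1 a2"
  shows "periodic a1 a2 (pdiff j \<phi>)"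
  unfolding periodic_def
proof (intro allI ballI)
  fix x k assume k: "k \<in> period_lattice a1 a2"
  have sh: "\<phi> (y + k) = \<phi> y" for y using \<phi> k by (simp add: test_fun_def periodic_def)
  define D where "D y = frechet_derivative \<phi> (at y)" for y
  have D: "(\<phi> has_derivative D y) (at y)" for y
    unfolding D_def using test_fun_differentiable[OF \<phi>] frechet_derivative_works by blast
  have "((\<lambda>y. \<phi> (y + k)) has_derivative D (x + k)) (at x)"
    by (rule has_derivative_compose[OF _ D, of "\<lambda>y. y + k" "\<lambda>y. y", simplified])
       (auto intro!: derivative_eq_intros)
  then have "(\<phi> has_derivative D (x + k)) (at x)" by (simp only: sh)
  then have "D (x + k) = D x" using D has_derivative_unique by blast
  then show "pdiff j \<phi> (x + k) = pdiff j \<phi> x" by (simp add: pdiff_def D_def)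
qed

lemma dist_pdiff_has_sum:
  assumes v: "v \<in> L2 a1 a2" and \<phi>: "\<phi> \<in> test_fun a1 a2"
  shows "((\<lambda>h. test_coeff \<phi> h * (\<i> * of_real (freq h $ j) * fcoeff v h $ i) / of_real A) has_sum
    dist_pdiff j (regular a1 a2 v) \<phi> $ i) UNIV"
proof -
  have "((\<lambda>h. (- 1) * (test_coeff (pdiff j \<phi>) h * fcoeff v h $ i / of_real A)) has_sum
      (- 1) * regular a1 a2 v (pdiff j \<phi>) $ i) UNIV"
    by (intro has_sum_cmult_right regular_has_sum v test_fun_continuous_pdiff[OF \<phi>] periodic_pdiff[OF \<phi>])
  then show ?thesis
    by (simp add: test_coeff_pdiff[OF \<phi>] dist_pdiff_def mult_ac)
qed

text \<open>The symbol of \<open>\<nabla>\<close> is \<open>\<i>\<zeta>\<close>, where \<open>\<zeta>\<close> is a real vector.\<close>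

definition zeta :: "real^2 \<Rightarrow> real \<Rightarrow> int \<times> int \<Rightarrow> complex^3" where
  "zeta \<xi> \<beta> h = vector [of_real (freq h $ 1 + \<xi> $ 1), of_real (freq h $ 2 + \<xi> $ 2), of_real \<beta>]"

lemma zeta_nth [simp]:
  "zeta \<xi> \<beta> h $ 1 = of_real (freq h $ 1 + \<xi> $ 1)" "zeta \<xi> \<beta> h $ 2 = of_real (freq h $ 2 + \<xi> $ 2)"
  "zeta \<xi> \<beta> h $ 3 = of_real \<beta>"
  by (simp_all add: zeta_def)

lemma nabla_has_sum:
  assumes v: "v \<in> L2 a1 a2" and \<phi>: "\<phi> \<in> test_fun a1 a2"
  shows "((\<lambda>h. test_coeff \<phi> h * (\<i> * zeta \<xi> \<beta> h $ k * fcoeff v h $ i) / of_real A) has_sum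
    nabla \<xi> \<beta> k (regular a1 a2 v) \<phi> $ i) UNIV"
proof -
  note reg = has_sum_cmult_right[OF regular_test_has_sum[OF v \<phi>, of i]]
  note pd = dist_pdiff_has_sum[OF v \<phi>, of _ i]
  consider "k = 1" | "k = 2" | "k = 3" using exhaust_3 by blast
  then show ?thesis
  proof cases
    case 1
    show ?thesis
      using has_sum_add[OF pd[of 1] reg[of "\<i> * of_real (\<xi> $ 1)"]] 1
      by (simp add: nabla_def algebra_simps add_divide_distrib)
  next
    case 2
    show ?thesis
      using has_sum_add[OF pd[of 2] reg[of "\<i> * of_real (\<xi> $ 2)"]] 2
      by (simp add: nabla_def algebra_simps add_divide_distrib)
  next
    case 3
    show ?thesis
      using reg[of "\<i> * of_real \<beta>"] 3
      by (simp add: nabla_def algebra_simps)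
  qed
qed

lemma dist_curl_has_sum:
  assumes v: "v \<in> L2 a1 a2" and \<phi>: "\<phi> \<in> test_fun a1 a2"
  shows "((\<lambda>h. test_coeff \<phi> h * (\<i> *s ccross (zeta \<xi> \<beta> h) (fcoeff v h)) $ i / of_real A) has_sum
    dist_curl \<xi> \<beta> (regular a1 a2 v) \<phi> $ i) UNIV"
proof -
  note N = nabla_has_sum[OF v \<phi>, of \<xi> \<beta>]
  consider "i = 1" | "i = 2" | "i = 3" using exhaust_3 by blast
  then show ?thesis
  proof cases
    case 1
    show ?thesis
      using has_sum_minus[OF N[of 2 3] N[of 3 2]] 1
      by (simp add: dist_curl_def ccross_def right_diff_distrib diff_divide_distrib mult_ac del: zeta_nth)
  next
    case 2
    show ?thesis
      using has_sum_minus[OF N[of 3 1] N[of 1 3]] 2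
      by (simp add: dist_curl_def ccross_def right_diff_distrib diff_divide_distrib mult_ac del: zeta_nth)
  next
    case 3
    show ?thesis
      using has_sum_minus[OF N[of 1 2] N[of 2 1]] 3
      by (simp add: dist_curl_def ccross_def right_diff_distrib diff_divide_distrib mult_ac del: zeta_nth)
  qed
qed

lemma dist_div_has_sum:
  assumes v: "v \<in> L2 a1 a2" and \<phi>: "\<phi> \<in> test_fun a1 a2"
  shows "((\<lambda>h. test_coeff \<phi> h * (\<i> * cdot (zeta \<xi> \<beta> h) (fcoeff v h)) / of_real A) has_sum
    dist_div \<xi> \<beta> (regular a1 a2 v) \<phi>) UNIV"
proof -
  note N = nabla_has_sum[OF v \<phi>, of \<xi> \<beta>]
  have "((\<lambda>h. \<Sum>k\<in>UNIV. test_coeff \<phi> h * (\<i> * zeta \<xi> \<beta> h $ k * fcoeff v h $ k) / of_real A) has_sum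
      dist_div \<xi> \<beta> (regular a1 a2 v) \<phi>) UNIV"
    unfolding dist_div_def sum_3 by (intro has_sum_add N)
  then show ?thesis
    by (simp add: cdot_def sum_distrib_left sum_divide_distrib mult.assoc del: zeta_nth)
qed

lemma test_coeff_wave_has_sum:
  assumes "((\<lambda>h. test_coeff (wave (- k)) h * g h / of_real A) has_sum S) UNIV"
  shows "S = g k"
proof (rule has_sum_unique[OF assms])
  show "((\<lambda>h. test_coeff (wave (- k)) h * g h / of_real A) has_sum g k) UNIV"
    by (rule has_sum_finite_neutralI[of "{k}"]) (use A_pos in \<open>auto simp: test_coeff_wave\<close>)
qed

text \<open>A distribution given by Fourier multipliers is represented by \<open>w\<close> iff the coefficients match: testing with plane
  waves isolates each coefficient, and the series determine the values at all test functions.\<close>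
lemma represents_iff:
  assumes T: "\<And>\<phi> i. \<phi> \<in> test_fun a1 a2 \<Longrightarrow> ((\<lambda>h. test_coeff \<phi> h * g h $ i / of_real A) has_sum T \<phi> $ i) UNIV"
  shows "represents_L2 a1 a2 T w \<longleftrightarrow> w \<in> L2 a1 a2 \<and> (\<forall>h. fcoeff w h = g h)"
proof (intro iffI conjI allI)
  assume R: "represents_L2 a1 a2 T w"
  then show w: "w \<in> L2 a1 a2" by (simp add: represents_L2_def)
  fix h
  have "fcoeff w h $ i = g h $ i" for i
  proof -
    have "T (wave (- h)) $ i = g h $ i"
      by (rule test_coeff_wave_has_sum[OF T[OF test_fun_wave]])
    moreover have "regular a1 a2 w (wave (- h)) $ i = fcoeff w h $ i"
      by (rule test_coeff_wave_has_sum[OF regular_test_has_sum[OF w test_fun_wave]])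
    ultimately show ?thesis
      using R test_fun_wave[of "- h"] by (simp add: represents_L2_def)
  qed
  then show "fcoeff w h = g h" by (simp add: vec_eq_iff)
next
  assume W: "w \<in> L2 a1 a2 \<and> (\<forall>h. fcoeff w h = g h)"
  have "T \<phi> = regular a1 a2 w \<phi>" if \<phi>: "\<phi> \<in> test_fun a1 a2" for \<phi>
  proof -
    have "T \<phi> $ i = regular a1 a2 w \<phi> $ i" for i
      using has_sum_unique[OF T[OF \<phi>, of i]] regular_test_has_sum[OF _ \<phi>, of w i] W by simp
    then show ?thesis by (simp add: vec_eq_iff)
  qed
  then show "represents_L2 a1 a2 T w" using W by (simp add: represents_L2_def)
qed

lemma represents_curl_iff:
  assumes "v \<in> L2 a1 a2"
  shows "represents_L2 a1 a2 (dist_curl \<xi> \<beta> (regular a1 a2 v)) w \<longleftrightarrow>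
    w \<in> L2 a1 a2 \<and> (\<forall>h. fcoeff w h = \<i> *s ccross (zeta \<xi> \<beta> h) (fcoeff v h))"
  by (rule represents_iff[OF dist_curl_has_sum[OF assms]])

lemma represents_pdiff_iff:
  assumes "v \<in> L2 a1 a2"
  shows "represents_L2 a1 a2 (dist_pdiff j (regular a1 a2 v)) w \<longleftrightarrow>
    w \<in> L2 a1 a2 \<and> (\<forall>h. fcoeff w h = (\<i> * of_real (freq h $ j)) *s fcoeff v h)"
  by (rule represents_iff) (use dist_pdiff_has_sum[OF assms] in simp)

lemma dist_div_zero_iff:
  assumes v: "v \<in> L2 a1 a2"
  shows "(\<forall>\<phi>\<in>test_fun a1 a2. dist_div \<xi> \<beta> (regular a1 a2 v) \<phi> = 0) \<longleftrightarrow>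
    (\<forall>h. cdot (zeta \<xi> \<beta> h) (fcoeff v h) = 0)"
proof (intro iffI allI ballI)
  fix h assume z: "\<forall>\<phi>\<in>test_fun a1 a2. dist_div \<xi> \<beta> (regular a1 a2 v) \<phi> = 0"
  have "\<i> * cdot (zeta \<xi> \<beta> h) (fcoeff v h) = 0"
    using test_coeff_wave_has_sum[OF dist_div_has_sum[OF v test_fun_wave[of "- h"], of \<xi> \<beta>]]
      bspec[OF z test_fun_wave[of "- h"]] by simp
  then show "cdot (zeta \<xi> \<beta> h) (fcoeff v h) = 0" by simp
next
  fix \<phi> assume z: "\<forall>h. cdot (zeta \<xi> \<beta> h) (fcoeff v h) = 0" and \<phi>: "\<phi> \<in> test_fun a1 a2"
  have "((\<lambda>h :: int \<times> int. 0) has_sum dist_div \<xi> \<beta> (regular a1 a2 v) \<phi>) UNIV"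
    using dist_div_has_sum[OF v \<phi>, of \<xi> \<beta>] unfolding spec[OF z] by simp
  then show "dist_div \<xi> \<beta> (regular a1 a2 v) \<phi> = 0"
    using has_sum_unique[OF _ has_sum_0_simp] by blast
qed

end

section \<open>The curl form on the Fourier side\<close>

lemma cdot_ccross: "cdot z (ccross z v) = 0"
  by (simp add: cdot_def ccross_def sum_3 algebra_simps)

lemma cdot_add: "cdot z (u + v) = cdot z u + cdot z v"
  and cdot_diff: "cdot z (u - v) = cdot z u - cdot z v"
  and cdot_scale: "cdot z (c *s v) = c * cdot z v"
  and cdot_zero: "cdot z 0 = 0"
  by (simp_all add: cdot_def sum_3 algebra_simps)

lemma ccross_add: "ccross z (u + v) = ccross z u + ccross z v"
  and ccross_diff: "ccross z (u - v) = ccross z u - ccross z v"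
  and ccross_scale: "ccross z (c *s v) = c *s ccross z v"
  by (simp_all add: ccross_def vec_eq_iff forall_3 algebra_simps)

text \<open>Lagrange's identity \<open>\<bar>z \<times> v\<bar>\<^sup>2 + \<bar>z \<bullet> v\<bar>\<^sup>2 = \<bar>z\<bar>\<^sup>2\<bar>v\<bar>\<^sup>2\<close> for real \<open>z\<close>.\<close>
lemma norm_ccross:
  assumes z: "\<And>i. cnj (z $ i) = z $ i" and v: "cdot z v = 0"
  shows "(norm (ccross z v))\<^sup>2 = (norm z)\<^sup>2 * (norm v)\<^sup>2"
proof -
  have Im: "Im (z $ i) = 0" for i
    using z[of i] by (simp add: complex_eq_iff)
  have "(norm (ccross z v))\<^sup>2 + (cmod (cdot z v))\<^sup>2 = (norm z)\<^sup>2 * (norm v)\<^sup>2"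
    unfolding norm_vec_sq sum_3 cdot_def ccross_def cmod_power2
    by (simp add: Im power2_eq_square algebra_simps)
  then show ?thesis using v by simp
qed

text \<open>The curl symbol is Hermitian.\<close>
lemma herm_ccross:
  assumes z: "\<And>i. cnj (z $ i) = z $ i"
  shows "herm u (\<i> *s ccross z v) = herm (\<i> *s ccross z u) v"
  unfolding herm_def sum_3 ccross_def by (simp add: z algebra_simps)

lemma exists_transversal: "\<exists>c. cdot z c = 0 \<and> c \<noteq> 0"
proof (cases "z $ 1 = 0 \<and> z $ 2 = 0")
  case True
  then show ?thesis
    by (intro exI[of _ "axis 1 1"]) (auto simp: cdot_def sum_3 axis_def vec_eq_iff)
next
  case False
  then show ?thesis
    by (intro exI[of _ "vector [z $ 2, - (z $ 1), 0]"]) (auto simp: cdot_def sum_3 vec_eq_iff forall_3)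
qed

lemma herm_eqI: "(\<And>c. herm u c = herm v c) \<Longrightarrow> u = v"
  by (metis herm_axis vec_eq_iff)

text \<open>The bound \<open>N\<close> makes the form coercive with respect to the curl, the bound \<open>C\<close> makes it continuous. In the final
  theorem \<open>N\<close> is the essential supremum of \<open>n\<close> on the torus.\<close>
locale medium = torus a1 a2 for a1 a2 +
  fixes n :: "real^2 \<Rightarrow> real" and \<xi> :: "real^2" and \<beta> N C :: real
  assumes n_pos: "n x > 0"
    and n_measurable: "n \<in> borel_measurable lebesgue"
    and n_periodic: "periodic a1 a2 n"
    and N: "AE x in M. n x \<le> N" "N > 0"
    and C: "AE x in M. 1 / (n x)\<^sup>2 \<le> C" "C > 0"
begin

abbreviation Z :: "int \<times> int \<Rightarrow> complex^3" where "Z \<equiv> zeta \<xi> \<beta>"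
abbreviation H :: "(real^2 \<Rightarrow> complex^3) set" where "H \<equiv> div_free a1 a2 \<xi> \<beta>"
abbreviation V :: "(real^2 \<Rightarrow> complex^3) set" where "V \<equiv> form_domain a1 a2 \<xi> \<beta>"
abbreviation Curl :: "(real^2 \<Rightarrow> complex^3) \<Rightarrow> real^2 \<Rightarrow> complex^3" where "Curl \<equiv> curl a1 a2 \<xi> \<beta>"
abbreviation form :: "(real^2 \<Rightarrow> complex^3) \<Rightarrow> (real^2 \<Rightarrow> complex^3) \<Rightarrow> complex" where
  "form \<equiv> curl_form a1 a2 n \<xi> \<beta>"

lemma Z_real: "cnj (Z h $ i) = Z h $ i"
  using exhaust_3[of i] by auto

lemma norm_Z_sq: "(norm (Z h))\<^sup>2 = (norm (freq h + \<xi>))\<^sup>2 + \<beta>\<^sup>2"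
proof -
  have "(norm (freq h + \<xi>))\<^sup>2 = (freq h $ 1 + \<xi> $ 1)\<^sup>2 + (freq h $ 2 + \<xi> $ 2)\<^sup>2"
    unfolding power2_norm_eq_inner by (simp add: inner_vec_def sum_2 power2_eq_square)
  then show ?thesis
    unfolding norm_vec_sq sum_3 zeta_nth norm_of_real by simp
qed

lemma H_iff: "v \<in> H \<longleftrightarrow> v \<in> L2 a1 a2 \<and> (\<forall>h. cdot (Z h) (fcoeff v h) = 0)"
  unfolding div_free_def using dist_div_zero_iff[of v \<xi> \<beta>] by auto

lemma V_iff: "v \<in> V \<longleftrightarrow> v \<in> H \<and> (\<exists>w\<in>L2 a1 a2. \<forall>h. fcoeff w h = \<i> *s ccross (Z h) (fcoeff v h))"
  unfolding form_domain_def div_free_def dist_in_L2_def using represents_curl_iff[of v \<xi> \<beta>] by auto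

lemma H_I: "v \<in> L2 a1 a2 \<Longrightarrow> (\<And>h. cdot (Z h) (fcoeff v h) = 0) \<Longrightarrow> v \<in> H"
  unfolding H_iff by blast

lemma H_L2 [simp]: "v \<in> H \<Longrightarrow> v \<in> L2 a1 a2"
  unfolding H_iff by blast

lemma V_I: "v \<in> H \<Longrightarrow> w \<in> L2 a1 a2 \<Longrightarrow> (\<And>h. fcoeff w h = \<i> *s ccross (Z h) (fcoeff v h)) \<Longrightarrow> v \<in> V"
  unfolding V_iff by blast

lemma V_H: "v \<in> V \<Longrightarrow> v \<in> H"
  unfolding V_iff by blast

lemma V_L2 [simp]: "v \<in> V \<Longrightarrow> v \<in> L2 a1 a2"
  by (rule H_L2[OF V_H])

lemma H_div: "v \<in> H \<Longrightarrow> cdot (Z h) (fcoeff v h) = 0"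
  unfolding H_iff by blast

lemma Curl_represents:
  assumes "v \<in> V"
  shows "Curl v \<in> L2 a1 a2 \<and> (\<forall>h. fcoeff (Curl v) h = \<i> *s ccross (Z h) (fcoeff v h))"
proof -
  have "\<exists>w. represents_L2 a1 a2 (dist_curl \<xi> \<beta> (regular a1 a2 v)) w"
    using assms unfolding form_domain_def dist_in_L2_def by blast
  then have "represents_L2 a1 a2 (dist_curl \<xi> \<beta> (regular a1 a2 v)) (Curl v)"
    unfolding curl_def L2_fun_def by (rule someI_ex)
  then show ?thesis
    using represents_curl_iff[OF V_L2[OF assms]] by blast
qed

lemma Curl_L2 [simp]: "v \<in> V \<Longrightarrow> Curl v \<in> L2 a1 a2"
  and fcoeff_Curl: "v \<in> V \<Longrightarrow> fcoeff (Curl v) h = \<i> *s ccross (Z h) (fcoeff v h)"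
  using Curl_represents by blast+

lemma norm_fcoeff_Curl: "v \<in> V \<Longrightarrow> (norm (fcoeff (Curl v) h))\<^sup>2 = (norm (Z h))\<^sup>2 * (norm (fcoeff v h))\<^sup>2"
  using norm_ccross[OF Z_real H_div[OF V_H]] by (simp add: fcoeff_Curl norm_vector_scalar)

lemma H_add: "u \<in> H \<Longrightarrow> v \<in> H \<Longrightarrow> u + v \<in> H"
  and H_scale: "u \<in> H \<Longrightarrow> vscale c u \<in> H"
  by (auto intro!: H_I simp: fcoeff_add fcoeff_scale cdot_add cdot_scale L2_add L2_scale H_div)

lemma fcoeff_0: "fcoeff 0 h = 0"
  by (simp add: fcoeff_def vec_eq_iff)

lemma H_subspace: "VS.subspace H"
proof -
  have "0 \<in> H" by (intro H_I L2_zero) (simp add: fcoeff_0 cdot_zero)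
  then show ?thesis unfolding VS.subspace_def by (intro conjI ballI allI H_add H_scale)
qed

lemma V_add: "u \<in> V \<Longrightarrow> v \<in> V \<Longrightarrow> u + v \<in> V"
  by (rule V_I[of _ "Curl u + Curl v"])
     (simp_all add: H_add V_H L2_add fcoeff_add fcoeff_Curl ccross_add vec_eq_iff algebra_simps)

lemma V_scale: "u \<in> V \<Longrightarrow> vscale c u \<in> V"
  by (rule V_I[of _ "vscale c (Curl u)"])
     (simp_all add: H_scale V_H L2_scale fcoeff_scale fcoeff_Curl ccross_scale vec_eq_iff algebra_simps)

lemma V_zero: "0 \<in> V"
  by (rule V_I[of _ 0], rule H_I)
     (simp_all add: L2_zero fcoeff_0 cdot_zero ccross_def vec_eq_iff forall_3)

lemma V_subspace: "VS.subspace V"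
  unfolding VS.subspace_def by (intro conjI ballI allI V_add V_scale V_zero)

lemma V_diff: "u \<in> V \<Longrightarrow> v \<in> V \<Longrightarrow> u - v \<in> V"
  by (rule VS.subspace_diff[OF V_subspace])

text \<open>The function \<open>Curl v\<close> is a choice of representative, so it is additive only up to null functions.\<close>
lemma Curl_add: "u \<in> V \<Longrightarrow> v \<in> V \<Longrightarrow> L2.nrm (Curl (u + v) - (Curl u + Curl v)) = 0"
  by (rule fourier_unique) (simp_all add: V_add L2_add fcoeff_add fcoeff_Curl ccross_add vec_eq_iff algebra_simps)

lemma Curl_diff: "u \<in> V \<Longrightarrow> v \<in> V \<Longrightarrow> L2.nrm (Curl (u - v) - (Curl u - Curl v)) = 0"
  by (rule fourier_unique) (simp_all add: V_diff fcoeff_diff fcoeff_Curl ccross_diff vec_eq_iff algebra_simps)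

lemma Curl_scale: "u \<in> V \<Longrightarrow> L2.nrm (Curl (vscale c u) - vscale c (Curl u)) = 0"
  by (rule fourier_unique) (simp_all add: V_scale L2_scale fcoeff_scale fcoeff_Curl ccross_scale vec_eq_iff algebra_simps)

definition weigh :: "(real^2 \<Rightarrow> complex^3) \<Rightarrow> real^2 \<Rightarrow> complex^3" where
  "weigh w = (\<lambda>x. (1 / (n x)\<^sup>2) *\<^sub>R w x)"

lemma weigh_L2:
  assumes w: "w \<in> L2 a1 a2"
  shows "weigh w \<in> L2 a1 a2"
  unfolding L2_alt
proof (intro conjI)
  have wl: "w \<in> borel_measurable lebesgue" and wp: "periodic a1 a2 w"
    using w by (simp_all add: L2_alt)
  show m: "weigh w \<in> borel_measurable lebesgue"
    unfolding weigh_def using wl n_measurable by measurable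
  show "periodic a1 a2 (weigh w)"
    using wp n_periodic by (simp add: periodic_def weigh_def)
  show "integrable M (\<lambda>x. (norm (weigh w x))\<^sup>2)"
  proof (rule Bochner_Integration.integrable_bound)
    show "integrable M (\<lambda>x. C\<^sup>2 * (norm (w x))\<^sup>2)"
      by (intro integrable_mult_right L2_integrable_sq w)
    show "(\<lambda>x. (norm (weigh w x))\<^sup>2) \<in> borel_measurable M"
      using measurable_M[OF m] by measurable
    show "AE x in M. norm ((norm (weigh w x))\<^sup>2) \<le> norm (C\<^sup>2 * (norm (w x))\<^sup>2)"
      using C(1)
    proof eventually_elim
      case (elim x)
      have "norm (weigh w x) \<le> C * norm (w x)"
        unfolding weigh_def norm_scaleR using elim by (intro mult_right_mono) auto
      then have "(norm (weigh w x))\<^sup>2 \<le> (C * norm (w x))\<^sup>2" by (intro power_mono) auto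
      then show ?case by (simp add: power_mult_distrib)
    qed
  qed
qed

lemma form_eq: "form u v = L2_inner a1 a2 (weigh (Curl u)) (Curl v)"
  unfolding curl_form_def L2_inner_herm torus_measure_eq weigh_def herm_def
  by (simp add: sum_distrib_left scaleR_conv_of_real[where 'a = complex] mult.assoc)

lemma weigh_symmetric: "L2_inner a1 a2 (weigh u) v = L2_inner a1 a2 u (weigh v)"
  unfolding L2_inner_herm weigh_def herm_def
  by (simp add: scaleR_conv_of_real[where 'a = complex] mult_ac)

lemma form_eq': "form u v = L2_inner a1 a2 (Curl u) (weigh (Curl v))"
  unfolding form_eq weigh_symmetric ..

lemma ip_cong_null_left:
  assumes "u \<in> L2 a1 a2" "u' \<in> L2 a1 a2" "w \<in> L2 a1 a2" "L2.nrm (u - u') = 0"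
  shows "L2_inner a1 a2 u w = L2_inner a1 a2 u' w"
  using L2.ip_null_left[OF L2.mem_diff[OF assms(1,2)] assms(3,4)] L2.ip_diff_left[OF assms(1-3)] by simp

lemma Re_inner_weigh:
  "Re (L2_inner a1 a2 w (weigh w)) = (LINT x|M. (norm (w x))\<^sup>2 / (n x)\<^sup>2)"
proof -
  have "herm (w x) (weigh w x) = of_real ((norm (w x))\<^sup>2 / (n x)\<^sup>2)" for x
  proof -
    have "weigh w x = of_real (1 / (n x)\<^sup>2) *s w x"
      by (simp add: weigh_def vec_eq_iff scaleR_conv_of_real[where 'a = complex])
    then have "herm (w x) (weigh w x) = of_real (1 / (n x)\<^sup>2) * herm (w x) (w x)"
      by (simp only: herm_scale_right complex_cnj_complex_of_real)
    then show ?thesis unfolding herm_self of_real_mult[symmetric] by simp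
  qed
  then show ?thesis unfolding L2_inner_herm by (simp only: integral_complex_of_real Re_complex_of_real)
qed

lemma integrable_weighted:
  assumes w: "w \<in> L2 a1 a2"
  shows "integrable M (\<lambda>x. (norm (w x))\<^sup>2 / (n x)\<^sup>2)"
proof (rule Bochner_Integration.integrable_bound)
  show "integrable M (\<lambda>x. C * (norm (w x))\<^sup>2)"
    by (intro integrable_mult_right L2_integrable_sq w)
  show "(\<lambda>x. (norm (w x))\<^sup>2 / (n x)\<^sup>2) \<in> borel_measurable M"
    using L2_measurable[OF w] measurable_M[OF n_measurable] by measurable
  show "AE x in M. norm ((norm (w x))\<^sup>2 / (n x)\<^sup>2) \<le> norm (C * (norm (w x))\<^sup>2)"
    using C(1)
  proof eventually_elim
    case (elim x)
    have "(norm (w x))\<^sup>2 * (1 / (n x)\<^sup>2) \<le> (norm (w x))\<^sup>2 * C"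
      using elim by (intro mult_left_mono) auto
    then show ?case using C(2) by (simp add: mult.commute)
  qed
qed

lemma weighted_upper:
  assumes w: "w \<in> L2 a1 a2"
  shows "Re (L2_inner a1 a2 w (weigh w)) \<le> C * (L2.nrm w)\<^sup>2"
proof -
  have "(LINT x|M. (norm (w x))\<^sup>2 / (n x)\<^sup>2) \<le> (LINT x|M. C * (norm (w x))\<^sup>2)"
  proof (rule integral_mono_AE)
    show "AE x in M. (norm (w x))\<^sup>2 / (n x)\<^sup>2 \<le> C * (norm (w x))\<^sup>2"
      using C(1)
    proof eventually_elim
      case (elim x)
      have "(norm (w x))\<^sup>2 * (1 / (n x)\<^sup>2) \<le> (norm (w x))\<^sup>2 * C"
        using elim by (intro mult_left_mono) auto
      then show ?case by (simp add: mult.commute)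
    qed
  qed (intro integrable_weighted integrable_mult_right L2_integrable_sq w)+
  then show ?thesis by (simp add: Re_inner_weigh L2_nrm_sq)
qed

lemma weighted_lower:
  assumes w: "w \<in> L2 a1 a2"
  shows "(L2.nrm w)\<^sup>2 \<le> N\<^sup>2 * Re (L2_inner a1 a2 w (weigh w))"
proof -
  have "(LINT x|M. (norm (w x))\<^sup>2) \<le> (LINT x|M. N\<^sup>2 * ((norm (w x))\<^sup>2 / (n x)\<^sup>2))"
  proof (rule integral_mono_AE)
    show "AE x in M. (norm (w x))\<^sup>2 \<le> N\<^sup>2 * ((norm (w x))\<^sup>2 / (n x)\<^sup>2)"
      using N(1)
    proof eventually_elim
      case (elim x)
      have "(n x)\<^sup>2 \<le> N\<^sup>2" using elim n_pos[of x] by (intro power_mono) auto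
      then have "(norm (w x))\<^sup>2 * (n x)\<^sup>2 \<le> (norm (w x))\<^sup>2 * N\<^sup>2" by (intro mult_left_mono) auto
      then show ?case using n_pos[of x] by (simp add: field_simps)
    qed
  qed (intro integrable_weighted integrable_mult_right L2_integrable_sq w)+
  then show ?thesis unfolding Re_inner_weigh L2_nrm_sq integral_mult_right_zero .
qed

sublocale Hs: semi_inner_space vscale H "L2_inner a1 a2"
  by unfold_locales
     (rule H_subspace L2.ip_add_left L2.ip_scale_left L2.ip_commute L2.ip_nonneg; (erule H_L2)?)+

sublocale Fm: semi_inner_space vscale V form
proof unfold_locales
  show "VS.subspace V" by (rule V_subspace)
next
  fix u v w assume u: "u \<in> V" and v: "v \<in> V" and w: "w \<in> V"
  have "form (u + v) w = L2_inner a1 a2 (Curl u + Curl v) (weigh (Curl w))"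
    unfolding form_eq' by (rule ip_cong_null_left) (use u v w Curl_add in \<open>simp_all add: V_add L2_add weigh_L2\<close>)
  then show "form (u + v) w = form u w + form v w"
    using u v w by (simp add: form_eq' L2.ip_add_left weigh_L2)
next
  fix u w c assume u: "u \<in> V" and w: "w \<in> V"
  have "form (vscale c u) w = L2_inner a1 a2 (vscale c (Curl u)) (weigh (Curl w))"
    unfolding form_eq' by (rule ip_cong_null_left) (use u w Curl_scale in \<open>simp_all add: V_scale L2_scale weigh_L2\<close>)
  then show "form (vscale c u) w = c * form u w"
    using u w by (simp add: form_eq' L2.ip_scale_left weigh_L2)
next
  fix u v assume u: "u \<in> V" and v: "v \<in> V"
  show "form v u = cnj (form u v)"
    unfolding form_eq[of v u] form_eq'[of u v] by (rule L2.ip_commute) (use u v weigh_L2 in auto)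
next
  fix u assume "u \<in> V"
  show "0 \<le> Re (form u u)"
    unfolding form_eq' Re_inner_weigh by simp
qed

lemma form_nrm_upper: "v \<in> V \<Longrightarrow> (Fm.nrm v)\<^sup>2 \<le> C * (L2.nrm (Curl v))\<^sup>2"
  unfolding Fm.nrm_sq form_eq' by (intro weighted_upper) simp

lemma form_nrm_lower: "v \<in> V \<Longrightarrow> (L2.nrm (Curl v))\<^sup>2 \<le> N\<^sup>2 * (Fm.nrm v)\<^sup>2"
  unfolding Fm.nrm_sq form_eq' by (intro weighted_lower) simp

lemma fcoeff_tendsto_closed:
  assumes x: "\<And>j. x j \<in> L2 a1 a2" and u: "u \<in> L2 a1 a2" and lim: "(\<lambda>j. L2.nrm (x j - u)) \<longlonglongrightarrow> 0"
  shows "(\<lambda>j. herm (fcoeff (x j) h) c) \<longlonglongrightarrow> herm (fcoeff u h) c"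
  using L2.tendsto_ip_left[OF x u mode_L2 lim, of h c] by (simp add: L2_inner_mode x u)

lemma cdot_herm: "cdot (Z h) v = herm v (Z h)"
  by (simp add: cdot_def herm_def Z_real mult.commute)

sublocale Hs: semi_hilbert vscale H "L2_inner a1 a2"
proof unfold_locales
  fix x assume x: "\<And>j::nat. x j \<in> H" and cau: "Hs.nrm_Cauchy x"
  obtain u where u: "u \<in> L2 a1 a2" and lim: "(\<lambda>j. L2.nrm (x j - u)) \<longlonglongrightarrow> 0"
    using L2.complete[OF _ cau] x by auto
  have "cdot (Z h) (fcoeff u h) = 0" for h
  proof (rule LIMSEQ_unique)
    show "(\<lambda>j. herm (fcoeff (x j) h) (Z h)) \<longlonglongrightarrow> cdot (Z h) (fcoeff u h)"
      unfolding cdot_herm by (rule fcoeff_tendsto_closed[OF _ u lim]) (use x in simp)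
    show "(\<lambda>j. herm (fcoeff (x j) h) (Z h)) \<longlonglongrightarrow> 0"
      using H_div[OF x] by (simp add: cdot_herm)
  qed
  then have "u \<in> H" using u by (intro H_I)
  then show "\<exists>u\<in>H. (\<lambda>j. L2.nrm (x j - u)) \<longlonglongrightarrow> 0" using lim by blast
qed

lemma mode_V:
  assumes "cdot (Z h) c = 0"
  shows "mode h c \<in> V"
proof (rule V_I)
  show "mode h c \<in> H" using assms by (intro H_I) (auto simp: fcoeff_mode cdot_scale cdot_zero)
  fix k
  have "ccross (Z k) 0 = 0" by (simp add: ccross_def vec_eq_iff forall_3)
  then show "fcoeff (mode h (\<i> *s ccross (Z h) c)) k = \<i> *s ccross (Z k) (fcoeff (mode h c) k)"
    by (auto simp: fcoeff_mode ccross_scale vec_eq_iff)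
qed simp

lemma Curl_mode:
  assumes "cdot (Z h) c = 0"
  shows "L2.nrm (Curl (mode h c) - mode h (\<i> *s ccross (Z h) c)) = 0"
proof (rule fourier_unique)
  fix k
  have "ccross (Z k) 0 = 0" by (simp add: ccross_def vec_eq_iff forall_3)
  then show "fcoeff (Curl (mode h c)) k = fcoeff (mode h (\<i> *s ccross (Z h) c)) k"
    by (auto simp: fcoeff_Curl[OF mode_V[OF assms]] fcoeff_mode ccross_scale vec_eq_iff)
qed (use mode_V[OF assms] in auto)

end

section \<open>Closedness, compactness and density of the form domain\<close>

context medium
begin

lemma form_nrm_upper': "v \<in> V \<Longrightarrow> Fm.nrm v \<le> sqrt C * L2.nrm (Curl v)"
proof (rule power2_le_imp_le)
  assume v: "v \<in> V"
  show "(Fm.nrm v)\<^sup>2 \<le> (sqrt C * L2.nrm (Curl v))\<^sup>2"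
    using form_nrm_upper[OF v] C(2) by (simp add: power_mult_distrib)
  show "0 \<le> sqrt C * L2.nrm (Curl v)"
    using L2.nrm_nonneg[OF Curl_L2[OF v]] C(2) by simp
qed

lemma form_nrm_lower': "v \<in> V \<Longrightarrow> L2.nrm (Curl v) \<le> N * Fm.nrm v"
proof (rule power2_le_imp_le)
  assume v: "v \<in> V"
  show "(L2.nrm (Curl v))\<^sup>2 \<le> (N * Fm.nrm v)\<^sup>2"
    using form_nrm_lower[OF v] by (simp add: power_mult_distrib)
  show "0 \<le> N * Fm.nrm v"
    using Fm.nrm_nonneg[OF v] N(2) by simp
qed

lemma nrm_Curl_diff:
  assumes u: "u \<in> V" and v: "v \<in> V"
  shows "L2.nrm (Curl (u - v)) = L2.nrm (Curl u - Curl v)"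
  using L2.nrm_reverse_triangle[OF Curl_L2[OF V_diff[OF u v]] L2.mem_diff[OF Curl_L2[OF u] Curl_L2[OF v]]]
    Curl_diff[OF u v] by simp

text \<open>The curls of the sequence converge in \<open>L2\<close>, and the curl symbol is continuous at each frequency, so the limit of
  the curls is the curl of the limit.\<close>
lemma form_closed:
  assumes x: "\<And>j::nat. x j \<in> V" and u: "u \<in> H" and lim: "(\<lambda>j. L2.nrm (x j - u)) \<longlonglongrightarrow> 0"
    and cau: "Fm.nrm_Cauchy x"
  shows "u \<in> V \<and> (\<lambda>j. Fm.nrm (x j - u)) \<longlonglongrightarrow> 0"
proof -
  have "L2.nrm_Cauchy (\<lambda>j. Curl (x j))"
    unfolding L2.nrm_Cauchy_def
  proof (intro allI impI)
    fix \<epsilon> :: real assume \<epsilon>: "\<epsilon> > 0"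
    then have "\<epsilon> / N > 0" using N(2) by simp
    then obtain K where K: "\<And>k l. k \<ge> K \<Longrightarrow> l \<ge> K \<Longrightarrow> Fm.nrm (x k - x l) < \<epsilon> / N"
      using cau unfolding Fm.nrm_Cauchy_def by blast
    have "L2.nrm (Curl (x k) - Curl (x l)) < \<epsilon>" if "k \<ge> K" "l \<ge> K" for k l
    proof -
      have "L2.nrm (Curl (x k) - Curl (x l)) \<le> N * Fm.nrm (x k - x l)"
        using form_nrm_lower'[OF V_diff[OF x x]] unfolding nrm_Curl_diff[OF x x] .
      also have "\<dots> < N * (\<epsilon> / N)"
        using K[OF that] N(2) by (intro mult_strict_left_mono)
      finally show ?thesis using N(2) by simp
    qed
    then show "\<exists>K. \<forall>k\<ge>K. \<forall>l\<ge>K. L2.nrm (Curl (x k) - Curl (x l)) < \<epsilon>" by blast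
  qed
  then obtain w where w: "w \<in> L2 a1 a2" and limw: "(\<lambda>j. L2.nrm (Curl (x j) - w)) \<longlonglongrightarrow> 0"
    using L2.complete[of "\<lambda>j. Curl (x j)"] x by auto
  have fcw: "fcoeff w h = \<i> *s ccross (Z h) (fcoeff u h)" for h
  proof (rule herm_eqI)
    fix c
    show "herm (fcoeff w h) c = herm (\<i> *s ccross (Z h) (fcoeff u h)) c"
    proof (rule LIMSEQ_unique)
      show "(\<lambda>j. herm (fcoeff (Curl (x j)) h) c) \<longlonglongrightarrow> herm (fcoeff w h) c"
        by (rule fcoeff_tendsto_closed[OF Curl_L2[OF x] w limw])
      have "(\<lambda>j. herm (fcoeff (x j) h) (\<i> *s ccross (Z h) c)) \<longlonglongrightarrow> herm (fcoeff u h) (\<i> *s ccross (Z h) c)"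
        by (rule fcoeff_tendsto_closed[OF V_L2[OF x] H_L2[OF u] lim])
      then show "(\<lambda>j. herm (fcoeff (Curl (x j)) h) c) \<longlonglongrightarrow> herm (\<i> *s ccross (Z h) (fcoeff u h)) c"
        unfolding fcoeff_Curl[OF x] herm_ccross[OF Z_real] .
    qed
  qed
  have uV: "u \<in> V" by (rule V_I[OF u w fcw])
  have "L2.nrm (Curl u - w) = 0"
    by (rule fourier_unique[OF Curl_L2[OF uV] w]) (simp add: fcoeff_Curl[OF uV] fcw)
  have "(\<lambda>j. Fm.nrm (x j - u)) \<longlonglongrightarrow> 0"
  proof (rule Lim_null_comparison)
    have "norm (Fm.nrm (x j - u)) \<le> sqrt C * L2.nrm (Curl (x j) - w)" for j
    proof -
      have "L2.nrm (Curl (x j) - Curl u) \<le> L2.nrm (Curl (x j) - w) + L2.nrm (w - Curl u)"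
        by (rule L2.nrm_diff_triangle[OF Curl_L2[OF x] w Curl_L2[OF uV]])
      also have "L2.nrm (w - Curl u) = 0"
        using L2.nrm_minus_commute[OF w Curl_L2[OF uV]] \<open>L2.nrm (Curl u - w) = 0\<close> by simp
      finally have le: "L2.nrm (Curl (x j) - Curl u) \<le> L2.nrm (Curl (x j) - w)" by (simp only: add_0_right)
      have "Fm.nrm (x j - u) \<le> sqrt C * L2.nrm (Curl (x j) - Curl u)"
        using form_nrm_upper'[OF V_diff[OF x uV]] unfolding nrm_Curl_diff[OF x uV] .
      also have "\<dots> \<le> sqrt C * L2.nrm (Curl (x j) - w)"
        using le C(2) by (intro mult_left_mono) auto
      finally show ?thesis using Fm.nrm_nonneg[OF V_diff[OF x uV]] by simp
    qed
    then show "\<forall>\<^sub>F j in sequentially. norm (Fm.nrm (x j - u)) \<le> sqrt C * L2.nrm (Curl (x j) - w)" by simp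
    show "(\<lambda>j. sqrt C * L2.nrm (Curl (x j) - w)) \<longlonglongrightarrow> 0"
      using tendsto_mult_right_zero[OF limw] .
  qed
  then show ?thesis using uV by blast
qed

text \<open>The integers \<open>fst h\<close> and \<open>snd h\<close> are recovered from \<open>freq h\<close> by inner products with \<open>a1\<close> and \<open>a2\<close>.\<close>
lemma finite_low_modes: "finite {h. norm (Z h) < R}"
proof -
  define B where "B = (\<bar>R\<bar> + norm \<xi>) * (norm a1 + norm a2)"
  have "{h. norm (Z h) < R} \<subseteq> {- \<lceil>B\<rceil>..\<lceil>B\<rceil>} \<times> {- \<lceil>B\<rceil>..\<lceil>B\<rceil>}"
  proof
    fix h assume "h \<in> {h. norm (Z h) < R}"
    then have "norm (Z h) < R" by simp
    moreover have "norm (freq h + \<xi>) \<le> norm (Z h)"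
      by (rule power2_le_imp_le) (simp_all add: norm_Z_sq)
    moreover have "norm (freq h) \<le> norm (freq h + \<xi>) + norm \<xi>"
      using norm_triangle_ineq4[of "freq h + \<xi>" \<xi>] by simp
    ultimately have f: "norm (freq h) \<le> \<bar>R\<bar> + norm \<xi>" by linarith
    have bound: "\<bar>real_of_int k\<bar> \<le> B" if k: "a \<bullet> freq h = 2 * pi * of_int k" and a: "norm a \<le> norm a1 + norm a2" for a k
    proof -
      have "1 * \<bar>real_of_int k\<bar> \<le> 2 * pi * \<bar>real_of_int k\<bar>"
        using pi_gt3 by (intro mult_right_mono) auto
      also have "\<dots> = \<bar>a \<bullet> freq h\<bar>" unfolding k by (simp add: abs_mult)
      also have "\<dots> \<le> norm a * norm (freq h)" by (rule Cauchy_Schwarz_ineq2)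
      also have "\<dots> \<le> (norm a1 + norm a2) * (\<bar>R\<bar> + norm \<xi>)"
        using a f by (intro mult_mono) auto
      finally show ?thesis by (simp add: B_def mult.commute)
    qed
    have "\<bar>real_of_int (fst h)\<bar> \<le> B" "\<bar>real_of_int (snd h)\<bar> \<le> B"
      by (rule bound[of a1]; simp add: freq_def inner_add_right) (rule bound[of a2]; simp add: freq_def inner_add_right)
    then show "h \<in> {- \<lceil>B\<rceil>..\<lceil>B\<rceil>} \<times> {- \<lceil>B\<rceil>..\<lceil>B\<rceil>}"
      by (auto simp: mem_Times_iff abs_le_iff) linarith+
  qed
  then show ?thesis by (rule finite_subset) simp
qed

text \<open>Where \<open>\<bar>Z h\<bar> \<ge> R\<close>, the coefficient of \<open>v\<close> is at most that of its curl divided by \<open>R\<close>.\<close>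
lemma nrm_split:
  assumes v: "v \<in> V" and R: "R > 0"
  shows "(L2.nrm v)\<^sup>2 \<le> (\<Sum>h | norm (Z h) < R. (norm (fcoeff v h))\<^sup>2 / A) + (L2.nrm (Curl v))\<^sup>2 / R\<^sup>2"
proof (rule has_sum_mono)
  show "((\<lambda>h. (norm (fcoeff v h))\<^sup>2 / A) has_sum (L2.nrm v)\<^sup>2) UNIV"
    by (rule fourier_nrm[OF V_L2[OF v]])
  have 1: "((\<lambda>h. if norm (Z h) < R then (norm (fcoeff v h))\<^sup>2 / A else 0) has_sum
      (\<Sum>h | norm (Z h) < R. (norm (fcoeff v h))\<^sup>2 / A)) UNIV"
    by (rule has_sum_finite_neutralI[OF finite_low_modes[of R]]) auto
  have 2: "((\<lambda>h. (norm (fcoeff (Curl v) h))\<^sup>2 / A * (1 / R\<^sup>2)) has_sum (L2.nrm (Curl v))\<^sup>2 * (1 / R\<^sup>2)) UNIV"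
    by (rule has_sum_cmult_left[OF fourier_nrm[OF Curl_L2[OF v]]])
  show "((\<lambda>h. (if norm (Z h) < R then (norm (fcoeff v h))\<^sup>2 / A else 0)
      + (norm (fcoeff (Curl v) h))\<^sup>2 / A * (1 / R\<^sup>2)) has_sum
      (\<Sum>h | norm (Z h) < R. (norm (fcoeff v h))\<^sup>2 / A) + (L2.nrm (Curl v))\<^sup>2 / R\<^sup>2) UNIV"
    using has_sum_add[OF 1 2] by simp
  fix h
  show "(norm (fcoeff v h))\<^sup>2 / A \<le> (if norm (Z h) < R then (norm (fcoeff v h))\<^sup>2 / A else 0)
      + (norm (fcoeff (Curl v) h))\<^sup>2 / A * (1 / R\<^sup>2)"
  proof (cases "norm (Z h) < R")
    case False
    then have "R\<^sup>2 \<le> (norm (Z h))\<^sup>2" using R by (intro power_mono) auto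
    then have "1 \<le> (norm (Z h))\<^sup>2 / R\<^sup>2" using R by simp
    then have "(norm (fcoeff v h))\<^sup>2 / A * 1 \<le> (norm (fcoeff v h))\<^sup>2 / A * ((norm (Z h))\<^sup>2 / R\<^sup>2)"
      using A_pos by (intro mult_left_mono) auto
    then show ?thesis
      using False by (simp add: norm_fcoeff_Curl[OF v] mult_ac)
  qed (use A_pos in simp)
qed

text \<open>Rellich's theorem: a diagonal subsequence converges at every frequency, and the high frequencies are
  uniformly small because the curls are bounded.\<close>
lemma form_compact:
  assumes x: "\<And>j::nat. x j \<in> V" and b: "\<And>j. L2.nrm (x j) \<le> B" and bF: "\<And>j. Fm.nrm (x j) \<le> B"
  shows "\<exists>r. strict_mono (r :: nat \<Rightarrow> nat) \<and> L2.nrm_Cauchy (x \<circ> r)"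
proof -
  have B0: "0 \<le> B" using b[of 0] L2.nrm_nonneg[OF V_L2[OF x[of 0]]] by linarith
  have fb: "norm (fcoeff (x j) h) \<le> sqrt A * B" for j h
  proof (rule power2_le_imp_le)
    have "(\<Sum>k\<in>{h}. (norm (fcoeff (x j) k))\<^sup>2 / A) \<le> (L2.nrm (x j))\<^sup>2"
      by (rule finite_sum_le_has_sum[OF fourier_nrm[OF V_L2[OF x]]]) (use A_pos in auto)
    also have "\<dots> \<le> B\<^sup>2"
      using b L2.nrm_nonneg[OF V_L2[OF x]] by (intro power_mono) auto
    finally show "(norm (fcoeff (x j) h))\<^sup>2 \<le> (sqrt A * B)\<^sup>2"
      using A_pos by (simp add: field_simps power_mult_distrib)
  qed (use A_pos B0 in simp)
  obtain r :: "nat \<Rightarrow> nat" where r: "strict_mono r"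
    and conv: "\<And>h. \<exists>l. (\<lambda>j. fcoeff (x (r j)) h) \<longlonglongrightarrow> l"
  proof (rule function_convergent_subsequence[of UNIV "\<lambda>j h. fcoeff (x j) h" "sqrt A * B"])
    show "countable (UNIV :: (int \<times> int) set)" by simp
    show "norm (fcoeff (x j) h) \<le> sqrt A * B" for j h by (rule fb)
  qed blast
  have "L2.nrm_Cauchy (x \<circ> r)"
    unfolding L2.nrm_Cauchy_def
  proof (intro allI impI)
    fix \<epsilon> :: real assume \<epsilon>: "\<epsilon> > 0"
    \<comment> \<open>The curls of differences have norm at most \<open>2NB\<close>; with this cut-off the high frequencies
      contribute at most \<open>\<epsilon>/2\<close> to the norm. The summand \<open>1\<close> keeps \<open>R\<close> positive.\<close>
    define R where "R = (2 * N * B + 1) * 2 / \<epsilon>"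
    have NB: "0 \<le> N * B" using N(2) B0 by simp
    have R0: "R > 0" using NB \<epsilon> by (simp add: R_def add_nonneg_pos)
    have Reps: "(2 * N * B) / R \<le> \<epsilon> / 2"
    proof -
      have "R * (\<epsilon> / 2) = 2 * N * B + 1" using \<epsilon> by (simp add: R_def)
      then have "2 * N * B \<le> R * (\<epsilon> / 2)" by linarith
      then show ?thesis using R0 by (simp add: field_simps)
    qed
    define G where "G = {h. norm (Z h) < R}"
    have finG: "finite G" unfolding G_def by (rule finite_low_modes)
    define S where "S j k = (\<Sum>h\<in>G. (norm (fcoeff (x (r j)) h - fcoeff (x (r k)) h))\<^sup>2 / A)" for j k
    \<comment> \<open>A bound for each of the finitely many low frequencies; they add up to less than \<open>\<epsilon>\<^sup>2/2\<close>.\<close>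
    define \<delta> where "\<delta> = \<epsilon>\<^sup>2 / 2 * A / (real (card G) + 1)"
    have \<delta>: "\<delta> > 0" using \<epsilon> A_pos by (simp add: \<delta>_def add_nonneg_pos)
    have "\<exists>K. \<forall>j\<ge>K. \<forall>k\<ge>K. norm (fcoeff (x (r j)) h - fcoeff (x (r k)) h) < sqrt \<delta>" for h
    proof -
      have "Cauchy (\<lambda>j. fcoeff (x (r j)) h)" using conv[of h] by (auto intro: LIMSEQ_imp_Cauchy)
      then show ?thesis using \<delta> unfolding Cauchy_iff by simp
    qed
    then obtain K where K: "\<And>h j k. j \<ge> K h \<Longrightarrow> k \<ge> K h \<Longrightarrow> norm (fcoeff (x (r j)) h - fcoeff (x (r k)) h) < sqrt \<delta>"
      by metis
    define K' where "K' = (\<Sum>h\<in>G. K h)"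
    have KK: "K h \<le> K'" if "h \<in> G" for h
      unfolding K'_def using member_le_sum[OF that _ finG, of K] by simp
    have "L2.nrm ((x \<circ> r) j - (x \<circ> r) k) < \<epsilon>" if jk: "j \<ge> K'" "k \<ge> K'" for j k
    proof (rule power2_less_imp_less)
      define v where "v = x (r j) - x (r k)"
      have vV: "v \<in> V" unfolding v_def by (rule V_diff[OF x x])
      have fcv: "fcoeff v h = fcoeff (x (r j)) h - fcoeff (x (r k)) h" for h
        unfolding v_def by (rule fcoeff_diff[OF V_L2[OF x] V_L2[OF x]])
      have "(\<Sum>h\<in>G. (norm (fcoeff v h))\<^sup>2 / A) \<le> (\<Sum>h\<in>G. \<delta> / A)"
      proof (rule sum_mono)
        fix h assume "h \<in> G"
        then have "norm (fcoeff v h) \<le> sqrt \<delta>"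
          using K[of h j k] KK[of h] jk unfolding fcv by simp
        then have "(norm (fcoeff v h))\<^sup>2 \<le> (sqrt \<delta>)\<^sup>2" by (intro power_mono) auto
        then show "(norm (fcoeff v h))\<^sup>2 / A \<le> \<delta> / A"
          using \<delta> A_pos by (simp add: divide_right_mono)
      qed
      also have "\<dots> = \<epsilon>\<^sup>2 / 2 * (real (card G) / (real (card G) + 1))"
        using A_pos by (simp add: \<delta>_def)
      also have "\<dots> < \<epsilon>\<^sup>2 / 2 * 1"
        using \<epsilon> by (intro mult_strict_left_mono) auto
      finally have low: "(\<Sum>h\<in>G. (norm (fcoeff v h))\<^sup>2 / A) < \<epsilon>\<^sup>2 / 2" by simp
      have "L2.nrm (Curl v) \<le> N * Fm.nrm v" by (rule form_nrm_lower'[OF vV])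
      also have "\<dots> \<le> N * (2 * B)"
      proof (rule mult_left_mono)
        have "Fm.nrm v \<le> Fm.nrm (x (r j)) + Fm.nrm (x (r k))"
          unfolding v_def
          using Fm.nrm_diff_triangle[OF x V_zero x, of "r j" "r k"] Fm.nrm_minus_commute[OF V_zero x[of "r k"]]
          by simp
        then show "Fm.nrm v \<le> 2 * B" using bF[of "r j"] bF[of "r k"] by linarith
      qed (use N(2) in simp)
      finally have "L2.nrm (Curl v) / R \<le> (2 * N * B) / R"
        using R0 by (intro divide_right_mono) auto
      then have "L2.nrm (Curl v) / R \<le> \<epsilon> / 2" using Reps by linarith
      then have "(L2.nrm (Curl v) / R)\<^sup>2 \<le> (\<epsilon> / 2)\<^sup>2"
        using R0 L2.nrm_nonneg[OF Curl_L2[OF vV]] by (intro power_mono) auto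
      also have "\<dots> \<le> \<epsilon>\<^sup>2 / 2" by (simp add: power_divide)
      finally have high: "(L2.nrm (Curl v))\<^sup>2 / R\<^sup>2 \<le> \<epsilon>\<^sup>2 / 2" by (simp add: power_divide)
      have "(L2.nrm v)\<^sup>2 < \<epsilon>\<^sup>2"
        using nrm_split[OF vV R0] low high unfolding G_def by linarith
      then show "(L2.nrm ((x \<circ> r) j - (x \<circ> r) k))\<^sup>2 < \<epsilon>\<^sup>2" by (simp add: v_def)
    qed (use \<epsilon> in simp)
    then show "\<exists>K. \<forall>j\<ge>K. \<forall>k\<ge>K. L2.nrm ((x \<circ> r) j - (x \<circ> r) k) < \<epsilon>" by blast
  qed
  then show ?thesis using r by blast
qed

lemma fcoeff_sum: "(\<And>i. i \<in> I \<Longrightarrow> f i \<in> L2 a1 a2) \<Longrightarrow> fcoeff (\<Sum>i\<in>I. f i) h = (\<Sum>i\<in>I. fcoeff (f i) h)"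
proof (induction I rule: infinite_finite_induct)
  case (insert i I)
  have "fcoeff (\<Sum>k\<in>insert i I. f k) h = fcoeff (f i + (\<Sum>k\<in>I. f k)) h"
    unfolding sum.insert[OF insert.hyps] ..
  also have "\<dots> = fcoeff (f i) h + fcoeff (\<Sum>k\<in>I. f k) h"
    by (rule fcoeff_add) (use insert.prems in \<open>auto intro!: L2.mem_sum\<close>)
  also have "\<dots> = (\<Sum>k\<in>insert i I. fcoeff (f k) h)"
    unfolding sum.insert[OF insert.hyps] using insert.IH insert.prems by (simp only: insertI2)
  finally show ?case .
qed (simp_all add: fcoeff_0)

text \<open>Truncation of the Fourier series keeps the divergence zero.\<close>
lemma form_dense:
  assumes f: "f \<in> H" and \<epsilon>: "\<epsilon> > 0"
  shows "\<exists>v\<in>V. L2.nrm (f - v) < \<epsilon>"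
proof -
  have hs: "((\<lambda>h. (norm (fcoeff f h))\<^sup>2 / A) has_sum (L2.nrm f)\<^sup>2) UNIV"
    by (rule fourier_nrm[OF H_L2[OF f]])
  have "\<forall>\<^sub>F G in finite_subsets_at_top UNIV. (L2.nrm f)\<^sup>2 - \<epsilon>\<^sup>2 < sum (\<lambda>h. (norm (fcoeff f h))\<^sup>2 / A) G"
    using hs unfolding has_sum_def by (rule order_tendstoD) (use \<epsilon> in simp)
  then obtain G where G: "finite G" "(L2.nrm f)\<^sup>2 - \<epsilon>\<^sup>2 < sum (\<lambda>h. (norm (fcoeff f h))\<^sup>2 / A) G"
    unfolding eventually_finite_subsets_at_top by blast
  define v where "v = (\<Sum>h\<in>G. mode h (of_real (1 / A) *s fcoeff f h))"
  have vV: "v \<in> V"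
    unfolding v_def by (intro Fm.mem_sum mode_V) (simp add: cdot_scale H_div[OF f])
  have fcv: "fcoeff v h = (if h \<in> G then fcoeff f h else 0)" for h
  proof -
    have "fcoeff v h = (\<Sum>k\<in>G. fcoeff (mode k (of_real (1 / A) *s fcoeff f k)) h)"
      unfolding v_def by (rule fcoeff_sum) simp
    also have "\<dots> = (\<Sum>k\<in>G. if k = h then fcoeff f k else 0)"
      using A_pos by (intro sum.cong refl) (auto simp: fcoeff_mode vec_eq_iff)
    finally show ?thesis using G(1) by simp
  qed
  have d: "fcoeff (f - v) h = (if h \<in> G then 0 else fcoeff f h)" for h
    unfolding fcoeff_diff[OF H_L2[OF f] V_L2[OF vV]] fcv by simp
  have "((\<lambda>h. (norm (fcoeff f h))\<^sup>2 / A - (if h \<in> G then (norm (fcoeff f h))\<^sup>2 / A else 0)) has_sum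
      ((L2.nrm f)\<^sup>2 - sum (\<lambda>h. (norm (fcoeff f h))\<^sup>2 / A) G)) UNIV"
    by (intro has_sum_minus hs has_sum_finite_neutralI[OF G(1)]) auto
  moreover have "(norm (fcoeff f h))\<^sup>2 / A - (if h \<in> G then (norm (fcoeff f h))\<^sup>2 / A else 0) = (norm (fcoeff (f - v) h))\<^sup>2 / A" for h
    by (simp add: d)
  ultimately have "((\<lambda>h. (norm (fcoeff (f - v) h))\<^sup>2 / A) has_sum
      ((L2.nrm f)\<^sup>2 - sum (\<lambda>h. (norm (fcoeff f h))\<^sup>2 / A) G)) UNIV"
    by (simp only:)
  then have "(L2.nrm (f - v))\<^sup>2 = (L2.nrm f)\<^sup>2 - sum (\<lambda>h. (norm (fcoeff f h))\<^sup>2 / A) G"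
    using has_sum_unique[OF fourier_nrm[OF L2.mem_diff[OF H_L2[OF f] V_L2[OF vV]]]] by blast
  then have "(L2.nrm (f - v))\<^sup>2 < \<epsilon>\<^sup>2" using G(2) by linarith
  then have "L2.nrm (f - v) < \<epsilon>"
    by (rule power2_less_imp_less) (use \<epsilon> in simp)
  then show ?thesis using vV by blast
qed

lemma form_infinite_dim: "\<exists>w :: nat \<Rightarrow> real^2 \<Rightarrow> complex^3. range w \<subseteq> V \<and> Hs.orthonormal_on UNIV w"
proof -
  have "\<forall>k::nat. \<exists>c. cdot (Z (int k, 0)) c = 0 \<and> c \<noteq> 0"
    using exists_transversal by blast
  from choice[OF this] obtain c where c: "\<And>k::nat. cdot (Z (int k, 0)) (c k) = 0" "\<And>k. c k \<noteq> 0"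
    by blast
  define d where "d k = of_real (1 / (sqrt A * norm (c k))) *s c k" for k
  have dZ: "cdot (Z (int k, 0)) (d k) = 0" for k
    by (simp add: d_def cdot_scale c)
  have nd: "(norm (d k))\<^sup>2 = 1 / A" for k
    using A_pos c(2)[of k] by (simp add: d_def norm_vector_scalar power_mult_distrib power_divide norm_divide norm_mult)
  define w where "w k = mode (int k, 0) (d k)" for k
  have wV: "w k \<in> V" for k unfolding w_def by (rule mode_V[OF dZ])
  have "L2_inner a1 a2 (w j) (w k) = (if j = k then 1 else 0)" for j k
  proof -
    have "L2_inner a1 a2 (w j) (w k) = herm (fcoeff (w j) (int k, 0)) (d k)"
      unfolding w_def by (rule L2_inner_mode) simp
    also have "\<dots> = (if j = k then of_real A * herm (d k) (d k) else 0)"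
      by (auto simp: w_def fcoeff_mode herm_scale_left) (simp add: herm_def)
    also have "\<dots> = (if j = k then 1 else 0)"
      using A_pos unfolding herm_self nd by simp
    finally show ?thesis .
  qed
  then have "Hs.orthonormal_on UNIV w"
    unfolding Hs.orthonormal_on_def using wV V_H by simp
  then show ?thesis using wV by blast
qed

sublocale CF: compact_form vscale H "L2_inner a1 a2" V form
proof unfold_locales
  show "V \<subseteq> H" using V_H by blast
  show "\<exists>v\<in>V. Hs.nrm (u - v) < \<epsilon>" if "u \<in> H" "0 < \<epsilon>" for u \<epsilon>
    by (rule form_dense[OF that])
  show "u \<in> V \<and> (\<lambda>j. Fm.nrm (x j - u)) \<longlonglongrightarrow> 0"
    if "\<And>j::nat. x j \<in> V" "u \<in> H" "(\<lambda>j. Hs.nrm (x j - u)) \<longlonglongrightarrow> 0" "Fm.nrm_Cauchy x" for x u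
    by (rule form_closed[OF that])
  show "\<exists>r. strict_mono (r :: nat \<Rightarrow> nat) \<and> Hs.nrm_Cauchy (x \<circ> r)"
    if "\<And>j. x j \<in> V" "\<And>j. Hs.nrm (x j) \<le> B" "\<And>j. Fm.nrm (x j) \<le> B" for x B
    by (rule form_compact[OF that])
  show "\<exists>w :: nat \<Rightarrow> real^2 \<Rightarrow> complex^3. range w \<subseteq> V \<and> Hs.orthonormal_on UNIV w"
    by (rule form_infinite_dim)
qed

end

section \<open>The operator, the Garding inequality and the spectrum\<close>

lemma herm_diff_left: "herm (u - v) w = herm u w - herm v w"
  by (simp add: herm_def sum_subtractf algebra_simps)

context medium
begin

lemma form_operator_eq: "form_operator a1 a2 n \<xi> \<beta> = CF.form_graph"
  unfolding form_operator_def CF.form_graph_def ..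

text \<open>The weak formulation tests only with divergence-free fields, whereas the distributional equation tests with all
  fields. Nothing is lost, because both \<open>f\<close> and every curl are orthogonal to longitudinal waves.\<close>
lemma curl_curl_eq: "form_operator a1 a2 n \<xi> \<beta> = curl_curl_operator a1 a2 n \<xi> \<beta>"
proof -
  have "u \<in> V \<Longrightarrow> f \<in> H \<and> (\<forall>v\<in>V. form u v = L2_inner a1 a2 f v) \<longleftrightarrow>
      represents_L2 a1 a2 (dist_curl \<xi> \<beta> (regular a1 a2 (weigh (Curl u)))) f" for u f
  proof -
    assume u: "u \<in> V"
    define p where "p = weigh (Curl u)"
    have p: "p \<in> L2 a1 a2" unfolding p_def by (rule weigh_L2[OF Curl_L2[OF u]])
    have fuv: "form u v = L2_inner a1 a2 p (Curl v)" for v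
      unfolding p_def by (rule form_eq)
    have "f \<in> H \<and> (\<forall>v\<in>V. form u v = L2_inner a1 a2 f v) \<longleftrightarrow>
        f \<in> L2 a1 a2 \<and> (\<forall>h. fcoeff f h = \<i> *s ccross (Z h) (fcoeff p h))"
    proof (intro iffI conjI allI ballI)
      assume A: "f \<in> H \<and> (\<forall>v\<in>V. form u v = L2_inner a1 a2 f v)"
      then have f: "f \<in> H" and eq: "\<And>v. v \<in> V \<Longrightarrow> form u v = L2_inner a1 a2 f v" by auto
      show "f \<in> L2 a1 a2" by (rule H_L2[OF f])
      fix h
      \<comment> \<open>The difference of both sides is transversal, so it may be used as the amplitude of a test mode.\<close>
      define c where "c = fcoeff f h - \<i> *s ccross (Z h) (fcoeff p h)"
      have c: "cdot (Z h) c = 0"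
        by (simp add: c_def cdot_diff cdot_scale cdot_ccross H_div[OF f])
      have "form u (mode h c) = L2_inner a1 a2 p (mode h (\<i> *s ccross (Z h) c))"
      proof -
        have "L2_inner a1 a2 (Curl (mode h c)) p = L2_inner a1 a2 (mode h (\<i> *s ccross (Z h) c)) p"
          by (rule ip_cong_null_left[OF Curl_L2[OF mode_V[OF c]] mode_L2 p Curl_mode[OF c]])
        then show ?thesis
          unfolding fuv L2.ip_commute[OF Curl_L2[OF mode_V[OF c]] p] L2.ip_commute[OF mode_L2 p] by simp
      qed
      also have "\<dots> = herm (\<i> *s ccross (Z h) (fcoeff p h)) c"
        unfolding L2_inner_mode[OF p] by (rule herm_ccross[OF Z_real])
      finally have "herm (fcoeff f h) c = herm (\<i> *s ccross (Z h) (fcoeff p h)) c"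
        using eq[OF mode_V[OF c]] L2_inner_mode[OF H_L2[OF f], of h c] by simp
      then have "herm c c = 0"
        by (subst (1) c_def) (simp add: herm_diff_left)
      then have "c = 0" unfolding herm_self by simp
      then show "fcoeff f h = \<i> *s ccross (Z h) (fcoeff p h)" by (simp add: c_def)
    next
      assume B: "f \<in> L2 a1 a2 \<and> (\<forall>h. fcoeff f h = \<i> *s ccross (Z h) (fcoeff p h))"
      then have f: "f \<in> L2 a1 a2" and ff: "\<And>h. fcoeff f h = \<i> *s ccross (Z h) (fcoeff p h)" by blast+
      show "f \<in> H" by (rule H_I[OF f]) (simp add: ff cdot_scale cdot_ccross)
      fix v assume v: "v \<in> V"
      have "((\<lambda>h. herm (fcoeff p h) (fcoeff (Curl v) h) / of_real A) has_sum form u v) UNIV"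
        unfolding fuv by (rule fourier_inner[OF p Curl_L2[OF v]])
      moreover have "herm (fcoeff p h) (fcoeff (Curl v) h) = herm (fcoeff f h) (fcoeff v h)" for h
        unfolding fcoeff_Curl[OF v] ff by (rule herm_ccross[OF Z_real])
      ultimately have "((\<lambda>h. herm (fcoeff f h) (fcoeff v h) / of_real A) has_sum form u v) UNIV"
        by (simp only:)
      then show "form u v = L2_inner a1 a2 f v"
        by (rule has_sum_unique) (rule fourier_inner[OF f V_L2[OF v]])
    qed
    then show ?thesis
      unfolding represents_curl_iff[OF p, folded p_def] p_def[symmetric] .
  qed
  then show ?thesis
    unfolding form_operator_def curl_curl_operator_def weigh_def by blast
qed

lemma norm_freq_sq_le: "(norm (freq h))\<^sup>2 \<le> 2 * (norm (freq h + \<xi>))\<^sup>2 + 2 * (norm \<xi>)\<^sup>2"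
  using norm_diff_sq_le[of "freq h" 0 "- \<xi>"] by simp

lemma norm_freq_components: "(\<Sum>j\<in>UNIV. (freq h $ j)\<^sup>2) = (norm (freq h))\<^sup>2"
  unfolding power2_norm_eq_inner by (simp add: inner_vec_def power2_eq_square)

text \<open>For divergence-free fields \<open>\<bar>g\<^sub>h\<bar>\<^sup>2\<bar>v\<^sub>h\<bar>\<^sup>2 \<le> 2\<bar>\<zeta>\<^sub>h \<times> v\<^sub>h\<bar>\<^sup>2 + 2\<bar>\<xi>\<bar>\<^sup>2\<bar>v\<^sub>h\<bar>\<^sup>2\<close>, so the coefficients of the partial derivatives are
  square-summable and the derivatives exist in \<open>L2\<close>.\<close>
lemma V_H1: "V \<subseteq> H1 a1 a2"
proof
  fix v assume v: "v \<in> V"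
  have "dist_in_L2 a1 a2 (dist_pdiff j (regular a1 a2 v))" for j
  proof -
    define c where "c h = (\<i> * of_real (freq h $ j)) *s fcoeff v h" for h
    have nc: "(norm (c h))\<^sup>2 = (freq h $ j)\<^sup>2 * (norm (fcoeff v h))\<^sup>2" for h
      by (simp add: c_def norm_vector_scalar norm_mult power_mult_distrib)
    have "(\<lambda>h. (norm (c h))\<^sup>2) summable_on UNIV"
    proof (rule summable_on_comparison_test)
      show "(\<lambda>h. 2 * (norm (fcoeff (Curl v) h))\<^sup>2 + 2 * (norm \<xi>)\<^sup>2 * (norm (fcoeff v h))\<^sup>2) summable_on UNIV"
        by (intro summable_on_add summable_on_cmult_right fourier_summable Curl_L2 V_L2 v)
      fix h
      have "(freq h $ j)\<^sup>2 \<le> (norm (freq h))\<^sup>2"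
        unfolding norm_freq_components[symmetric] by (rule member_le_sum) auto
      also have "\<dots> \<le> 2 * (norm (Z h))\<^sup>2 + 2 * (norm \<xi>)\<^sup>2"
        using norm_freq_sq_le[of h] norm_Z_sq[of h] zero_le_power2[of \<beta>] by linarith
      finally have "(freq h $ j)\<^sup>2 * (norm (fcoeff v h))\<^sup>2
          \<le> (2 * (norm (Z h))\<^sup>2 + 2 * (norm \<xi>)\<^sup>2) * (norm (fcoeff v h))\<^sup>2"
        by (rule mult_right_mono) simp
      then show "(norm (c h))\<^sup>2 \<le> 2 * (norm (fcoeff (Curl v) h))\<^sup>2 + 2 * (norm \<xi>)\<^sup>2 * (norm (fcoeff v h))\<^sup>2"
        unfolding nc norm_fcoeff_Curl[OF v] by (simp add: algebra_simps)
    qed simp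
    from fourier_exists[OF this] obtain w where "w \<in> L2 a1 a2" "\<forall>h. fcoeff w h = c h" by blast
    then have "represents_L2 a1 a2 (dist_pdiff j (regular a1 a2 v)) w"
      unfolding represents_pdiff_iff[OF V_L2[OF v]] c_def by blast
    then show ?thesis unfolding dist_in_L2_def by blast
  qed
  then show "v \<in> H1 a1 a2" unfolding H1_def using V_L2[OF v] by blast
qed

lemma H1_norm_has_sum:
  assumes v: "v \<in> V"
  shows "((\<lambda>h. (1 + (norm (freq h))\<^sup>2) * ((norm (fcoeff v h))\<^sup>2 / A)) has_sum (H1_norm a1 a2 v)\<^sup>2) UNIV"
proof -
  define g where "g j = L2_fun a1 a2 (dist_pdiff j (regular a1 a2 v))" for j
  have "represents_L2 a1 a2 (dist_pdiff j (regular a1 a2 v)) (g j)" for j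
  proof -
    have "\<exists>w. represents_L2 a1 a2 (dist_pdiff j (regular a1 a2 v)) w"
      using V_H1 v unfolding H1_def dist_in_L2_def by blast
    then show ?thesis unfolding g_def L2_fun_def by (rule someI_ex)
  qed
  then have g: "g j \<in> L2 a1 a2" and fg: "fcoeff (g j) h = (\<i> * of_real (freq h $ j)) *s fcoeff v h" for j h
    unfolding represents_pdiff_iff[OF V_L2[OF v]] by blast+
  have ng: "(norm (fcoeff (g j) h))\<^sup>2 = (freq h $ j)\<^sup>2 * (norm (fcoeff v h))\<^sup>2" for j h
    by (simp add: fg norm_vector_scalar norm_mult power_mult_distrib)
  have "(H1_norm a1 a2 v)\<^sup>2 = (L2.nrm v)\<^sup>2 + ((L2.nrm (g 1))\<^sup>2 + (L2.nrm (g 2))\<^sup>2)"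
    unfolding H1_norm_def g_def[symmetric] L2_norm_eq sum_2
    by (rule real_sqrt_pow2) simp
  moreover have "((\<lambda>h. (norm (fcoeff v h))\<^sup>2 / A + ((norm (fcoeff (g 1) h))\<^sup>2 / A + (norm (fcoeff (g 2) h))\<^sup>2 / A)) has_sum
      (L2.nrm v)\<^sup>2 + ((L2.nrm (g 1))\<^sup>2 + (L2.nrm (g 2))\<^sup>2)) UNIV"
    by (intro has_sum_add fourier_nrm V_L2[OF v] g)
  moreover have "(norm (fcoeff v h))\<^sup>2 / A + ((norm (fcoeff (g 1) h))\<^sup>2 / A + (norm (fcoeff (g 2) h))\<^sup>2 / A)
      = (1 + (norm (freq h))\<^sup>2) * ((norm (fcoeff v h))\<^sup>2 / A)" for h
    unfolding ng norm_freq_components[symmetric] sum_2 by (simp add: algebra_simps add_divide_distrib)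
  ultimately show ?thesis by (simp only:)
qed

text \<open>The inequality holds for each frequency separately, by \<open>\<bar>g\<^sub>h\<bar>\<^sup>2 \<le> 2\<bar>g\<^sub>h + \<xi>\<bar>\<^sup>2 + 2\<bar>\<xi>\<bar>\<^sup>2\<close>.\<close>
lemma Garding:
  assumes v: "v \<in> V"
  shows "1 / 2 * (H1_norm a1 a2 v)\<^sup>2 + \<beta>\<^sup>2 * (L2_norm a1 a2 v)\<^sup>2
    \<le> N\<^sup>2 * Re (form v v) + (3 * (norm \<xi>)\<^sup>2 + 1) * (L2_norm a1 a2 v)\<^sup>2"
proof -
  have "1 / 2 * (H1_norm a1 a2 v)\<^sup>2 + \<beta>\<^sup>2 * (L2.nrm v)\<^sup>2
      \<le> (L2.nrm (Curl v))\<^sup>2 + (3 * (norm \<xi>)\<^sup>2 + 1) * (L2.nrm v)\<^sup>2"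
  proof (rule has_sum_mono)
    show "((\<lambda>h. 1 / 2 * ((1 + (norm (freq h))\<^sup>2) * ((norm (fcoeff v h))\<^sup>2 / A)) + \<beta>\<^sup>2 * ((norm (fcoeff v h))\<^sup>2 / A)) has_sum
        1 / 2 * (H1_norm a1 a2 v)\<^sup>2 + \<beta>\<^sup>2 * (L2.nrm v)\<^sup>2) UNIV"
      by (intro has_sum_add has_sum_cmult_right H1_norm_has_sum fourier_nrm V_L2 v)
    show "((\<lambda>h. (norm (fcoeff (Curl v) h))\<^sup>2 / A + (3 * (norm \<xi>)\<^sup>2 + 1) * ((norm (fcoeff v h))\<^sup>2 / A)) has_sum
        (L2.nrm (Curl v))\<^sup>2 + (3 * (norm \<xi>)\<^sup>2 + 1) * (L2.nrm v)\<^sup>2) UNIV"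
      by (intro has_sum_add has_sum_cmult_right fourier_nrm V_L2 Curl_L2 v)
    fix h
    define s where "s = (norm (fcoeff v h))\<^sup>2 / A"
    have s: "0 \<le> s" using A_pos by (simp add: s_def)
    have "1 / 2 * (1 + (norm (freq h))\<^sup>2) + \<beta>\<^sup>2 \<le> (norm (Z h))\<^sup>2 + (3 * (norm \<xi>)\<^sup>2 + 1)"
    proof -
      have arith: "1 / 2 * (1 + g) + b \<le> z + (3 * q + 1)"
        if "g \<le> 2 * p + 2 * q" "z = p + b" "0 \<le> q" for g b z p q :: real
        using that by (simp add: field_simps)
      show ?thesis by (rule arith[OF norm_freq_sq_le norm_Z_sq zero_le_power2])
    qed
    then have "(1 / 2 * (1 + (norm (freq h))\<^sup>2) + \<beta>\<^sup>2) * s \<le> ((norm (Z h))\<^sup>2 + (3 * (norm \<xi>)\<^sup>2 + 1)) * s"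
      using s by (rule mult_right_mono)
    moreover have "(norm (fcoeff (Curl v) h))\<^sup>2 / A = (norm (Z h))\<^sup>2 * s"
      by (simp add: norm_fcoeff_Curl[OF v] s_def)
    ultimately show "1 / 2 * ((1 + (norm (freq h))\<^sup>2) * ((norm (fcoeff v h))\<^sup>2 / A)) + \<beta>\<^sup>2 * ((norm (fcoeff v h))\<^sup>2 / A)
        \<le> (norm (fcoeff (Curl v) h))\<^sup>2 / A + (3 * (norm \<xi>)\<^sup>2 + 1) * ((norm (fcoeff v h))\<^sup>2 / A)"
      unfolding s_def[symmetric] by (simp add: algebra_simps)
  qed
  also have "(L2.nrm (Curl v))\<^sup>2 \<le> N\<^sup>2 * Re (form v v)"
    using form_nrm_lower[OF v] unfolding Fm.nrm_sq[OF v] .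
  finally show ?thesis unfolding L2_norm_eq by simp
qed

lemma form_real: "v \<in> V \<Longrightarrow> form v v \<in> \<real>"
  using Fm.ip_self by simp

lemma L2_norm_diff: "L2_norm a1 a2 (\<lambda>x. f x - u x) = L2.nrm (f - u)"
  unfolding L2_norm_eq fun_diff_def ..

text \<open>Translation of the abstract diagonalisation: the spectrum is the set of the \<open>\<lambda>\<^sub>k\<close>, and the eigenspace of \<open>z\<close> is
  spanned by the finitely many \<open>e\<^sub>k\<close> with \<open>\<lambda>\<^sub>k = z\<close>.\<close>
lemma spectral_theorem:
  defines "T \<equiv> form_operator a1 a2 n \<xi> \<beta>"
  shows "self_adjoint a1 a2 H T \<and> discrete_spectrum a1 a2 H T \<and>
    (\<exists>lam :: nat \<Rightarrow> real. incseq lam \<and> (\<forall>k. lam k \<ge> 0) \<and> filterlim lam at_top sequentially \<and>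
       op_spectrum a1 a2 H T = range (\<lambda>k. complex_of_real (lam k)))"
proof -
  obtain e and lam :: "nat \<Rightarrow> real" where eV: "\<And>k. e k \<in> V" and "Hs.orthonormal_on UNIV e" "Hs.total e"
    and "\<And>k v. v \<in> V \<Longrightarrow> form (e k) v = of_real (lam k) * L2_inner a1 a2 (e k) v"
    and lam: "incseq lam" "\<And>k. 0 \<le> lam k" "filterlim lam at_top sequentially"
    using CF.eigenbasis by blast
  then interpret D: diagonal_form vscale H "L2_inner a1 a2" V form e lam
    by unfold_locales blast+
  have T: "T = CF.form_graph" unfolding T_def by (rule form_operator_eq)
  have TH: "u \<in> H \<and> f \<in> H" if "(u, f) \<in> T" for u f
    using that unfolding T D.form_graph_iff by blast
  have eH: "e k \<in> H" for k by (rule V_H[OF eV])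
  have ne: "L2.nrm (e k) = 1" for k
    using D.ip_ee[of k k] by (simp add: L2.nrm_def)
  have "densely_defined a1 a2 H T"
    unfolding densely_defined_def L2_norm_diff T using D.dense_domain by (metis DomainI)
  moreover have "adjoint_operator a1 a2 H T = T"
    unfolding adjoint_operator_def T by (rule D.adjoint_form_graph)
  ultimately have sa: "self_adjoint a1 a2 H T" by (simp add: self_adjoint_def)
  have shift: "(\<lambda>x. g x - z *s u x) = g - vscale z u" for g u z
    by (simp add: fun_diff_def vscale_def)
  have eig: "(e k, vscale (of_real (lam k)) (e k)) \<in> T" for k
    unfolding T by (rule D.eigenvector_in_graph)
  have spec: "op_spectrum a1 a2 H T = range (\<lambda>k. complex_of_real (lam k))"
  proof -
    have "z \<in> resolvent_set a1 a2 H T \<longleftrightarrow> z \<notin> range (\<lambda>k. complex_of_real (lam k))" for z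
    proof
      assume "z \<in> resolvent_set a1 a2 H T"
      then obtain B where B: "\<forall>(u, g)\<in>T. L2_norm a1 a2 u \<le> B * L2_norm a1 a2 (\<lambda>x. g x - z *s u x)"
        unfolding resolvent_set_def by blast
      show "z \<notin> range (\<lambda>k. complex_of_real (lam k))"
      proof
        assume "z \<in> range (\<lambda>k. complex_of_real (lam k))"
        then obtain k where k: "z = of_real (lam k)" by blast
        have "L2.nrm (e k) \<le> B * L2.nrm (vscale z (e k) - vscale z (e k))"
          using bspec[OF B eig[of k]] unfolding shift L2_norm_eq k by simp
        then show False by (simp add: ne)
      qed
    next
      assume "z \<notin> range (\<lambda>k. complex_of_real (lam k))"
      then have z: "complex_of_real (lam k) \<noteq> z" for k by blast
      have "\<exists>(u, g)\<in>T. AE x in M. g x - z *s u x = f x" if f: "f \<in> H" for f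
      proof -
        obtain u g where ug: "(u, g) \<in> T" "L2.nrm (g - vscale z u - f) = 0"
          using D.resolvent(1)[OF z] f unfolding T by blast
        have "g - vscale z u - f \<in> L2 a1 a2"
          using TH[OF ug(1)] f by (intro L2.mem_diff L2.mem_scale) auto
        then have "AE x in M. (g - vscale z u - f) x = 0"
          using ug(2) L2_nrm_zero_iff by blast
        then have "AE x in M. g x - z *s u x = f x"
          by eventually_elim simp
        then show ?thesis using ug(1) by blast
      qed
      moreover have "\<exists>B. \<forall>(u, g)\<in>T. L2_norm a1 a2 u \<le> B * L2_norm a1 a2 (\<lambda>x. g x - z *s u x)"
        using D.resolvent(2)[OF z] unfolding shift L2_norm_eq T .
      ultimately show "z \<in> resolvent_set a1 a2 H T"
        unfolding resolvent_set_def torus_measure_eq by blast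
    qed
    then show ?thesis unfolding op_spectrum_def by blast
  qed
  have "discrete_spectrum a1 a2 H T"
    unfolding discrete_spectrum_def
  proof (intro ballI conjI)
    fix z assume z: "z \<in> op_spectrum a1 a2 H T"
    then obtain k where k: "z = of_real (lam k)" unfolding spec by blast
    obtain \<delta> where \<delta>: "\<delta> > 0" "\<And>j. complex_of_real (lam j) \<noteq> z \<Longrightarrow> \<delta> \<le> cmod (of_real (lam j) - z)"
      using D.discrete_eigenvalues[of z] by blast
    have "op_spectrum a1 a2 H T \<inter> ball z \<delta> = {z}"
    proof (intro set_eqI iffI)
      fix y assume "y \<in> op_spectrum a1 a2 H T \<inter> ball z \<delta>"
      then obtain j where j: "y = of_real (lam j)" "dist z y < \<delta>" unfolding spec by auto
      have "\<not> \<delta> \<le> cmod (y - z)" using j(2) by (simp add: dist_norm norm_minus_commute)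
      then have "y = z" using \<delta>(2)[of j] unfolding j(1) by blast
      then show "y \<in> {z}" by simp
    qed (use z \<delta>(1) in simp)
    then show "z isolated_in op_spectrum a1 a2 H T"
      unfolding isolated_in_def using z by (intro conjI exI[of _ "ball z \<delta>"]) auto
    have "e k \<in> op_eigenspace T z"
      using eig[of k] unfolding op_eigenspace_def k vscale_def by simp
    moreover have "\<not> (AE x in M. e k x = 0)"
      unfolding L2_nrm_zero_iff[OF H_L2[OF eH], symmetric] ne by simp
    ultimately show "op_eigenvalue a1 a2 T z"
      unfolding op_eigenvalue_def torus_measure_eq by blast
    show "finite_multiplicity a1 a2 T z"
      unfolding finite_multiplicity_def torus_measure_eq
    proof (intro exI[of _ "e ` {j. complex_of_real (lam j) = z}"] conjI ballI)
      have "(e k, vscale z (e k)) \<in> CF.form_graph" using eig[of k] by (simp add: k T)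
      from D.eigenspace_expansion(1)[OF this]
      show fin: "finite (e ` {j. complex_of_real (lam j) = z})" by (rule finite_imageI)
      fix u assume "u \<in> op_eigenspace T z"
      then have u: "(u, vscale z u) \<in> CF.form_graph"
        unfolding op_eigenspace_def T vscale_def by simp
      define J where "J = {j. complex_of_real (lam j) = z}"
      define s where "s = (\<Sum>j\<in>J. vscale (L2_inner a1 a2 u (e j)) (e j))"
      have inj: "inj_on e J"
      proof (rule inj_onI)
        fix i j assume "e i = e j"
        then show "i = j" using D.ip_ee[of i j] D.ip_ee[of j j] by (auto split: if_splits)
      qed
      have uH: "u \<in> H" using TH[of u "vscale z u"] u T by blast
      have "s \<in> L2 a1 a2"
        unfolding s_def by (intro L2.mem_sum L2.mem_scale H_L2 eH)
      moreover have "L2.nrm (u - s) = 0"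
        using D.eigenspace_expansion(2)[OF u] unfolding s_def J_def .
      ultimately have "AE x in M. (u - s) x = 0"
        using L2_nrm_zero_iff[OF L2.mem_diff[OF H_L2[OF uH]]] by blast
      then have "AE x in M. u x = (\<Sum>b\<in>e ` J. L2_inner a1 a2 u b *s b x)"
      proof eventually_elim
        case (elim x)
        have "(\<Sum>b\<in>e ` J. L2_inner a1 a2 u b *s b x) = s x"
          unfolding sum.reindex[OF inj] s_def by simp
        then show ?case using elim by simp
      qed
      then show "\<exists>c. AE x in M. u x = (\<Sum>b\<in>e ` {j. complex_of_real (lam j) = z}. c b *s b x)"
        unfolding J_def by blast
    qed
  qed
  then show ?thesis using sa spec lam by blast
qed

end

lemma Linf_AE_bound:
  assumes "f \<in> Linf M"
  shows "\<exists>B. AE x in M. \<bar>f x\<bar> \<le> B"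
proof -
  define s where "s = esssup M (\<lambda>x. ereal \<bar>f x\<bar>)"
  have "s < \<infinity>" using assms by (simp add: Linf_def Linf_norm_def s_def)
  have "AE x in M. ereal \<bar>f x\<bar> \<le> s" unfolding s_def by (rule esssup_AE)
  then have "AE x in M. \<bar>f x\<bar> \<le> real_of_ereal s"
  proof eventually_elim
    case (elim x)
    then show ?case using \<open>s < \<infinity>\<close> by (cases s) auto
  qed
  then show ?thesis by blast
qed

theorem theorem4p1:
  fixes a1 a2 :: "real^2"
    and mu :: "real^3 \<Rightarrow> real" and mu0 :: real
    and eps :: "real^2 \<Rightarrow> real" and eps0 :: real
    and n :: "real^2 \<Rightarrow> real"
    and \<xi> :: "real^2" and \<beta> :: real
  assumes "a1 \<noteq> a2" and "independent {a1, a2}"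
    and "\<forall>x. mu x = mu0"
    and "periodic a1 a2 eps" and "\<forall>x. eps x > 0"
    and "eps \<in> Linf lebesgue" and "(\<lambda>x. 1 / eps x) \<in> Linf lebesgue"
    and "eps0 > 0" and "\<forall>x. n x > 0" and "\<forall>x. eps x = eps0 * (n x)\<^sup>2"
    and "\<xi> \<in> brillouin_zone (period_lattice a1 a2)"
  shows "form_domain a1 a2 \<xi> \<beta> \<subseteq> H1 a1 a2 \<and>
    (\<forall>v\<in>form_domain a1 a2 \<xi> \<beta>.
       curl_form a1 a2 n \<xi> \<beta> v v \<in> \<real> \<and>
       (real_of_ereal (Linf_norm (torus_measure a1 a2) n))\<^sup>2 * Re (curl_form a1 a2 n \<xi> \<beta> v v)
         + (3 * (norm \<xi>)\<^sup>2 + 1) * (L2_norm a1 a2 v)\<^sup>2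
       \<ge> 1 / 2 * (H1_norm a1 a2 v)\<^sup>2 + \<beta>\<^sup>2 * (L2_norm a1 a2 v)\<^sup>2) \<and>
    form_operator a1 a2 n \<xi> \<beta> = curl_curl_operator a1 a2 n \<xi> \<beta> \<and>
    self_adjoint a1 a2 (div_free a1 a2 \<xi> \<beta>) (form_operator a1 a2 n \<xi> \<beta>) \<and>
    discrete_spectrum a1 a2 (div_free a1 a2 \<xi> \<beta>) (form_operator a1 a2 n \<xi> \<beta>) \<and>
    (\<exists>lam :: nat \<Rightarrow> real. incseq lam \<and> (\<forall>k. lam k \<ge> 0) \<and> filterlim lam at_top sequentially \<and>
       op_spectrum a1 a2 (div_free a1 a2 \<xi> \<beta>) (form_operator a1 a2 n \<xi> \<beta>)
         = range (\<lambda>k. complex_of_real (lam k)))"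
proof -
  interpret torus a1 a2 by unfold_locales fact+
  have npos: "n x > 0" and eps: "eps x = eps0 * (n x)\<^sup>2" for x
    using assms by auto
  have n_sqrt: "n = (\<lambda>x. sqrt (eps x / eps0))"
  proof
    fix x
    have "eps x / eps0 = (n x)\<^sup>2" using eps[of x] \<open>eps0 > 0\<close> by simp
    then show "n x = sqrt (eps x / eps0)" using npos[of x] by simp
  qed
  have "eps \<in> borel_measurable lebesgue"
    using \<open>eps \<in> Linf lebesgue\<close> by (simp add: Linf_def)
  then have nm: "n \<in> borel_measurable lebesgue" unfolding n_sqrt by measurable
  have nper: "periodic a1 a2 n"
    using \<open>periodic a1 a2 eps\<close> unfolding n_sqrt periodic_def by simp
  have to_M: "AE x in M. Q x" if "AE x in lebesgue. Q x" for Q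
    unfolding AE_M using that by eventually_elim simp
  obtain E where "AE x in lebesgue. \<bar>eps x\<bar> \<le> E"
    using Linf_AE_bound[OF \<open>eps \<in> Linf lebesgue\<close>] by blast
  then have E: "AE x in M. \<bar>eps x\<bar> \<le> E" by (rule to_M)
  obtain D where "AE x in lebesgue. \<bar>1 / eps x\<bar> \<le> D"
    using Linf_AE_bound[OF \<open>(\<lambda>x. 1 / eps x) \<in> Linf lebesgue\<close>] by blast
  then have D: "AE x in M. \<bar>1 / eps x\<bar> \<le> D" by (rule to_M)
  have exists_point: "\<exists>x. Q x" if "AE x in M. Q x" for Q
  proof (rule ccontr)
    assume "\<nexists>x. Q x"
    then have "AE x in M. False" using that by simp
    then have "emeasure M (space M) = 0"
      by (subst AE_iff_measurable[OF sets.top, of M "\<lambda>_. False", symmetric]) simp_all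
    then show False using emeasure_M_pos by simp
  qed
  define s where "s = Linf_norm M n"
  define N where "N = real_of_ereal s"
  have "AE x in M. ereal \<bar>n x\<bar> \<le> ereal (sqrt (E / eps0))"
    using E
  proof eventually_elim
    case (elim x)
    then have "sqrt (eps x / eps0) \<le> sqrt (E / eps0)"
      using \<open>eps0 > 0\<close> by (simp add: divide_right_mono)
    then show ?case using npos[of x] unfolding fun_cong[OF n_sqrt] by simp
  qed
  then have s_le: "s \<le> ereal (sqrt (E / eps0))"
    unfolding s_def Linf_norm_def
    by (intro esssup_I) (use measurable_M[OF nm] in measurable)
  have s_ge: "AE x in M. ereal \<bar>n x\<bar> \<le> s"
    unfolding s_def Linf_norm_def by (rule esssup_AE)
  then obtain x0 where x0: "ereal \<bar>n x0\<bar> \<le> s" using exists_point by blast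
  have sN: "s = ereal N"
    using s_le x0 by (cases s) (auto simp: N_def)
  have Npos: "N > 0" using x0 npos[of x0] unfolding sN by simp
  have N: "AE x in M. n x \<le> N"
    using s_ge unfolding sN by eventually_elim simp
  have C: "AE x in M. 1 / (n x)\<^sup>2 \<le> eps0 * D"
    using D
  proof eventually_elim
    case (elim x)
    have "1 / (n x)\<^sup>2 = eps0 * (1 / eps x)" using eps[of x] \<open>eps0 > 0\<close> by simp
    also have "\<dots> \<le> eps0 * D" using order_trans[OF abs_ge_self elim] \<open>eps0 > 0\<close> by (intro mult_left_mono) auto
    finally show ?case .
  qed
  obtain x1 where x1: "1 / (n x1)\<^sup>2 \<le> eps0 * D" using exists_point[OF C] by blast
  have "1 / (n x1)\<^sup>2 > 0" using npos[of x1] by simp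
  then have Cpos: "eps0 * D > 0" using x1 by linarith
  interpret medium a1 a2 n \<xi> \<beta> N "eps0 * D"
    by unfold_locales (fact npos nm nper N Npos C Cpos)+
  have "real_of_ereal (Linf_norm (torus_measure a1 a2) n) = N"
    by (simp add: torus_measure_eq N_def s_def)
  then show ?thesis
    using V_H1 form_real Garding curl_curl_eq spectral_theorem by (simp only:) blast
qed

end
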